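(* Let $n=2$, let $\delta>0$, $\mu>0$, $\kappa>0$ and $0<\theta\le 2$ be fixed. For $u_0\in H^2(\mathbf{R}^2)$ and $u_1\in H^\theta(\mathbf{R}^2)$ let $u$ be the solution of $$u_{tt}+\delta(-\Delta)^\theta u_{tt}+\mu\Delta^2u-\kappa\Delta u=0\ \text{ in }(0,\infty)\times\mathbf{R}^2,\qquad u(0,x)=u_0(x),\ u_t(0,x)=u_1(x).$$ (i) There is a constant $C_1>0$ such that, for all $u_0\in H^2(\mathbf{R}^2)$ and $u_1\in H^\theta(\mathbf{R}^2)\cap L^1(\mathbf{R}^2)$, $$\|u(t,\cdot)\|_{L^2(\mathbf{R}^2)}\le C_1 I_{0,2}\sqrt{\log t}\qquad\text{for all sufficiently large } t,$$ where $I_{0,2}:=\|u_1\|_{L^2(\mathbf{R}^2)}+\|u_1\|_{L^1(\mathbf{R}^2)}$. (ii) For every $\gamma\in(0,1]$ there is a constant $C_2>0$ such that, for all $u_0\in H^2(\mathbf{R}^2)$ and $u_1\in H^\theta(\mathbf{R}^2)\cap L^{1,\gamma}(\mathbf{R}^2)$, $$C_2\left|\int_{\mathbf{R}^2}u_1(x)\,dx\right|\sqrt{\log t}\le\|u(t,\cdot)\|_{L^2(\mathbf{R}^2)}\qquad\text{for all sufficiently large } t.$$ For the fixed values of $\delta,\mu,\kappa,\theta$, the constants $C_1,C_2$ depend only on the space dimension and $\gamma$ (in particular not on the data or on $t$).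
   Context: The Fourier transform is $\hat f(\xi)=\int_{\mathbf{R}^n}e^{-ix\cdot\xi}f(x)\,dx$, and $(-\Delta)^\theta u:=\mathcal{F}^{-1}(|\xi|^{2\theta}\hat u)$. $L^{1,\gamma}(\mathbf{R}^n)$ is the set of $f\in L^1(\mathbf{R}^n)$ with $\|f\|_{1,\gamma}:=\int_{\mathbf{R}^n}(1+|x|^\gamma)|f(x)|\,dx<\infty$. "The solution" is the unique mild solution $u\in C([0,\infty);H^2(\mathbf{R}^n))\cap C^1([0,\infty);H^\theta(\mathbf{R}^n))$; on the Fourier side it is given by $$\hat u(t,\xi)=\cos(tf(|\xi|))\hat u_0(\xi)+\frac{\sin(tf(|\xi|))}{f(|\xi|)}\hat u_1(\xi),\qquad f(r)=\sqrt{\frac{\mu r^4+\kappa r^2}{1+\delta r^{2\theta}}}.$$ "For all sufficiently large $t$" means: there is $T>1$, which may depend on the data $u_0,u_1$ and on the parameters, such that the estimate holds for all $t\ge T$.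
   Formalization: In part (i) the case where u_1 = 0 a.e. but u_0 is not 0 a.e. is excluded, because then I_{0,2} = 0 while the norm of u(t) is positive for every t, so the stated bound fails. *)

theory Defs
  imports "HOL-Analysis.Analysis"
begin

definition L2 :: "('a::euclidean_space \<Rightarrow> complex) set" where
  "L2 = {f. f \<in> borel_measurable lborel \<and> integrable lborel (\<lambda>x. (cmod (f x))\<^sup>2)}"

definition L2_norm :: "('a::euclidean_space \<Rightarrow> complex) \<Rightarrow> real" where
  "L2_norm f = sqrt (\<integral>x. (cmod (f x))\<^sup>2 \<partial>lborel)"

definition L1_norm :: "('a::euclidean_space \<Rightarrow> complex) \<Rightarrow> real" where
  "L1_norm f = (\<integral>x. cmod (f x) \<partial>lborel)"

definition L1_weighted :: "real \<Rightarrow> ('a::euclidean_space \<Rightarrow> complex) set" where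
  "L1_weighted \<gamma> =
     {f. integrable lborel f \<and> integrable lborel (\<lambda>x. (1 + norm x powr \<gamma>) * cmod (f x))}"

definition fourier_integral :: "('a::euclidean_space \<Rightarrow> complex) \<Rightarrow> 'a \<Rightarrow> complex" where
  "fourier_integral f \<xi> = (\<integral>x. exp (- (\<i> * of_real (x \<bullet> \<xi>))) * f x \<partial>lborel)"

text \<open>The Fourier transform on \<open>L2\<close> is the \<open>L2\<close> limit of the transforms of the truncations of
  \<open>f\<close> to balls. It is determined up to null sets only; \<open>fourier f\<close> is some representative, so
  equations between transforms are meant almost everywhere. For \<open>f\<close> both in \<open>L2\<close> and integrable
  it agrees almost everywhere with \<open>fourier_integral f\<close>.\<close>

definition is_fourier_transform ::
    "('a::euclidean_space \<Rightarrow> complex) \<Rightarrow> ('a \<Rightarrow> complex) \<Rightarrow> bool" where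
  "is_fourier_transform f g \<longleftrightarrow> g \<in> L2 \<and>
     ((\<lambda>R. \<integral>\<^sup>+\<xi>. ennreal ((cmod (fourier_integral (\<lambda>x. indicat_real (cball 0 R) x *\<^sub>R f x) \<xi> - g \<xi>))\<^sup>2)
         \<partial>lborel) \<longlongrightarrow> 0) at_top"

definition fourier :: "('a::euclidean_space \<Rightarrow> complex) \<Rightarrow> 'a \<Rightarrow> complex" where
  "fourier f = (SOME g. is_fourier_transform f g)"

definition bessel_weight :: "real \<Rightarrow> ('a::euclidean_space \<Rightarrow> complex) \<Rightarrow> 'a \<Rightarrow> complex" where
  "bessel_weight s g \<xi> = of_real ((1 + (norm \<xi>)\<^sup>2) powr (s / 2)) * g \<xi>"

definition sobolev :: "real \<Rightarrow> ('a::euclidean_space \<Rightarrow> complex) set" where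
  "sobolev s = {f \<in> L2. bessel_weight s (fourier f) \<in> L2}"

definition sobolev_norm :: "real \<Rightarrow> ('a::euclidean_space \<Rightarrow> complex) \<Rightarrow> real" where
  "sobolev_norm s f = L2_norm (bessel_weight s (fourier f))"

definition continuous_in_sobolev ::
    "real \<Rightarrow> (real \<Rightarrow> 'a::euclidean_space \<Rightarrow> complex) \<Rightarrow> bool" where
  "continuous_in_sobolev s w \<longleftrightarrow> (\<forall>t\<ge>0. w t \<in> sobolev s) \<and>
     (\<forall>t\<ge>0. ((\<lambda>r. sobolev_norm s (\<lambda>x. w r x - w t x)) \<longlongrightarrow> 0) (at t within {0..}))"

definition has_sobolev_time_derivative ::
    "real \<Rightarrow> (real \<Rightarrow> 'a::euclidean_space \<Rightarrow> complex) \<Rightarrow> (real \<Rightarrow> 'a \<Rightarrow> complex) \<Rightarrow> bool" where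
  "has_sobolev_time_derivative s w v \<longleftrightarrow>
     (\<forall>t\<ge>0. ((\<lambda>r. sobolev_norm s (\<lambda>x. (w r x - w t x) /\<^sub>R (r - t) - v t x)) \<longlongrightarrow> 0)
        (at t within {0..}))"

text \<open>Up to the factor \<open>(2\<pi>)\<^sup>n\<close> from Parseval's identity, \<open>multiplier_pairing m w g\<close> is
  the duality pairing of the distribution with Fourier transform \<open>m(|\<xi>|)\<close> times that of \<open>w\<close>
  against the function whose Fourier transform is \<open>g\<close>. The multiplier \<open>r\<^sup>2\<^sup>\<theta>\<close> gives
  \<open>(-\<Delta>)\<^sup>\<theta>\<close>, \<open>r\<^sup>2\<close> gives \<open>-\<Delta>\<close>, and \<open>r\<^sup>4\<close> gives \<open>\<Delta>\<^sup>2\<close>.\<close>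

definition multiplier_pairing ::
    "(real \<Rightarrow> real) \<Rightarrow> ('a::euclidean_space \<Rightarrow> complex) \<Rightarrow> ('a \<Rightarrow> complex) \<Rightarrow> complex" where
  "multiplier_pairing m w g = (\<integral>\<xi>. of_real (m (norm \<xi>)) * fourier w \<xi> * cnj (g \<xi>) \<partial>lborel)"

text \<open>Mild solution of \<open>u\<^sub>t\<^sub>t + \<delta>(-\<Delta>)\<^sup>\<theta>u\<^sub>t\<^sub>t + \<mu>\<Delta>\<^sup>2u - \<kappa>\<Delta>u = 0\<close>, in the usual sense of evolution
  equations: with \<open>v = u\<^sub>t\<close>, the equation integrated in time,
  \<open>(I + \<delta>(-\<Delta>)\<^sup>\<theta>)(v(t) - u\<^sub>1) + \<integral>\<^sub>0\<^sup>t (\<mu>\<Delta>\<^sup>2 - \<kappa>\<Delta>)u(s) ds = 0\<close>, holds for every \<open>t \<ge> 0\<close>. For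
  \<open>u(s)\<close> in \<open>H\<^sup>2\<close> it is an identity in the dual of \<open>H\<^sup>2\<close>, hence the test functions: \<open>g\<close> ranges
  over the Fourier transforms of the functions of \<open>H\<^sup>2\<close>. All pairings that occur converge
  absolutely by the Cauchy-Schwarz inequality when \<open>\<theta> \<le> 2\<close>.\<close>

definition mild_solution ::
    "real \<Rightarrow> real \<Rightarrow> real \<Rightarrow> real \<Rightarrow> ('a::euclidean_space \<Rightarrow> complex) \<Rightarrow> ('a \<Rightarrow> complex)
      \<Rightarrow> (real \<Rightarrow> 'a \<Rightarrow> complex) \<Rightarrow> bool" where
  "mild_solution \<delta> \<mu> \<kappa> \<theta> u0 u1 u \<longleftrightarrow> continuous_in_sobolev 2 u \<and>
     (\<exists>v. has_sobolev_time_derivative \<theta> u v \<and> continuous_in_sobolev \<theta> v \<and>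
        (AE x in lborel. u 0 x = u0 x) \<and> (AE x in lborel. v 0 x = u1 x) \<and>
        (\<forall>t\<ge>0. \<forall>g. bessel_weight 2 g \<in> L2 \<longrightarrow>
           multiplier_pairing (\<lambda>r. 1 + \<delta> * r powr (2 * \<theta>)) (\<lambda>x. v t x - u1 x) g
           + integral {0..t} (\<lambda>s. multiplier_pairing (\<lambda>r. \<mu> * r ^ 4 + \<kappa> * r\<^sup>2) (u s) g) = 0))"

end

theory Submission
  imports Defs "HOL-Probability.Probability"
begin

text \<open>By Plancherel's theorem all norms may be computed on the Fourier side. There the weak equation
  decouples into one oscillator for each frequency, so the transform of the solution is
  \<open>cos (t f) u0^ + sin (t f) / f \<cdot> u1^\<close> with \<open>f(|\<xi>|) \<approx> \<surd>\<kappa> |\<xi>|\<close> near the origin. The first term stays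
  bounded in \<open>L\<^sup>2\<close>, and so does the second one away from the origin. For \<open>|\<xi>| \<le> 1\<close> the square of
  \<open>sin (t f) / f\<close> is at most a constant times \<open>min (t\<^sup>2) (|\<xi>|\<^sup>-\<^sup>2)\<close>; about \<open>log t\<close> dyadic annuli
  contribute \<open>O(1)\<close> each to its integral. Conversely, each dyadic shell with \<open>1/t \<lesssim> |\<xi>| \<le> \<epsilon>\<close> contributes a fixed amount:
  shifting a box horizontally by \<open>\<pi> / (2 t \<surd>\<kappa>)\<close> moves the phase \<open>t f\<close> by about a quarter period,
  so \<open>sin\<^sup>2\<close> cannot be small on both the box and its translate; and \<open>|u1^| \<ge> |\<integral> u1| / 2\<close> near the
  origin because \<open>u1^\<close> is continuous.\<close>


section \<open>Square-integrable functions\<close>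

text \<open>A mild solution is differentiable in time only in norms taken over all frequencies, so
  the oscillator equation cannot be handled at a single frequency. Duality replaces this:
  \<open>U\<close> and \<open>V\<close> are paired with explicit solutions of the adjoint problem
  that run backward from time \<open>T\<close>. Cutting frequencies to bounded sets makes the
  multipliers involved bounded, and enough test functions remain to conclude almost everywhere. The
  data-dependent time threshold is what keeps the constants uniform. The norm of \<open>u0\<close>
  and the radius on which the transform of \<open>u1\<close> stays large depend on the data but not
  on \<open>t\<close>, whereas \<open>sqrt (ln t)\<close> is unbounded, so they only enlarge the
  threshold. Boxes instead of annuli let the lower bound do without polar coordinates: a translation
  preserves Lebesgue measure, and near the horizontal axis it acts almost like a radial motion. The
  dimension enters through one cancellation: the area of a ball of radius \<open>2^-k\<close>,
  proportional to \<open>4^-k\<close>, against the size \<open>4^k\<close> of the squared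
  multiplier.\<close>

lemma L2_measurable [measurable_dest]: "f \<in> L2 \<Longrightarrow> f \<in> borel_measurable lborel"
  by (simp add: L2_def)

lemma L2_integrable_square: "f \<in> L2 \<Longrightarrow> integrable lborel (\<lambda>x. (cmod (f x))\<^sup>2)"
  by (simp add: L2_def)

lemma L2_norm_nonneg [simp]: "0 \<le> L2_norm f"
  by (simp add: L2_norm_def)

lemma L2_norm_square: "(L2_norm f)\<^sup>2 = (\<integral>x. (cmod (f x))\<^sup>2 \<partial>lborel)"
  by (simp add: L2_norm_def)

lemma nn_integral_L2:
  assumes "f \<in> L2"
  shows "(\<integral>\<^sup>+x. ennreal ((cmod (f x))\<^sup>2) \<partial>lborel) = ennreal ((L2_norm f)\<^sup>2)"
  unfolding L2_norm_square by (rule nn_integral_eq_integral[OF L2_integrable_square[OF assms]]) simp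

lemma L2I_nn_integral:
  assumes [measurable]: "f \<in> borel_measurable lborel"
    and "(\<integral>\<^sup>+x. ennreal ((cmod (f x))\<^sup>2) \<partial>lborel) \<le> ennreal (c\<^sup>2)" and "0 \<le> c"
  shows "f \<in> L2" "L2_norm f \<le> c"
proof -
  have "integrable lborel (\<lambda>x. (cmod (f x))\<^sup>2)"
    using le_less_trans[OF assms(2) ennreal_less_top] by (intro integrableI_bounded) auto
  then show *: "f \<in> L2" by (simp add: L2_def)
  have "(L2_norm f)\<^sup>2 \<le> c\<^sup>2"
    using assms(2) nn_integral_L2[OF *] by (simp add: ennreal_le_iff)
  then show "L2_norm f \<le> c" using assms(3) power2_le_imp_le by blast
qed

lemma L2_norm_cong_AE:
  assumes "f \<in> borel_measurable lborel" "g \<in> borel_measurable lborel" "AE x in lborel. f x = g x"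
  shows "L2_norm f = L2_norm g"
proof -
  have "(\<integral>x. (cmod (f x))\<^sup>2 \<partial>lborel) = (\<integral>x. (cmod (g x))\<^sup>2 \<partial>lborel)"
    using assms by (intro integral_cong_AE) auto
  then show ?thesis by (simp add: L2_norm_def)
qed

lemma L2_cong_AE:
  assumes "f \<in> L2" "g \<in> borel_measurable lborel" "AE x in lborel. f x = g x"
  shows "g \<in> L2"
proof -
  have "integrable lborel (\<lambda>x. (cmod (g x))\<^sup>2)"
    by (rule integrable_cong_AE_imp[OF L2_integrable_square[OF assms(1)]]) (use assms in auto)
  then show ?thesis using assms(2) by (simp add: L2_def)
qed

lemma L2_mono:
  assumes "f \<in> L2" "g \<in> borel_measurable lborel" "AE x in lborel. cmod (g x) \<le> cmod (f x)"
  shows "g \<in> L2" "L2_norm g \<le> L2_norm f"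
proof -
  have "(\<integral>\<^sup>+x. ennreal ((cmod (g x))\<^sup>2) \<partial>lborel) \<le> (\<integral>\<^sup>+x. ennreal ((cmod (f x))\<^sup>2) \<partial>lborel)"
    using assms(3) by (intro nn_integral_mono_AE) (auto intro!: ennreal_leI power_mono)
  then have "(\<integral>\<^sup>+x. ennreal ((cmod (g x))\<^sup>2) \<partial>lborel) \<le> ennreal ((L2_norm f)\<^sup>2)"
    using nn_integral_L2[OF assms(1)] by simp
  from L2I_nn_integral[OF assms(2) this] show "g \<in> L2" "L2_norm g \<le> L2_norm f" by auto
qed

lemma L2_cmult:
  assumes "f \<in> L2"
  shows "(\<lambda>x. c * f x) \<in> L2" "L2_norm (\<lambda>x. c * f x) = cmod c * L2_norm f"
proof -
  show "(\<lambda>x. c * f x) \<in> L2"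
    using assms by (auto simp: L2_def norm_mult power_mult_distrib)
  show "L2_norm (\<lambda>x. c * f x) = cmod c * L2_norm f"
    by (simp add: L2_norm_def norm_mult power_mult_distrib real_sqrt_mult)
qed

text \<open>The infinite case is excluded because its square would be infinite too. This lets
  Cauchy-Schwarz, stated for squares of extended integrals, yield finiteness.\<close>

lemma ennreal_le_of_power2:
  assumes "a\<^sup>2 \<le> ennreal (c\<^sup>2)" "0 \<le> c"
  shows "a \<le> ennreal c"
proof (cases a rule: ennreal_cases)
  case (real r)
  then have "r\<^sup>2 \<le> c\<^sup>2" using assms by (simp add: ennreal_power)
  then show ?thesis using real assms(2) by (auto intro!: ennreal_leI intro: power2_le_imp_le)
next
  case top
  then show ?thesis using assms by (simp add: power2_eq_square top_unique)
qed

lemma L2_norm_le_scaled: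
  assumes "f \<in> L2" "g \<in> borel_measurable lborel" "\<And>x. cmod (g x) \<le> cmod (of_real c * f x)"
  shows "L2_norm g \<le> \<bar>c\<bar> * L2_norm f"
  using L2_mono(2)[OF L2_cmult(1)[OF assms(1), of "of_real c"] assms(2) AE_I2[OF assms(3)]]
  by (simp add: L2_cmult(2)[OF assms(1)])

text \<open>Cauchy-Schwarz for extended integrals presupposes no integrability, so one estimate
  yields both the integrability of the product and the bound.\<close>

lemma L2_mult_integrable_aux:
  assumes f: "f \<in> L2" and g: "g \<in> L2"
  shows "integrable lborel (\<lambda>x. f x * g x)"
    and "(\<integral>x. cmod (f x) * cmod (g x) \<partial>lborel) \<le> L2_norm f * L2_norm g"
proof -
  note [measurable] = L2_measurable[OF f] L2_measurable[OF g]
  have "(\<integral>\<^sup>+x. ennreal (cmod (f x)) * ennreal (cmod (g x)) \<partial>lborel)\<^sup>2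
      \<le> (\<integral>\<^sup>+x. ennreal (cmod (f x)) ^ 2 \<partial>lborel) * (\<integral>\<^sup>+x. ennreal (cmod (g x)) ^ 2 \<partial>lborel)"
    by (rule Cauchy_Schwarz_nn_integral) auto
  also have "\<dots> = ennreal ((L2_norm f)\<^sup>2) * ennreal ((L2_norm g)\<^sup>2)"
    using nn_integral_L2[OF f] nn_integral_L2[OF g] by (simp add: ennreal_power)
  finally have *: "(\<integral>\<^sup>+x. ennreal (cmod (f x) * cmod (g x)) \<partial>lborel)\<^sup>2
      \<le> ennreal ((L2_norm f * L2_norm g)\<^sup>2)"
    by (simp add: ennreal_mult' power_mult_distrib)
  have **: "(\<integral>\<^sup>+x. ennreal (cmod (f x) * cmod (g x)) \<partial>lborel) \<le> ennreal (L2_norm f * L2_norm g)"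
    using * by (rule ennreal_le_of_power2) auto
  show 1: "integrable lborel (\<lambda>x. f x * g x)"
    using ** by (intro integrableI_bounded) (auto simp: norm_mult intro: le_less_trans)
  have "integrable lborel (\<lambda>x. cmod (f x) * cmod (g x))"
    using integrable_norm[OF 1] by (simp add: norm_mult)
  from nn_integral_eq_integral[OF this] **
  show "(\<integral>x. cmod (f x) * cmod (g x) \<partial>lborel) \<le> L2_norm f * L2_norm g"
    by (simp add: ennreal_le_iff)
qed

lemmas L2_mult_integrable = L2_mult_integrable_aux(1)
lemmas L2_Cauchy_Schwarz_abs = L2_mult_integrable_aux(2)

lemma L2_Cauchy_Schwarz:
  assumes "f \<in> L2" and "g \<in> L2"
  shows "cmod (\<integral>x. f x * g x \<partial>lborel) \<le> L2_norm f * L2_norm g"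
proof -
  have "cmod (\<integral>x. f x * g x \<partial>lborel) \<le> (\<integral>x. cmod (f x * g x) \<partial>lborel)"
    by (rule integral_norm_bound)
  then show ?thesis using L2_Cauchy_Schwarz_abs[OF assms] by (simp add: norm_mult)
qed

text \<open>Bounding the cross term of the expanded square by Cauchy-Schwarz produces a perfect
  square: Minkowski's inequality.\<close>

lemma L2_add:
  assumes f: "f \<in> L2" and g: "g \<in> L2"
  shows "(\<lambda>x. f x + g x) \<in> L2" "L2_norm (\<lambda>x. f x + g x) \<le> L2_norm f + L2_norm g"
proof -
  note [measurable] = L2_measurable[OF f] L2_measurable[OF g]
  let ?h = "\<lambda>x. (cmod (f x))\<^sup>2 + 2 * (cmod (f x) * cmod (g x)) + (cmod (g x))\<^sup>2"
  have i: "integrable lborel (\<lambda>x. cmod (f x) * cmod (g x))"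
    using integrable_norm[OF L2_mult_integrable[OF f g]] by (simp add: norm_mult)
  have ih: "integrable lborel ?h"
    using i L2_integrable_square[OF f] L2_integrable_square[OF g] by auto
  have "(\<integral>x. ?h x \<partial>lborel) = (L2_norm f)\<^sup>2 + 2 * (\<integral>x. cmod (f x) * cmod (g x) \<partial>lborel) + (L2_norm g)\<^sup>2"
    using i L2_integrable_square[OF f] L2_integrable_square[OF g] by (simp add: L2_norm_square)
  also have "\<dots> \<le> (L2_norm f + L2_norm g)\<^sup>2"
    using L2_Cauchy_Schwarz_abs[OF f g] by (simp add: power2_sum)
  finally have a: "(\<integral>x. ?h x \<partial>lborel) \<le> (L2_norm f + L2_norm g)\<^sup>2" .
  have p: "(cmod (f x + g x))\<^sup>2 \<le> ?h x" for x
  proof -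
    have "(cmod (f x + g x))\<^sup>2 \<le> (cmod (f x) + cmod (g x))\<^sup>2"
      by (intro power_mono norm_triangle_ineq) auto
    then show ?thesis by (simp add: power2_sum algebra_simps)
  qed
  have "(\<integral>\<^sup>+x. ennreal ((cmod (f x + g x))\<^sup>2) \<partial>lborel) \<le> (\<integral>\<^sup>+x. ennreal (?h x) \<partial>lborel)"
    by (intro nn_integral_mono ennreal_leI p)
  also have "\<dots> = ennreal (\<integral>x. ?h x \<partial>lborel)"
    by (rule nn_integral_eq_integral[OF ih]) auto
  also have "\<dots> \<le> ennreal ((L2_norm f + L2_norm g)\<^sup>2)"
    using a by (rule ennreal_leI)
  finally have "(\<integral>\<^sup>+x. ennreal ((cmod (f x + g x))\<^sup>2) \<partial>lborel) \<le> ennreal ((L2_norm f + L2_norm g)\<^sup>2)" .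
  from L2I_nn_integral[OF _ this]
  show "(\<lambda>x. f x + g x) \<in> L2" "L2_norm (\<lambda>x. f x + g x) \<le> L2_norm f + L2_norm g"
    by auto
qed

lemma L2_diff:
  assumes f: "f \<in> L2" and g: "g \<in> L2"
  shows "(\<lambda>x. f x - g x) \<in> L2" "L2_norm (\<lambda>x. f x - g x) \<le> L2_norm f + L2_norm g"
  using L2_add[OF f L2_cmult(1)[OF g, of "-1"]] L2_cmult(2)[OF g, of "-1"] by simp_all

lemma L2_norm_minus_commute: "L2_norm (\<lambda>x. f x - g x) = L2_norm (\<lambda>x. g x - f x)"
  by (simp add: L2_norm_def norm_minus_commute)

lemma L2_norm_triangle3:
  assumes "f \<in> L2" "g \<in> L2" "h \<in> L2"
  shows "L2_norm (\<lambda>x. f x - h x) \<le> L2_norm (\<lambda>x. f x - g x) + L2_norm (\<lambda>x. g x - h x)"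
  using L2_add(2)[OF L2_diff(1)[OF assms(1,2)] L2_diff(1)[OF assms(2,3)]] by simp

lemma L2_norm_diff_ge:
  assumes "f \<in> L2" "g \<in> L2"
  shows "\<bar>L2_norm f - L2_norm g\<bar> \<le> L2_norm (\<lambda>x. f x - g x)"
proof -
  have "L2_norm f \<le> L2_norm (\<lambda>x. f x - g x) + L2_norm g"
    using L2_add(2)[OF L2_diff(1)[OF assms] assms(2)] by simp
  moreover have "L2_norm g \<le> L2_norm (\<lambda>x. g x - f x) + L2_norm f"
    using L2_add(2)[OF L2_diff(1)[OF assms(2,1)] assms(1)] by simp
  ultimately show ?thesis using L2_norm_minus_commute[of f g] by simp
qed

lemma L2_norm_eq_0_iff:
  assumes "f \<in> L2"
  shows "L2_norm f = 0 \<longleftrightarrow> (AE x in lborel. f x = 0)"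
  unfolding L2_norm_def
  using integral_nonneg_eq_0_iff_AE[OF L2_integrable_square[OF assms]] by simp

section \<open>Fatou's lemma and completeness of \<open>L2\<close>\<close>

lemma L2_Fatou:
  assumes s: "\<And>n. s n \<in> L2" and b: "\<And>n. L2_norm (s n) \<le> c"
    and [measurable]: "f \<in> borel_measurable lborel"
    and lim: "AE x in lborel. (\<lambda>n. s n x) \<longlonglongrightarrow> f x"
  shows "f \<in> L2" "L2_norm f \<le> c"
proof -
  note [measurable] = L2_measurable[OF s]
  have c: "0 \<le> c" using b[of 0] L2_norm_nonneg[of "s 0"] by linarith
  have "(\<integral>\<^sup>+x. ennreal ((cmod (f x))\<^sup>2) \<partial>lborel) = (\<integral>\<^sup>+x. liminf (\<lambda>n. ennreal ((cmod (s n x))\<^sup>2)) \<partial>lborel)"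
  proof (rule nn_integral_cong_AE, use lim in eventually_elim)
    fix x assume "(\<lambda>n. s n x) \<longlonglongrightarrow> f x"
    then have "(\<lambda>n. ennreal ((cmod (s n x))\<^sup>2)) \<longlonglongrightarrow> ennreal ((cmod (f x))\<^sup>2)"
      by (intro tendsto_ennrealI tendsto_intros)
    then show "ennreal ((cmod (f x))\<^sup>2) = liminf (\<lambda>n. ennreal ((cmod (s n x))\<^sup>2))"
      by (metis lim_imp_Liminf sequentially_bot)
  qed
  also have "\<dots> \<le> liminf (\<lambda>n. \<integral>\<^sup>+x. ennreal ((cmod (s n x))\<^sup>2) \<partial>lborel)"
    by (rule nn_integral_liminf) measurable
  also have "\<dots> \<le> liminf (\<lambda>n::nat. ennreal (c\<^sup>2))"
    using b by (intro Liminf_mono always_eventually) (auto simp: nn_integral_L2[OF s] intro!: ennreal_leI power_mono)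
  also have "\<dots> = ennreal (c\<^sup>2)" by (simp add: Liminf_const)
  finally show "f \<in> L2" "L2_norm f \<le> c" using L2I_nn_integral[of f c] c by auto
qed

text \<open>The integrals of \<open>2^k\<close> times the squared increments are bounded by a
  geometric series, so these weighted squares are summable at almost every point; that forces the
  increments themselves to be absolutely summable.\<close>

lemma L2_AE_convergent_of_fast_Cauchy:
  assumes s: "\<And>n. s n \<in> L2" and d: "\<And>k. L2_norm (\<lambda>x. s (Suc k) x - s k x) \<le> (1/2) ^ k"
  shows "AE x in lborel. convergent (\<lambda>k. s k x)"
proof -
  note [measurable] = L2_measurable[OF s]
  let ?d = "\<lambda>k x. (cmod (s (Suc k) x - s k x))\<^sup>2"
  have "(\<integral>\<^sup>+x. (\<Sum>k. ennreal (2 ^ k * ?d k x)) \<partial>lborel) = (\<Sum>k. \<integral>\<^sup>+x. ennreal (2 ^ k * ?d k x) \<partial>lborel)"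
    by (rule nn_integral_suminf) measurable
  also have "\<dots> \<le> (\<Sum>k. ennreal ((1/2) ^ k))"
  proof (intro suminf_le allI)
    fix k
    have "(\<integral>\<^sup>+x. ennreal (2 ^ k * ?d k x) \<partial>lborel) = ennreal (2^k) * (\<integral>\<^sup>+x. ennreal (?d k x) \<partial>lborel)"
      by (simp add: ennreal_mult' nn_integral_cmult)
    also have "\<dots> = ennreal (2 ^ k * (L2_norm (\<lambda>x. s (Suc k) x - s k x))\<^sup>2)"
      by (simp add: nn_integral_L2[OF L2_diff(1)[OF s s]] ennreal_mult')
    also have "\<dots> \<le> ennreal (2 ^ k * ((1/2) ^ k)\<^sup>2)"
      using d by (intro ennreal_leI mult_left_mono power_mono) auto
    also have "2 ^ k * ((1/2) ^ k)\<^sup>2 = ((1/2) ^ k :: real)"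
      by (simp add: power2_eq_square power_divide field_simps)
    finally show "(\<integral>\<^sup>+x. ennreal (2 ^ k * ?d k x) \<partial>lborel) \<le> ennreal ((1/2) ^ k)" .
  qed auto
  also have "\<dots> < \<infinity>"
    by (subst suminf_ennreal2) (auto intro: summable_geometric)
  finally have "AE x in lborel. (\<Sum>k. ennreal (2 ^ k * ?d k x)) \<noteq> \<infinity>"
    by (intro nn_integral_noteq_infinite) auto
  then show ?thesis
  proof eventually_elim
    fix x assume "(\<Sum>k. ennreal (2 ^ k * ?d k x)) \<noteq> \<infinity>"
    then have sm: "summable (\<lambda>k. 2 ^ k * ?d k x)"
      by (intro summable_suminf_not_top) auto
    have "summable (\<lambda>k. (1/2) ^ k + 2 ^ k * ?d k x)"
      by (intro summable_add summable_geometric sm) simp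
    moreover have "cmod (s (Suc k) x - s k x) \<le> (1/2) ^ k + 2 ^ k * ?d k x" for k
    proof -
      \<comment> \<open>Either \<open>a \<le> p\<close> or \<open>a \<le> a^2 / p\<close>; with
        \<open>p = (1/2)^k\<close> an increment is bounded by two summable terms.\<close>
      have "a \<le> p + 1 / p * a\<^sup>2" if "p > 0" "a \<ge> 0" for a p :: real
      proof (cases "a \<le> p")
        case True then show ?thesis using that by (simp add: add_increasing2)
      next
        case False
        then have "a * p \<le> a * a" using that by (intro mult_left_mono) auto
        then have "a \<le> a\<^sup>2 / p" using that by (simp add: field_simps power2_eq_square)
        then show ?thesis using that by simp
      qed
      from this[of "(1/2)^k" "cmod (s (Suc k) x - s k x)"] show ?thesis
        by (simp add: power_divide)
    qed
    ultimately have "summable (\<lambda>k. s (Suc k) x - s k x)"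
      by (rule summable_comparison_test')
    then have "convergent (\<lambda>k. s 0 x + (\<Sum>i<k. s (Suc i) x - s i x))"
      by (intro convergent_add convergent_const) (simp add: summable_iff_convergent)
    then show "convergent (\<lambda>k. s k x)"
      by (simp add: sum_lessThan_telescope[of "\<lambda>k. s k x"])
  qed
qed

theorem L2_complete:
  assumes s: "\<And>n. s n \<in> L2"
    and cauchy: "\<And>e. e > 0 \<Longrightarrow> \<exists>N. \<forall>m\<ge>N. \<forall>n\<ge>N. L2_norm (\<lambda>x. s m x - s n x) \<le> e"
  shows "\<exists>g\<in>L2. (\<lambda>n. L2_norm (\<lambda>x. s n x - g x)) \<longlonglongrightarrow> 0"
proof -
  note [measurable] = L2_measurable[OF s]
  have "\<forall>k. \<exists>N. \<forall>m\<ge>N. \<forall>n\<ge>N. L2_norm (\<lambda>x. s m x - s n x) \<le> (1/2) ^ k"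
    using cauchy by simp
  then obtain N where N: "\<And>k m n. m \<ge> N k \<Longrightarrow> n \<ge> N k \<Longrightarrow> L2_norm (\<lambda>x. s m x - s n x) \<le> (1/2) ^ k"
    by metis
  \<comment> \<open>Summing the \<open>N i\<close> makes \<open>r\<close> monotone and at least
    \<open>N k\<close>, so consecutive terms along \<open>r\<close> differ by at most
    \<open>(1/2)^k\<close>.\<close>
  define r where "r k = (\<Sum>i\<le>k. N i) + k" for k
  have r: "N k \<le> r k" "r k \<le> r (Suc k)" for k
    by (auto simp: r_def intro: trans_le_add1 member_le_sum)
  have rmono: "mono r" using r(2) by (simp add: mono_iff_le_Suc)
  have "AE x in lborel. convergent (\<lambda>k. s (r k) x)"
    by (rule L2_AE_convergent_of_fast_Cauchy) (use s N r le_trans in \<open>blast+\<close>)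
  then have lim: "AE x in lborel. (\<lambda>k. s (r k) x) \<longlonglongrightarrow> lim (\<lambda>k. s (r k) x)"
    by eventually_elim (simp add: convergent_LIMSEQ_iff)
  define g where "g x = lim (\<lambda>k. s (r k) x)" for x
  have [measurable]: "g \<in> borel_measurable lborel"
    unfolding g_def by measurable
  \<comment> \<open>For fixed \<open>n\<close> the Cauchy bound survives the pointwise limit in
    \<open>j\<close> by \<open>L2_Fatou\<close>. The offset in \<open>r (j + k)\<close> places every
    term beyond \<open>N k\<close>.\<close>
  have *: "(\<lambda>x. s n x - g x) \<in> L2 \<and> L2_norm (\<lambda>x. s n x - g x) \<le> (1/2) ^ k" if n: "n \<ge> N k" for n k
  proof -
    have "\<And>j. (\<lambda>x. s n x - s (r (j + k)) x) \<in> L2"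
      by (intro L2_diff s)
    moreover have "L2_norm (\<lambda>x. s n x - s (r (j + k)) x) \<le> (1/2) ^ k" for j
      using r(1)[of k] monoD[OF rmono, of k "j + k"] n by (intro N) auto
    moreover have "AE x in lborel. (\<lambda>j. s n x - s (r (j + k)) x) \<longlonglongrightarrow> s n x - g x"
      using lim by eventually_elim (auto simp: g_def intro!: tendsto_intros LIMSEQ_ignore_initial_segment)
    ultimately show ?thesis
      using L2_Fatou[of "\<lambda>j x. s n x - s (r (j + k)) x" "(1/2)^k" "\<lambda>x. s n x - g x"] by auto
  qed
  have "g \<in> L2"
    using L2_diff(1)[OF s[of "N 0"] conjunct1[OF *[of 0 "N 0"]]] by simp
  moreover have "(\<lambda>n. L2_norm (\<lambda>x. s n x - g x)) \<longlonglongrightarrow> 0"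
  proof (rule LIMSEQ_I)
    fix e :: real assume "e > 0"
    then obtain k where k: "(1/2) ^ k < e"
      using real_arch_pow_inv[of e "1/2"] by auto
    show "\<exists>no. \<forall>n\<ge>no. norm (L2_norm (\<lambda>x. s n x - g x) - 0) < e"
      using * k by (intro exI[of _ "N k"]) (auto intro: le_less_trans)
  qed
  ultimately show ?thesis by blast
qed

section \<open>Gaussians and translations\<close>

lemma lborel_affine_integral:
  fixes f :: "'a::euclidean_space \<Rightarrow> 'b::{banach, second_countable_topology}"
  assumes [measurable]: "f \<in> borel_measurable lborel" and c: "c \<noteq> 0"
  shows "integrable lborel (\<lambda>x. f (t + c *\<^sub>R x)) \<longleftrightarrow> integrable lborel f"
    and "(\<integral>x. f x \<partial>lborel) = \<bar>c\<bar> ^ DIM('a) *\<^sub>R (\<integral>x. f (t + c *\<^sub>R x) \<partial>lborel)"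
proof -
  have m: "f \<in> borel_measurable borel" by simp
  note [measurable] = m
  have pos: "\<bar>c\<bar> ^ DIM('a) \<noteq> 0" using c by simp
  show "integrable lborel (\<lambda>x. f (t + c *\<^sub>R x)) \<longleftrightarrow> integrable lborel f"
  proof -
    have "integrable lborel f \<longleftrightarrow> integrable lborel (\<lambda>x. \<bar>c\<bar> ^ DIM('a) *\<^sub>R f (t + c *\<^sub>R x))"
      by (subst lborel_affine[OF c, of t]) (simp add: integrable_density integrable_distr_eq)
    moreover have "integrable lborel (\<lambda>x. f (t + c *\<^sub>R x))"
      if "integrable lborel (\<lambda>x. \<bar>c\<bar> ^ DIM('a) *\<^sub>R f (t + c *\<^sub>R x))"
      using integrable_scaleR_right[OF that, of "inverse (\<bar>c\<bar> ^ DIM('a))"] pos by simp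
    ultimately show ?thesis by auto
  qed
  show "(\<integral>x. f x \<partial>lborel) = \<bar>c\<bar> ^ DIM('a) *\<^sub>R (\<integral>x. f (t + c *\<^sub>R x) \<partial>lborel)"
    by (subst lborel_affine[OF c, of t]) (simp add: integral_density integral_distr)
qed

lemma lborel_translation_integral:
  fixes f :: "'a::euclidean_space \<Rightarrow> 'b::{banach, second_countable_topology}"
  assumes "f \<in> borel_measurable lborel"
  shows "integrable lborel (\<lambda>x. f (x + t)) \<longleftrightarrow> integrable lborel f"
    and "(\<integral>x. f (x + t) \<partial>lborel) = (\<integral>x. f x \<partial>lborel)"
  using lborel_affine_integral[OF assms, of 1 t] by (simp_all add: add.commute)

lemma lborel_translation_L2:
  assumes "f \<in> L2"
  shows "(\<lambda>x. f (x + t)) \<in> L2" "L2_norm (\<lambda>x. f (x + t)) = L2_norm f"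
proof -
  note [measurable] = L2_measurable[OF assms]
  show "(\<lambda>x. f (x + t)) \<in> L2"
    using L2_integrable_square[OF assms] lborel_translation_integral(1)[of "\<lambda>x. (cmod (f x))\<^sup>2" t]
    by (auto simp: L2_def)
  show "L2_norm (\<lambda>x. f (x + t)) = L2_norm f"
    using lborel_translation_integral(2)[of "\<lambda>x. (cmod (f x))\<^sup>2" t] by (simp add: L2_norm_def)
qed

text \<open>Lebesgue measure is the image of the product of its one-dimensional copies; this reduces
  Gaussian integrals to the line.\<close>

lemma lborel_integral_prod:
  fixes f :: "'a::euclidean_space \<Rightarrow> real \<Rightarrow> 'b::{real_normed_field,banach,second_countable_topology}"
  assumes f: "\<And>b. b \<in> Basis \<Longrightarrow> integrable lborel (f b)"
  shows "integrable lborel (\<lambda>x::'a. \<Prod>b\<in>Basis. f b (x \<bullet> b))"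
    and "(\<integral>x. (\<Prod>b\<in>Basis. f b ((x::'a) \<bullet> b)) \<partial>lborel) = (\<Prod>b\<in>Basis. (\<integral>x. f b x \<partial>lborel))"
proof -
  have [measurable]: "f b \<in> borel_measurable borel" if "b \<in> Basis" for b
    using borel_measurable_integrable[OF f[OF that]] by simp
  interpret product_sigma_finite "\<lambda>b::'a. lborel :: real measure" ..
  have [simp]: "(\<Prod>b\<in>Basis. f b ((\<Sum>c\<in>Basis. x c *\<^sub>R c) \<bullet> b)) = (\<Prod>b\<in>Basis. f b (x b))" for x
    by (intro prod.cong) auto
  have i: "integrable (\<Pi>\<^sub>M b\<in>Basis. lborel) (\<lambda>x. \<Prod>b\<in>(Basis::'a set). f b (x b))"
    by (rule product_integrable_prod) (use f in auto)
  show "integrable lborel (\<lambda>x::'a. \<Prod>b\<in>Basis. f b (x \<bullet> b))"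
    by (subst lborel_eq) (use i in \<open>simp add: integrable_distr_eq\<close>)
  show "(\<integral>x. (\<Prod>b\<in>Basis. f b ((x::'a) \<bullet> b)) \<partial>lborel) = (\<Prod>b\<in>Basis. (\<integral>x. f b x \<partial>lborel))"
    by (subst lborel_eq, subst integral_distr) (use f in \<open>simp_all add: product_integral_prod\<close>)
qed

section \<open>The standard Gaussian density and its characteristic function\<close>

definition gauss :: "'a::euclidean_space \<Rightarrow> real" where
  "gauss x = exp (- (norm x)\<^sup>2 / 2) / sqrt (2 * pi) ^ DIM('a)"

lemma gauss_nonneg [simp]: "0 \<le> gauss x"
  by (simp add: gauss_def)

lemma gauss_eq_prod: "gauss (x::'a::euclidean_space) = (\<Prod>b\<in>Basis. std_normal_density (x \<bullet> b))"
proof -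
  have "(norm x)\<^sup>2 = (\<Sum>b\<in>Basis. (x \<bullet> b)\<^sup>2)"
    by (simp add: norm_eq_sqrt_inner euclidean_inner[of x x] power2_eq_square sum_nonneg)
  then show ?thesis
    by (simp add: gauss_def std_normal_density_def prod_dividef exp_sum[symmetric] sum_negf[symmetric] sum_divide_distrib)
qed

lemma std_normal_characteristic:
  "integrable lborel (\<lambda>x. of_real (std_normal_density x) * iexp (t * x))"
  "(\<integral>x. of_real (std_normal_density x) * iexp (t * x) \<partial>lborel) = complex_of_real (exp (- (t\<^sup>2) / 2))"
proof -
  have 1: "(\<lambda>x. of_real (std_normal_density x) * iexp (t * x)) = (\<lambda>x. std_normal_density x *\<^sub>R iexp (t * x))"
    by (simp add: scaleR_conv_of_real)
  show "integrable lborel (\<lambda>x. of_real (std_normal_density x) * iexp (t * x))"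
    by (rule Bochner_Integration.integrable_bound[OF integrable_normal_density[of 1 0]])
       (auto simp: norm_mult normal_density_nonneg)
  have "char std_normal_distribution t = (\<integral>x. std_normal_density x *\<^sub>R iexp (t * x) \<partial>lborel)"
    unfolding char_def by (subst integral_density) (auto simp: normal_density_nonneg)
  then show "(\<integral>x. of_real (std_normal_density x) * iexp (t * x) \<partial>lborel) = complex_of_real (exp (- (t\<^sup>2) / 2))"
    unfolding 1 char_std_normal_distribution by simp
qed

lemma gauss_integral:
  "integrable lborel (gauss :: 'a::euclidean_space \<Rightarrow> real)"
  "(\<integral>x. gauss (x::'a) \<partial>lborel) = 1"
  using lborel_integral_prod[where f="\<lambda>_::'a. std_normal_density"]
  by (simp_all add: gauss_eq_prod[abs_def] integral_normal_density)

lemma gauss_measurable [measurable]: "gauss \<in> borel_measurable borel"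
  unfolding gauss_def[abs_def] by measurable

lemma gauss_characteristic:
  fixes \<xi> :: "'a::euclidean_space"
  shows "(\<integral>x. of_real (gauss x) * iexp (x \<bullet> \<xi>) \<partial>lborel) = of_real (exp (- (norm \<xi>)\<^sup>2 / 2))"
proof -
  have *: "complex_of_real (gauss x) * iexp (x \<bullet> \<xi>)
      = (\<Prod>b\<in>Basis. of_real (std_normal_density (x \<bullet> b)) * iexp ((\<xi> \<bullet> b) * (x \<bullet> b)))" for x :: 'a
    by (simp add: gauss_eq_prod prod.distrib exp_sum[symmetric] euclidean_inner[of x \<xi>] sum_distrib_left
        mult.commute)
  have n: "(norm \<xi>)\<^sup>2 = (\<Sum>b\<in>Basis. (\<xi> \<bullet> b)\<^sup>2)"
    by (simp add: norm_eq_sqrt_inner euclidean_inner[of \<xi> \<xi>] power2_eq_square sum_nonneg)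
  show ?thesis
    unfolding *
    by (subst lborel_integral_prod(2))
       (simp_all only: std_normal_characteristic n of_real_prod[symmetric] exp_sum[symmetric]
         sum_negf[symmetric] sum_divide_distrib finite_Basis)
qed

text \<open>For the indicator of an open set the translates converge pointwise on the set, so dominated
  convergence applies; outer regularity covers all other sets of finite measure.\<close>

lemma translation_continuous_L1:
  fixes f :: "'a::euclidean_space \<Rightarrow> real"
  assumes "integrable lborel f" and h: "h \<longlonglongrightarrow> 0"
  shows "(\<lambda>n. \<integral>x. \<bar>f (x + h n) - f x\<bar> \<partial>lborel) \<longlonglongrightarrow> 0"
proof -
  define P :: "('a \<Rightarrow> real) \<Rightarrow> bool" where "P f \<longleftrightarrow> (\<lambda>n. \<integral>x. \<bar>f (x + h n) - f x\<bar> \<partial>lborel) \<longlonglongrightarrow> 0" for f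
  have tr: "integrable lborel (\<lambda>x. f (x + t))" if "integrable lborel f" for f :: "'a \<Rightarrow> real" and t
    using lborel_translation_integral(1)[of f t] that borel_measurable_integrable[OF that] by simp
  have tr2: "(\<integral>x. f (x + t) \<partial>lborel) = (\<integral>x. f x \<partial>lborel)" if "integrable lborel f" for f :: "'a \<Rightarrow> real" and t
    using lborel_translation_integral(2)[of f t] that borel_measurable_integrable[OF that] by simp
  \<comment> \<open>Translation preserves the L^1 norm, so the property passes to L^1 limits: two
    thirds of \<open>e\<close> pay for the approximation before and after the shift.\<close>
  have approx: "P f" if f: "integrable lborel f"
    and g: "\<And>e. e > 0 \<Longrightarrow> \<exists>g. integrable lborel g \<and> P g \<and> (\<integral>x. \<bar>f x - g x\<bar> \<partial>lborel) < e" for f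
    unfolding P_def
  proof (rule LIMSEQ_I)
    fix e :: real assume "e > 0"
    then obtain g where gi: "integrable lborel g" and Pg: "P g" and fg: "(\<integral>x. \<bar>f x - g x\<bar> \<partial>lborel) < e / 3"
      using g[of "e/3"] by auto
    from Pg \<open>e > 0\<close> obtain N where N: "\<And>n. n \<ge> N \<Longrightarrow> \<bar>\<integral>x. \<bar>g (x + h n) - g x\<bar> \<partial>lborel\<bar> < e / 3"
      unfolding P_def by (fastforce dest: LIMSEQ_D[where r="e/3"])
    have "(\<integral>x. \<bar>f (x + h n) - f x\<bar> \<partial>lborel) < e" if "n \<ge> N" for n
    proof -
      have i1: "integrable lborel (\<lambda>x. \<bar>f (x + h n) - g (x + h n)\<bar>)"
        using tr[of "\<lambda>x. \<bar>f x - g x\<bar>" "h n"] f gi by auto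
      have i2: "integrable lborel (\<lambda>x. \<bar>g (x + h n) - g x\<bar>)" "integrable lborel (\<lambda>x. \<bar>f x - g x\<bar>)"
          "integrable lborel (\<lambda>x. \<bar>f (x + h n) - f x\<bar>)"
        using tr[OF gi] tr[OF f] f gi by auto
      have "(\<integral>x. \<bar>f (x + h n) - f x\<bar> \<partial>lborel)
          \<le> (\<integral>x. \<bar>f (x + h n) - g (x + h n)\<bar> + \<bar>g (x + h n) - g x\<bar> + \<bar>f x - g x\<bar> \<partial>lborel)"
        using i1 i2 by (intro integral_mono) auto
      also have "\<dots> = (\<integral>x. \<bar>f x - g x\<bar> \<partial>lborel) + (\<integral>x. \<bar>g (x + h n) - g x\<bar> \<partial>lborel) + (\<integral>x. \<bar>f x - g x\<bar> \<partial>lborel)"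
        using i1 i2 tr2[of "\<lambda>x. \<bar>f x - g x\<bar>" "h n"] by simp
      also have "\<dots> < e" using fg N[OF that] by simp
      finally show ?thesis .
    qed
    then show "\<exists>no. \<forall>n\<ge>no. norm ((\<integral>x. \<bar>f (x + h n) - f x\<bar> \<partial>lborel) - 0) < e"
      by (intro exI[of _ N]) auto
  qed
  have op: "P (\<lambda>x. indicator T x *\<^sub>R c)" if T: "open T" and fin: "emeasure lborel T < \<infinity>" for T and c :: real
  proof -
    have [measurable]: "T \<in> sets borel" using T by simp
    have iT: "integrable lborel (indicat_real T)" using fin by (simp add: integrable_indicator_iff)
    \<comment> \<open>Off \<open>T\<close> the product is 0 for every \<open>n\<close>, and on
      \<open>T\<close> openness makes it eventually 1; boundary points therefore cause no
      trouble.\<close>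
    have lim: "(\<lambda>n. \<integral>x. indicat_real T x * indicat_real T (x + h n) \<partial>lborel) \<longlonglongrightarrow> (\<integral>x. indicat_real T x \<partial>lborel)"
    proof (rule integral_dominated_convergence[where w="indicat_real T"])
      show "AE x in lborel. (\<lambda>n. indicat_real T x * indicat_real T (x + h n)) \<longlonglongrightarrow> indicat_real T x"
      proof (rule AE_I2)
        fix x
        show "(\<lambda>n. indicat_real T x * indicat_real T (x + h n)) \<longlonglongrightarrow> indicat_real T x"
        proof (cases "x \<in> T")
          case True
          have "(\<lambda>n. x + h n) \<longlonglongrightarrow> x" using tendsto_add[OF tendsto_const h, of x] by simp
          then have "eventually (\<lambda>n. x + h n \<in> T) sequentially"
            using T True by (rule topological_tendstoD)
          then have "eventually (\<lambda>n. indicat_real T x * indicat_real T (x + h n) = 1) sequentially"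
            by eventually_elim (use True in auto)
          then show ?thesis using True by (simp add: tendsto_eventually)
        qed simp
      qed
    qed (use iT in \<open>auto split: split_indicator\<close>)
    \<comment> \<open>For \<open>a\<close> and \<open>b\<close> in {0, 1} one has
      \<open>|a - b| = a + b - 2 * a * b\<close>, and the two single terms have equal
      integrals.\<close>
    have "(\<integral>x. \<bar>indicator T (x + h n) *\<^sub>R c - indicator T x *\<^sub>R c\<bar> \<partial>lborel)
        = \<bar>c\<bar> * (2 * (\<integral>x. indicat_real T x \<partial>lborel) - 2 * (\<integral>x. indicat_real T x * indicat_real T (x + h n) \<partial>lborel))" for n
    proof -
      have i: "integrable lborel (\<lambda>x. indicat_real T x * indicat_real T (x + h n))"
        by (rule Bochner_Integration.integrable_bound[OF iT]) (auto split: split_indicator)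
      have "(\<integral>x. \<bar>indicator T (x + h n) *\<^sub>R c - indicator T x *\<^sub>R c\<bar> \<partial>lborel) =
        (\<integral>x. \<bar>c\<bar> * (indicat_real T (x + h n) + indicat_real T x - 2 * (indicat_real T x * indicat_real T (x + h n))) \<partial>lborel)"
        by (intro Bochner_Integration.integral_cong) (auto split: split_indicator)
      then show ?thesis using i iT tr[OF iT, of "h n"] tr2[OF iT, of "h n"] by simp
    qed
    moreover have "(\<lambda>n. \<bar>c\<bar> * (2 * (\<integral>x. indicat_real T x \<partial>lborel) - 2 * (\<integral>x. indicat_real T x * indicat_real T (x + h n) \<partial>lborel)))
       \<longlonglongrightarrow> \<bar>c\<bar> * (2 * (\<integral>x. indicat_real T x \<partial>lborel) - 2 * (\<integral>x. indicat_real T x \<partial>lborel))"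
      by (intro tendsto_intros lim)
    ultimately show ?thesis by (simp add: P_def)
  qed
  have "P f" using assms(1)
  proof (induction rule: integrable_induct)
    case (base A c)
    then have A[measurable]: "A \<in> sets borel" and fA: "emeasure lborel A < \<infinity>" by auto
    show ?case
    proof (rule approx)
      show "integrable lborel (\<lambda>x. indicator A x *\<^sub>R c)" using fA by simp
      fix e :: real assume e: "e > 0"
      \<comment> \<open>The summand 1 in the denominator covers \<open>c = 0\<close>.\<close>
      define d where "d = e / (\<bar>c\<bar> + 1)"
      have d: "d > 0" using e by (simp add: d_def add_pos_nonneg)
      have "A \<in> sets lebesgue" using A by simp
      then obtain T where T: "open T" "A \<subseteq> T" and "T - A \<in> lmeasurable"
        and TA: "emeasure lebesgue (T - A) < ennreal d"
        by (rule sets_lebesgue_outer_open[OF _ d])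
      have [measurable]: "T \<in> sets borel" using T by simp
      have TA': "emeasure lborel (T - A) < ennreal d" using TA by simp
      have fTA: "emeasure lborel (T - A) < \<infinity>" using TA' by (rule less_trans) simp
      have "emeasure lborel T \<le> emeasure lborel A + emeasure lborel (T - A)"
        using T(2) by (subst plus_emeasure) (auto intro!: emeasure_mono)
      also have "\<dots> < \<infinity>" using fA fTA by simp
      finally have fT: "emeasure lborel T < \<infinity>" .
      have "(\<integral>x. \<bar>indicator A x *\<^sub>R c - indicator T x *\<^sub>R c\<bar> \<partial>lborel) = (\<integral>x. \<bar>c\<bar> * indicat_real (T - A) x \<partial>lborel)"
        using T(2) by (intro Bochner_Integration.integral_cong) (auto split: split_indicator)
      also have "\<dots> = \<bar>c\<bar> * measure lborel (T - A)" by simp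
      also have "\<dots> \<le> \<bar>c\<bar> * d"
        using TA' d by (intro mult_left_mono) (auto simp: measure_def intro!: enn2real_leI)
      also have "\<dots> < e" using e by (simp add: d_def field_simps)
      finally show "\<exists>g. integrable lborel g \<and> P g \<and> (\<integral>x. \<bar>indicator A x *\<^sub>R c - g x\<bar> \<partial>lborel) < e"
        using op[OF T(1) fT, of c] fT by (intro exI[of _ "\<lambda>x. indicator T x *\<^sub>R c"]) simp
    qed
  next
    case (add f g)
    show ?case unfolding P_def
    proof (rule tendsto_sandwich[where f="\<lambda>_. 0"])
      show "(\<lambda>n. (\<integral>x. \<bar>f (x + h n) - f x\<bar> \<partial>lborel) + (\<integral>x. \<bar>g (x + h n) - g x\<bar> \<partial>lborel)) \<longlonglongrightarrow> 0"
        using tendsto_add[OF add(3)[unfolded P_def] add(4)[unfolded P_def]] by simp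
      show "\<forall>\<^sub>F n in sequentially. (\<integral>x. \<bar>f (x + h n) + g (x + h n) - (f x + g x)\<bar> \<partial>lborel)
         \<le> (\<integral>x. \<bar>f (x + h n) - f x\<bar> \<partial>lborel) + (\<integral>x. \<bar>g (x + h n) - g x\<bar> \<partial>lborel)"
      proof (rule always_eventually, rule allI)
        fix n
        have i: "integrable lborel (\<lambda>x. \<bar>f (x + h n) - f x\<bar>)" "integrable lborel (\<lambda>x. \<bar>g (x + h n) - g x\<bar>)"
          "integrable lborel (\<lambda>x. \<bar>f (x + h n) + g (x + h n) - (f x + g x)\<bar>)"
          using add(1,2) tr[OF add(1)] tr[OF add(2)] by auto
        have "(\<integral>x. \<bar>f (x + h n) + g (x + h n) - (f x + g x)\<bar> \<partial>lborel)
          \<le> (\<integral>x. \<bar>f (x + h n) - f x\<bar> + \<bar>g (x + h n) - g x\<bar> \<partial>lborel)"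
          using i by (intro integral_mono) auto
        then show "(\<integral>x. \<bar>f (x + h n) + g (x + h n) - (f x + g x)\<bar> \<partial>lborel)
         \<le> (\<integral>x. \<bar>f (x + h n) - f x\<bar> \<partial>lborel) + (\<integral>x. \<bar>g (x + h n) - g x\<bar> \<partial>lborel)"
          using i by simp
      qed
    qed (auto intro!: always_eventually)
  next
    case (lim f s)
    note [measurable] = borel_measurable_integrable[OF lim(1)] borel_measurable_integrable[OF lim(4)]
    show ?case
    proof (rule approx[OF lim(4)])
      fix e :: real assume "e > 0"
      have "(\<lambda>i. \<integral>x. \<bar>f x - s i x\<bar> \<partial>lborel) \<longlonglongrightarrow> integral\<^sup>L lborel (\<lambda>x::'a. 0)"
      proof (rule integral_dominated_convergence[where w="\<lambda>x. 3 * \<bar>f x\<bar>"])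
        show "integrable lborel (\<lambda>x. 3 * \<bar>f x\<bar>)" using lim(4) by auto
        show "AE x in lborel. (\<lambda>i. \<bar>f x - s i x\<bar>) \<longlonglongrightarrow> 0"
        proof (rule AE_I2)
          fix x :: 'a
          have "(\<lambda>i. \<bar>f x - s i x\<bar>) \<longlonglongrightarrow> \<bar>f x - f x\<bar>"
            using lim(2)[of x] by (intro tendsto_intros) auto
          then show "(\<lambda>i. \<bar>f x - s i x\<bar>) \<longlonglongrightarrow> 0" by simp
        qed
        show "AE x in lborel. norm \<bar>f x - s i x\<bar> \<le> 3 * \<bar>f x\<bar>" for i
        proof (rule AE_I2)
          fix x show "norm \<bar>f x - s i x\<bar> \<le> 3 * \<bar>f x\<bar>" using lim(3)[of x i] by simp
        qed
      qed measurable
      from LIMSEQ_D[OF this \<open>e > 0\<close>] have "\<exists>i. norm ((\<integral>x. \<bar>f x - s i x\<bar> \<partial>lborel) - 0) < e"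
        by auto
      then show "\<exists>g. integrable lborel g \<and> P g \<and> (\<integral>x. \<bar>f x - g x\<bar> \<partial>lborel) < e"
        using lim(1,5) by auto
    qed
  qed
  then show ?thesis by (simp add: P_def)
qed

section \<open>Plancherel's theorem for integrable functions\<close>

text \<open>For nonnegative numbers \<open>\<bar>a - b\<bar>\<^sup>2 \<le> \<bar>a\<^sup>2 - b\<^sup>2\<bar>\<close>, so continuity in mean square of the positive
  and negative parts follows from continuity in mean of their squares.\<close>

lemma translation_continuous_L2:
  fixes f :: "'a::euclidean_space \<Rightarrow> complex"
  assumes f: "f \<in> L2" and h: "h \<longlonglongrightarrow> 0"
  shows "(\<lambda>n. L2_norm (\<lambda>x. f (x + h n) - f x)) \<longlonglongrightarrow> 0"
proof -
  note [measurable] = L2_measurable[OF f]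
  \<comment> \<open>The four functions are the squared positive and negative parts of
    \<open>Re f\<close> and \<open>Im f\<close>: \<open>j < 2\<close> selects the real part, the
    parity of \<open>j\<close> the sign.\<close>
  define p where "p j x = (max 0 (((if j < 2 then Re else Im) (f x)) * (if even j then 1 else -1)))\<^sup>2"
    for j :: nat and x
  have pm[measurable]: "p j \<in> borel_measurable lborel" for j
    unfolding p_def[abs_def] by (cases "j < 2") simp_all
  have pb: "p j x \<le> (cmod (f x))\<^sup>2" "0 \<le> p j x" for j x
    using abs_Re_le_cmod[of "f x"] abs_Im_le_cmod[of "f x"]
    by (auto simp: p_def intro!: power_mono)
  have pi: "integrable lborel (p j)" for j
    by (rule Bochner_Integration.integrable_bound[OF L2_integrable_square[OF f]])
       (use pb[of j] in \<open>auto simp: abs_of_nonneg\<close>)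
  have ti: "integrable lborel (\<lambda>x. \<bar>p j (x + t) - p j x\<bar>)" for j t
    using pi lborel_translation_integral(1)[OF pm, of j t] by auto
  have key: "(cmod (f y - f x))\<^sup>2 \<le> 2 * (\<Sum>j<4. \<bar>p j y - p j x\<bar>)" for x y
  proof -
    \<comment> \<open>Positive and negative parts are compared separately; the factor 2 comes from
      \<open>(A - B)^2 \<le> 2 * (A^2 + B^2)\<close>.\<close>
    have sq: "(a - b)\<^sup>2 \<le> 2 * (\<bar>(max 0 a)\<^sup>2 - (max 0 b)\<^sup>2\<bar> + \<bar>(max 0 (-a))\<^sup>2 - (max 0 (-b))\<^sup>2\<bar>)" for a b :: real
    proof -
      have nn: "(u - v)\<^sup>2 \<le> \<bar>u\<^sup>2 - v\<^sup>2\<bar>" if "u \<ge> 0" "v \<ge> 0" for u v :: real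
      proof -
        have "\<bar>u - v\<bar> * \<bar>u - v\<bar> \<le> \<bar>u - v\<bar> * \<bar>u + v\<bar>" using that by (intro mult_left_mono) auto
        then show ?thesis by (simp add: abs_mult[symmetric] power2_eq_square algebra_simps abs_mult_self_eq)
      qed
      define A B where "A = max 0 a - max 0 b" and "B = max 0 (-a) - max 0 (-b)"
      have eq: "a - b = A - B" by (auto simp: A_def B_def max_def)
      have "(A - B)\<^sup>2 \<le> 2 * (A\<^sup>2 + B\<^sup>2)"
        using zero_le_power2[of "A + B"] by (simp add: power2_eq_square algebra_simps)
      also have "\<dots> \<le> 2 * (\<bar>(max 0 a)\<^sup>2 - (max 0 b)\<^sup>2\<bar> + \<bar>(max 0 (-a))\<^sup>2 - (max 0 (-b))\<^sup>2\<bar>)"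
        unfolding A_def B_def by (rule mult_left_mono[OF add_mono]) (simp_all add: nn)
      finally show ?thesis unfolding eq .
    qed
    have "(\<Sum>j<4. \<bar>p j y - p j x\<bar>)
      = \<bar>p 0 y - p 0 x\<bar> + \<bar>p 1 y - p 1 x\<bar> + (\<bar>p 2 y - p 2 x\<bar> + \<bar>p 3 y - p 3 x\<bar>)"
      by (simp add: eval_nat_numeral)
    moreover have "p 0 z = (max 0 (Re (f z)))\<^sup>2" "p 1 z = (max 0 (- Re (f z)))\<^sup>2"
        "p 2 z = (max 0 (Im (f z)))\<^sup>2" "p 3 z = (max 0 (- Im (f z)))\<^sup>2" for z
      by (simp_all add: p_def)
    ultimately show ?thesis
      using add_mono[OF sq[of "Re (f y)" "Re (f x)"] sq[of "Im (f y)" "Im (f x)"]]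
      by (simp only: cmod_power2 minus_complex.sel distrib_left)
  qed
  have "(\<lambda>n. \<integral>x. (cmod (f (x + h n) - f x))\<^sup>2 \<partial>lborel) \<longlonglongrightarrow> 0"
  proof (rule tendsto_sandwich[where f="\<lambda>_. 0"])
    show "(\<lambda>n. 2 * (\<Sum>j<4. \<integral>x. \<bar>p j (x + h n) - p j x\<bar> \<partial>lborel)) \<longlonglongrightarrow> 0"
      by (intro tendsto_mult_right_zero tendsto_null_sum translation_continuous_L1 pi h)
    show "\<forall>\<^sub>F n in sequentially. (\<integral>x. (cmod (f (x + h n) - f x))\<^sup>2 \<partial>lborel)
       \<le> 2 * (\<Sum>j<4. \<integral>x. \<bar>p j (x + h n) - p j x\<bar> \<partial>lborel)"
    proof (rule always_eventually, rule allI)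
      fix n
      have "(\<integral>x. (cmod (f (x + h n) - f x))\<^sup>2 \<partial>lborel) \<le> (\<integral>x. 2 * (\<Sum>j<4. \<bar>p j (x + h n) - p j x\<bar>) \<partial>lborel)"
        using L2_integrable_square[OF L2_diff(1)[OF lborel_translation_L2(1)[OF f] f]] ti
        by (intro integral_mono key) auto
      then show "(\<integral>x. (cmod (f (x + h n) - f x))\<^sup>2 \<partial>lborel)
         \<le> 2 * (\<Sum>j<4. \<integral>x. \<bar>p j (x + h n) - p j x\<bar> \<partial>lborel)"
        using ti by simp
    qed
  qed auto
  then show ?thesis
    unfolding L2_norm_def using tendsto_real_sqrt[of _ 0 sequentially] by fastforce
qed

lemma borel_measurable_cnj [measurable]:
  assumes "f \<in> borel_measurable M"
  shows "(\<lambda>x. cnj (f x)) \<in> borel_measurable M"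
  by (rule measurable_compose[OF assms borel_measurable_continuous_onI]) (intro continuous_intros)

lemma L2_cnj:
  assumes "g \<in> L2"
  shows "(\<lambda>x. cnj (g x)) \<in> L2" "L2_norm (\<lambda>x. cnj (g x)) = L2_norm g"
  using borel_measurable_cnj[OF L2_measurable[OF assms]] L2_integrable_square[OF assms]
  by (auto simp: L2_def L2_norm_def)

text \<open>The deviation from the limit is the integral of \<open>f\<close> against the conjugate
  of \<open>f (x + h n) - f x\<close>; Cauchy-Schwarz reduces it to the continuity of translations
  in mean square.\<close>

lemma L2_autocorrelation_tendsto:
  fixes f :: "'a::euclidean_space \<Rightarrow> complex"
  assumes f: "f \<in> L2" and h: "h \<longlonglongrightarrow> 0"
  shows "(\<lambda>n. \<integral>x. f x * cnj (f (x + h n)) \<partial>lborel) \<longlonglongrightarrow> of_real ((L2_norm f)\<^sup>2)"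
proof (rule LIM_zero_cancel, rule Lim_null_comparison)
  note [measurable] = L2_measurable[OF f]
  note tf = lborel_translation_L2(1)[OF f]
  show "\<forall>\<^sub>F n in sequentially. norm ((\<integral>x. f x * cnj (f (x + h n)) \<partial>lborel) - of_real ((L2_norm f)\<^sup>2))
    \<le> L2_norm f * L2_norm (\<lambda>x. f (x + h n) - f x)"
  proof (rule always_eventually, rule allI)
    fix n
    have "of_real ((L2_norm f)\<^sup>2) = (\<integral>x. f x * cnj (f x) \<partial>lborel)"
      by (simp add: L2_norm_square complex_norm_square[symmetric] del: of_real_power)
    then have "(\<integral>x. f x * cnj (f (x + h n)) \<partial>lborel) - of_real ((L2_norm f)\<^sup>2)
      = (\<integral>x. f x * cnj (f (x + h n)) - f x * cnj (f x) \<partial>lborel)"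
      using L2_mult_integrable[OF f L2_cnj(1)[OF tf]] L2_mult_integrable[OF f L2_cnj(1)[OF f]] by simp
    also have "\<dots> = (\<integral>x. f x * cnj (f (x + h n) - f x) \<partial>lborel)"
      by (simp add: algebra_simps)
    finally show "norm ((\<integral>x. f x * cnj (f (x + h n)) \<partial>lborel) - of_real ((L2_norm f)\<^sup>2))
      \<le> L2_norm f * L2_norm (\<lambda>x. f (x + h n) - f x)"
      using L2_Cauchy_Schwarz[OF f L2_cnj(1)[OF L2_diff(1)[OF tf[of "h n"] f]]]
        L2_cnj(2)[OF L2_diff(1)[OF tf[of "h n"] f]] by simp
  qed
  show "(\<lambda>n. L2_norm f * L2_norm (\<lambda>x. f (x + h n) - f x)) \<longlonglongrightarrow> 0"
    by (intro tendsto_mult_right_zero translation_continuous_L2 f h)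
qed

section \<open>Fourier integrals and their Gaussian regularisation\<close>

lemma fourier_integrand_integrable:
  assumes "integrable lborel f"
  shows "integrable lborel (\<lambda>x. exp (- (\<i> * of_real (x \<bullet> \<xi>))) * f x)"
  by (rule Bochner_Integration.integrable_bound[OF assms])
     (use borel_measurable_integrable[OF assms] in \<open>auto simp: norm_mult\<close>)

lemma norm_fourier_integral_le:
  assumes "integrable lborel f"
  shows "cmod (fourier_integral f \<xi>) \<le> L1_norm f"
proof -
  have "cmod (fourier_integral f \<xi>) \<le> (\<integral>x. cmod (exp (- (\<i> * of_real (x \<bullet> \<xi>))) * f x) \<partial>lborel)"
    unfolding fourier_integral_def by (rule integral_norm_bound)
  then show ?thesis by (simp add: norm_mult L1_norm_def)
qed

lemma fourier_integral_measurable: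
  assumes "f \<in> borel_measurable lborel"
  shows "fourier_integral f \<in> borel_measurable lborel"
proof -
  have [measurable]: "f \<in> borel_measurable borel" using assms by simp
  show ?thesis
    unfolding fourier_integral_def[abs_def]
    by (rule lborel.borel_measurable_lebesgue_integral) measurable
qed

lemma fourier_integral_diff:
  assumes "integrable lborel f" "integrable lborel g"
  shows "fourier_integral (\<lambda>x. f x - g x) \<xi> = fourier_integral f \<xi> - fourier_integral g \<xi>"
  using fourier_integrand_integrable[OF assms(1)] fourier_integrand_integrable[OF assms(2)]
  by (simp add: fourier_integral_def algebra_simps)

text \<open>A product majorant verifies all hypotheses of Fubini's theorem at once. It serves the
  exchanges of integrals whose kernel is a phase times integrable factors of the separate
  variables.\<close>

lemma pair_integrable_dominated:
  fixes H :: "'a::euclidean_space \<Rightarrow> 'b::euclidean_space \<Rightarrow> complex"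
  assumes [measurable]: "case_prod H \<in> borel_measurable (lborel \<Otimes>\<^sub>M lborel)"
    and a: "integrable lborel a" and b: "integrable lborel b"
    and le: "\<And>x y. cmod (H x y) \<le> a x * b y"
  shows "integrable (lborel \<Otimes>\<^sub>M lborel) (case_prod H)"
proof (rule lborel_pair.Fubini_integrable)
  have 1: "integrable lborel (\<lambda>y. H x y)" for x
    by (rule Bochner_Integration.integrable_bound[OF integrable_mult_right[OF b, of "a x"]])
       (use le[of x] in \<open>auto intro: order_trans[OF _ abs_ge_self]\<close>)
  then show "AE x in lborel. integrable lborel (\<lambda>y. case (x, y) of (x, y) \<Rightarrow> H x y)" by simp
  have "integrable lborel (\<lambda>x. \<integral>y. cmod (H x y) \<partial>lborel)"
  proof (rule Bochner_Integration.integrable_bound[OF integrable_mult_left[OF a, of "\<integral>y. b y \<partial>lborel"]])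
    show "(\<lambda>x. \<integral>y. cmod (H x y) \<partial>lborel) \<in> borel_measurable lborel" by measurable
    have "(\<integral>y. cmod (H x y) \<partial>lborel) \<le> (\<integral>y. a x * b y \<partial>lborel)" for x
      using 1[of x] b le by (intro integral_mono) auto
    then show "AE x in lborel. norm (\<integral>y. cmod (H x y) \<partial>lborel) \<le> norm (a x * (\<integral>y. b y \<partial>lborel))"
      by (intro AE_I2) (auto intro: order_trans[OF _ abs_ge_self])
  qed
  then show "integrable lborel (\<lambda>x. \<integral>y. norm (case (x, y) of (x, y) \<Rightarrow> H x y) \<partial>lborel)" by simp
qed measurable

text \<open>This is \<open>gauss_characteristic\<close> after scaling the variable by
  \<open>e\<close>. One factor \<open>sqrt (2 * pi) ^ n\<close> normalises the weight, a second one
  normalises the Gaussian in the result; together they give \<open>(2 * pi) ^ n\<close>.\<close>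

lemma gaussian_weight_scaling:
  fixes w :: "'a::euclidean_space"
  assumes e: "e > 0"
  shows "(\<integral>\<xi>. iexp (w \<bullet> \<xi>) * of_real (exp (- (e * norm \<xi>)\<^sup>2 / 2)) \<partial>lborel)
    = of_real ((2 * pi) ^ DIM('a) / e ^ DIM('a) * gauss (w /\<^sub>R e))"
    and "integrable lborel (\<lambda>\<xi>::'a. exp (- (e * norm \<xi>)\<^sup>2 / 2))"
proof -
  let ?c = "sqrt (2 * pi) ^ DIM('a)"
  have g: "exp (- (e * norm \<xi>)\<^sup>2 / 2) = ?c * gauss (e *\<^sub>R \<xi>)" for \<xi> :: 'a
    using e by (simp add: gauss_def)
  show "integrable lborel (\<lambda>\<xi>::'a. exp (- (e * norm \<xi>)\<^sup>2 / 2))"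
    unfolding g using lborel_affine_integral(1)[of "gauss :: 'a \<Rightarrow> real" e 0] gauss_integral e
    by simp
  have "of_real (exp (- (norm (w /\<^sub>R e))\<^sup>2 / 2)) = (\<integral>x. complex_of_real (gauss x) * iexp (x \<bullet> (w /\<^sub>R e)) \<partial>lborel)"
    by (rule gauss_characteristic[symmetric])
  also have "\<dots> = e ^ DIM('a) *\<^sub>R (\<integral>\<xi>. complex_of_real (gauss (e *\<^sub>R \<xi>)) * iexp (\<xi> \<bullet> w) \<partial>lborel)"
    using lborel_affine_integral(2)[of "\<lambda>x. complex_of_real (gauss x) * iexp (x \<bullet> (w /\<^sub>R e))" e 0] e
    by (simp add: mult.assoc[symmetric])
  finally have 1: "of_real (exp (- (norm (w /\<^sub>R e))\<^sup>2 / 2) / e ^ DIM('a))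
      = (\<integral>\<xi>. complex_of_real (gauss (e *\<^sub>R \<xi>)) * iexp (\<xi> \<bullet> w) \<partial>lborel)"
    using e by (simp add: scaleR_conv_of_real field_simps)
  have c2: "(2 * pi) ^ DIM('a) = ?c * ?c"
    unfolding power_mult_distrib[symmetric] by (subst real_sqrt_mult_self) simp
  have "(\<integral>\<xi>. iexp (w \<bullet> \<xi>) * of_real (exp (- (e * norm \<xi>)\<^sup>2 / 2)) \<partial>lborel)
     = of_real ?c * (\<integral>\<xi>. complex_of_real (gauss (e *\<^sub>R \<xi>)) * iexp (\<xi> \<bullet> w) \<partial>lborel)"
    unfolding g integral_mult_right_zero[symmetric]
    by (intro Bochner_Integration.integral_cong refl) (simp add: inner_commute mult_ac)
  also have "\<dots> = of_real ((2 * pi) ^ DIM('a) / e ^ DIM('a) * gauss (w /\<^sub>R e))"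
    unfolding 1[symmetric] c2 of_real_mult[symmetric] by (simp add: gauss_def)
  finally show "(\<integral>\<xi>. iexp (w \<bullet> \<xi>) * of_real (exp (- (e * norm \<xi>)\<^sup>2 / 2)) \<partial>lborel)
    = of_real ((2 * pi) ^ DIM('a) / e ^ DIM('a) * gauss (w /\<^sub>R e))" .
qed


text \<open>The Gaussian weight is the transform of a Gaussian, so the weighted energy of the transform is
  a Gaussian average of autocorrelations of \<open>f\<close>.\<close>

lemma gaussian_weighted_energy:
  fixes f :: "'a::euclidean_space \<Rightarrow> complex"
  assumes fi: "integrable lborel f" and f2: "f \<in> L2" and e: "e > 0"
  shows "integrable lborel (\<lambda>\<xi>. (cmod (fourier_integral f \<xi>))\<^sup>2 * exp (- (e * norm \<xi>)\<^sup>2 / 2))"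
    and "of_real (\<integral>\<xi>. (cmod (fourier_integral f \<xi>))\<^sup>2 * exp (- (e * norm \<xi>)\<^sup>2 / 2) \<partial>lborel)
      = (2 * pi) ^ DIM('a) * (\<integral>z. of_real (gauss z) * (\<integral>x. f x * cnj (f (x + e *\<^sub>R z)) \<partial>lborel) \<partial>lborel)"
proof -
  let ?F = "fourier_integral f"
  let ?G = "\<lambda>\<xi>::'a. exp (- (e * norm \<xi>)\<^sup>2 / 2)"
  have fm[measurable]: "f \<in> borel_measurable borel" using borel_measurable_integrable[OF fi] by simp
  have Fm[measurable]: "?F \<in> borel_measurable borel"
    using fourier_integral_measurable[of f] borel_measurable_integrable[OF fi] by simp
  have Gi: "integrable lborel ?G" by (rule gaussian_weight_scaling(2)[OF e])
  have Fb: "cmod (?F \<xi>) \<le> L1_norm f" for \<xi> by (rule norm_fourier_integral_le[OF fi])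
  have L1: "0 \<le> L1_norm f" using Fb[of 0] norm_ge_zero[of "?F 0"] by linarith
  show "integrable lborel (\<lambda>\<xi>. (cmod (?F \<xi>))\<^sup>2 * ?G \<xi>)"
    by (rule Bochner_Integration.integrable_bound[OF integrable_mult_right[OF Gi, of "(L1_norm f)\<^sup>2"]])
       (use Fb in \<open>auto simp: abs_mult intro!: mult_right_mono power_mono\<close>)
  have inner: "(\<integral>\<xi>. exp (- (\<i> * of_real (x \<bullet> \<xi>))) * (cnj (?F \<xi>) * of_real (?G \<xi>)) \<partial>lborel)
    = (2 * pi) ^ DIM('a) * (\<integral>z. of_real (gauss z) * cnj (f (x + e *\<^sub>R z)) \<partial>lborel)" for x
  proof -
    \<comment> \<open>Writing the conjugate transform as an integral over \<open>y\<close> merges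
      the phases into \<open>(y - x) \<bullet> \<xi>\<close>; after Fubini the integral over
      \<open>\<xi>\<close> is a Gaussian in \<open>(y - x) / e\<close>.\<close>
    let ?H = "\<lambda>\<xi> y. iexp ((y - x) \<bullet> \<xi>) * of_real (?G \<xi>) * cnj (f y)"
    have int: "integrable (lborel \<Otimes>\<^sub>M lborel) (case_prod ?H)"
      by (rule pair_integrable_dominated[OF _ Gi integrable_norm[OF fi]])
         (auto simp: norm_mult split_beta')
    have "(\<integral>\<xi>. exp (- (\<i> * of_real (x \<bullet> \<xi>))) * (cnj (?F \<xi>) * of_real (?G \<xi>)) \<partial>lborel)
      = (\<integral>\<xi>. (\<integral>y. ?H \<xi> y \<partial>lborel) \<partial>lborel)"
    proof (rule Bochner_Integration.integral_cong[OF refl])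
      fix \<xi> :: 'a
      have "cnj (?F \<xi>) = (\<integral>y. iexp (y \<bullet> \<xi>) * cnj (f y) \<partial>lborel)"
        unfolding fourier_integral_def Bochner_Integration.integral_cnj[symmetric] by (simp add: exp_cnj del: Bochner_Integration.integral_cnj)
      then have "exp (- (\<i> * of_real (x \<bullet> \<xi>))) * (cnj (?F \<xi>) * of_real (?G \<xi>))
        = exp (- (\<i> * of_real (x \<bullet> \<xi>))) * of_real (?G \<xi>) * (\<integral>y. iexp (y \<bullet> \<xi>) * cnj (f y) \<partial>lborel)"
        by simp
      also have "\<dots> = (\<integral>y. exp (- (\<i> * of_real (x \<bullet> \<xi>))) * of_real (?G \<xi>) * (iexp (y \<bullet> \<xi>) * cnj (f y)) \<partial>lborel)"
        by simp
      also have "\<dots> = (\<integral>y. ?H \<xi> y \<partial>lborel)"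
        by (intro Bochner_Integration.integral_cong refl)
           (simp add: inner_diff_left right_diff_distrib exp_diff exp_minus field_simps)
      finally show "exp (- (\<i> * of_real (x \<bullet> \<xi>))) * (cnj (?F \<xi>) * of_real (?G \<xi>)) = (\<integral>y. ?H \<xi> y \<partial>lborel)" .
    qed
    also have "\<dots> = (\<integral>y. (\<integral>\<xi>. ?H \<xi> y \<partial>lborel) \<partial>lborel)"
      by (rule lborel_pair.Fubini_integral[OF int, symmetric])
    also have "\<dots> = (\<integral>y. of_real ((2 * pi) ^ DIM('a) / e ^ DIM('a) * gauss ((y - x) /\<^sub>R e)) * cnj (f y) \<partial>lborel)"
      by (simp only: integral_mult_left_zero gaussian_weight_scaling(1)[OF e])
    \<comment> \<open>With \<open>y = x + e z\<close> the Jacobian \<open>e^n\<close> cancels the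
      factor \<open>1 / e^n\<close> of the weight.\<close>
    also have "\<dots> = e ^ DIM('a) *\<^sub>R (\<integral>z. of_real ((2 * pi) ^ DIM('a) / e ^ DIM('a) * gauss z) * cnj (f (x + e *\<^sub>R z)) \<partial>lborel)"
      using e by (subst lborel_affine_integral(2)[of _ e x]) simp_all
    also have "\<dots> = (2 * pi) ^ DIM('a) * (\<integral>z. of_real (gauss z) * cnj (f (x + e *\<^sub>R z)) \<partial>lborel)"
      using e by (simp add: scaleR_conv_of_real mult.assoc)
    finally show ?thesis .
  qed
  let ?K = "\<lambda>\<xi> x. exp (- (\<i> * of_real (x \<bullet> \<xi>))) * f x * (cnj (?F \<xi>) * of_real (?G \<xi>))"
  have K: "integrable (lborel \<Otimes>\<^sub>M lborel) (case_prod ?K)"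
  proof (rule pair_integrable_dominated[OF _ integrable_mult_right[OF Gi, of "L1_norm f"] integrable_norm[OF fi]])
    fix \<xi> x :: 'a
    have "cmod (?K \<xi> x) = cmod (f x) * (cmod (?F \<xi>) * ?G \<xi>)"
      by (simp add: norm_mult)
    also have "\<dots> \<le> cmod (f x) * (L1_norm f * ?G \<xi>)"
      by (intro mult_left_mono mult_right_mono Fb) auto
    finally show "cmod (?K \<xi> x) \<le> L1_norm f * ?G \<xi> * norm (f x)" by (simp add: mult_ac)
  qed measurable
  let ?M = "\<lambda>z x. of_real (gauss z) * (f x * cnj (f (x + e *\<^sub>R z)))"
  have tf: "(\<lambda>x. cnj (f (x + t))) \<in> L2" "L2_norm (\<lambda>x. cnj (f (x + t))) = L2_norm f" for t
    using L2_cnj[OF lborel_translation_L2(1)[OF f2, of t]] lborel_translation_L2(2)[OF f2, of t] by simp_all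
  \<comment> \<open>Cauchy-Schwarz bounds the integral over \<open>x\<close> uniformly in
    \<open>z\<close>; the Gaussian supplies integrability in \<open>z\<close>.\<close>
  have M: "integrable (lborel \<Otimes>\<^sub>M lborel) (case_prod ?M)"
  proof (rule lborel_pair.Fubini_integrable)
    show "case_prod ?M \<in> borel_measurable (lborel \<Otimes>\<^sub>M lborel)" by measurable
    show "AE z in lborel. integrable lborel (\<lambda>x. case (z, x) of (z, x) \<Rightarrow> ?M z x)"
      using L2_mult_integrable[OF f2 tf(1)] by simp
    show "integrable lborel (\<lambda>z. \<integral>x. norm (case (z, x) of (z, x) \<Rightarrow> ?M z x) \<partial>lborel)"
    proof (rule Bochner_Integration.integrable_bound[OF integrable_mult_right[OF gauss_integral(1), of "(L2_norm f)\<^sup>2"]])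
      show "(\<lambda>z. \<integral>x. norm (case (z, x) of (z, x) \<Rightarrow> ?M z x) \<partial>lborel) \<in> borel_measurable lborel" by measurable
      show "AE z in lborel. norm (\<integral>x. norm (case (z, x) of (z, x) \<Rightarrow> ?M z x) \<partial>lborel) \<le> norm ((L2_norm f)\<^sup>2 * gauss z)"
      proof (rule AE_I2)
        fix z :: 'a
        have "(\<integral>x. norm (?M z x) \<partial>lborel) = gauss z * (\<integral>x. cmod (f x) * cmod (cnj (f (x + e *\<^sub>R z))) \<partial>lborel)"
          by (simp add: norm_mult)
        also have "\<dots> \<le> gauss z * (L2_norm f * L2_norm f)"
          using L2_Cauchy_Schwarz_abs[OF f2 tf(1)] tf(2) by (intro mult_left_mono) simp_all
        finally show "norm (\<integral>x. norm (case (z, x) of (z, x) \<Rightarrow> ?M z x) \<partial>lborel) \<le> norm ((L2_norm f)\<^sup>2 * gauss z)"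
          by (simp add: power2_eq_square mult_ac)
      qed
    qed
  qed
  have swap: "(\<integral>z. ?M z x \<partial>lborel) = f x * (\<integral>z. of_real (gauss z) * cnj (f (x + e *\<^sub>R z)) \<partial>lborel)" for x
    by (simp only: mult.left_commute[of "of_real _" "f x"] integral_mult_right_zero)
  have "of_real (\<integral>\<xi>. (cmod (?F \<xi>))\<^sup>2 * ?G \<xi> \<partial>lborel) = (\<integral>\<xi>. ?F \<xi> * (cnj (?F \<xi>) * of_real (?G \<xi>)) \<partial>lborel)"
    unfolding integral_complex_of_real[symmetric]
    by (intro Bochner_Integration.integral_cong refl)
       (simp only: of_real_mult complex_norm_square mult.assoc)
  also have "\<dots> = (\<integral>\<xi>. (\<integral>x. ?K \<xi> x \<partial>lborel) \<partial>lborel)"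
    by (intro Bochner_Integration.integral_cong refl) (simp add: fourier_integral_def)
  also have "\<dots> = (\<integral>x. (\<integral>\<xi>. ?K \<xi> x \<partial>lborel) \<partial>lborel)"
    by (rule lborel_pair.Fubini_integral[OF K, symmetric])
  also have "\<dots> = (\<integral>x. f x * (\<integral>\<xi>. exp (- (\<i> * of_real (x \<bullet> \<xi>))) * (cnj (?F \<xi>) * of_real (?G \<xi>)) \<partial>lborel) \<partial>lborel)"
    by (simp only: mult.assoc mult.left_commute[of "exp _" "f _"] integral_mult_right_zero)
  also have "\<dots> = (2 * pi) ^ DIM('a) * (\<integral>x. (\<integral>z. ?M z x \<partial>lborel) \<partial>lborel)"
    unfolding inner swap
    by (simp only: mult.left_commute[of "f _" "of_real ((2 * pi) ^ DIM('a))"] integral_mult_right_zero)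
  also have "(\<integral>x. (\<integral>z. ?M z x \<partial>lborel) \<partial>lborel) = (\<integral>z. (\<integral>x. ?M z x \<partial>lborel) \<partial>lborel)"
    by (rule lborel_pair.Fubini_integral[OF M])
  finally show "of_real (\<integral>\<xi>. (cmod (?F \<xi>))\<^sup>2 * ?G \<xi> \<partial>lborel)
      = (2 * pi) ^ DIM('a) * (\<integral>z. of_real (gauss z) * (\<integral>x. f x * cnj (f (x + e *\<^sub>R z)) \<partial>lborel) \<partial>lborel)"
    by (simp only: integral_mult_right_zero)
qed

text \<open>Let \<open>e\<close> tend to 0 in \<open>gaussian_weighted_energy\<close>. The weights
  increase to 1, so monotone convergence yields square integrability of the transform together with
  its norm; the averaged autocorrelations converge by domination.\<close>

theorem Plancherel_L1_L2:
  fixes f :: "'a::euclidean_space \<Rightarrow> complex"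
  assumes fi: "integrable lborel f" and f2: "f \<in> L2"
  shows "fourier_integral f \<in> L2" "(L2_norm (fourier_integral f))\<^sup>2 = (2 * pi) ^ DIM('a) * (L2_norm f)\<^sup>2"
proof -
  let ?F = "fourier_integral f"
  define e where "e n = inverse (real (Suc n))" for n
  have e: "e n > 0" for n by (simp add: e_def)
  have e0: "e \<longlonglongrightarrow> 0" unfolding e_def by (rule LIMSEQ_inverse_real_of_nat)
  let ?E = "\<lambda>n \<xi>. (cmod (?F \<xi>))\<^sup>2 * exp (- (e n * norm \<xi>)\<^sup>2 / 2)"
  let ?c = "\<lambda>n z. \<integral>x. f x * cnj (f (x + e n *\<^sub>R z)) \<partial>lborel"
  have fm[measurable]: "f \<in> borel_measurable borel" using borel_measurable_integrable[OF fi] by simp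
  have Fm[measurable]: "?F \<in> borel_measurable borel"
    using fourier_integral_measurable[of f] borel_measurable_integrable[OF fi] by simp
  have "(\<lambda>n. \<integral>z. of_real (gauss z) * ?c n z \<partial>lborel) \<longlonglongrightarrow> (\<integral>z. of_real (gauss (z::'a)) * of_real ((L2_norm f)\<^sup>2) \<partial>lborel)"
  proof (rule integral_dominated_convergence[where w="\<lambda>z. gauss z * (L2_norm f)\<^sup>2"])
    show "integrable lborel (\<lambda>z::'a. gauss z * (L2_norm f)\<^sup>2)" using gauss_integral(1) by auto
    show "AE z in lborel. (\<lambda>n. of_real (gauss z) * ?c n z) \<longlonglongrightarrow> of_real (gauss z) * of_real ((L2_norm f)\<^sup>2)"
      by (intro AE_I2 tendsto_mult_left L2_autocorrelation_tendsto f2)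
         (use tendsto_scaleR[OF e0 tendsto_const] in auto)
    show "AE z in lborel. norm (of_real (gauss z) * ?c n z) \<le> gauss z * (L2_norm f)\<^sup>2" for n
    proof (rule AE_I2)
      fix z :: 'a
      have "cmod (?c n z) \<le> L2_norm f * L2_norm f"
        using L2_Cauchy_Schwarz[OF f2 L2_cnj(1)[OF lborel_translation_L2(1)[OF f2, of "e n *\<^sub>R z"]]]
          L2_cnj(2)[OF lborel_translation_L2(1)[OF f2, of "e n *\<^sub>R z"]] lborel_translation_L2(2)[OF f2, of "e n *\<^sub>R z"]
        by simp
      then show "norm (of_real (gauss z) * ?c n z) \<le> gauss z * (L2_norm f)\<^sup>2"
        by (simp add: norm_mult power2_eq_square mult_left_mono)
    qed
  qed measurable
  also have "(\<integral>z. complex_of_real (gauss (z::'a)) * of_real ((L2_norm f)\<^sup>2) \<partial>lborel) = of_real ((L2_norm f)\<^sup>2)"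
    using gauss_integral(2)[where 'a='a] by simp
  finally have "(\<lambda>n. (2 * pi) ^ DIM('a) * (\<integral>z. of_real (gauss z) * ?c n z \<partial>lborel))
      \<longlonglongrightarrow> (2 * pi) ^ DIM('a) * complex_of_real ((L2_norm f)\<^sup>2)"
    by (rule tendsto_mult_left)
  then have "(\<lambda>n. complex_of_real (\<integral>\<xi>. ?E n \<xi> \<partial>lborel)) \<longlonglongrightarrow> complex_of_real ((2 * pi) ^ DIM('a) * (L2_norm f)\<^sup>2)"
    unfolding gaussian_weighted_energy(2)[OF fi f2 e] by simp
  then have lim: "(\<lambda>n. \<integral>\<xi>. ?E n \<xi> \<partial>lborel) \<longlonglongrightarrow> (2 * pi) ^ DIM('a) * (L2_norm f)\<^sup>2"
    by (rule tendsto_of_real_iff[THEN iffD1])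
  have *: "AE \<xi> in lborel. mono (\<lambda>n. ?E n \<xi>)"
  proof (rule AE_I2, rule monoI)
    fix \<xi> :: 'a and m n :: nat assume "m \<le> n"
    then have "e n \<le> e m" by (simp add: e_def)
    then have "(e n * norm \<xi>)\<^sup>2 \<le> (e m * norm \<xi>)\<^sup>2"
      using e[of n] by (intro power_mono mult_right_mono) auto
    then show "?E m \<xi> \<le> ?E n \<xi>" by (intro mult_left_mono) auto
  qed
  have **: "AE \<xi> in lborel. (\<lambda>n. ?E n \<xi>) \<longlonglongrightarrow> (cmod (?F \<xi>))\<^sup>2"
  proof (rule AE_I2)
    fix \<xi> :: 'a
    have "(\<lambda>n. ?E n \<xi>) \<longlonglongrightarrow> (cmod (?F \<xi>))\<^sup>2 * exp (- (0 * norm \<xi>)\<^sup>2 / 2)"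
      by (intro tendsto_intros e0) simp
    then show "(\<lambda>n. ?E n \<xi>) \<longlonglongrightarrow> (cmod (?F \<xi>))\<^sup>2" by simp
  qed
  note conv = integral_monotone_convergence_nonneg[OF gaussian_weighted_energy(1)[OF fi f2 e] * _ ** lim]
  show "?F \<in> L2" unfolding L2_def using conv(1) Fm by auto
  show "(L2_norm ?F)\<^sup>2 = (2 * pi) ^ DIM('a) * (L2_norm f)\<^sup>2"
    unfolding L2_norm_square[of ?F] using conv(2) Fm by auto
qed

section \<open>The Fourier transform of square-integrable functions\<close>

abbreviation truncation :: "('a::euclidean_space \<Rightarrow> complex) \<Rightarrow> real \<Rightarrow> 'a \<Rightarrow> complex" where
  "truncation f R \<equiv> (\<lambda>x. indicat_real (cball 0 R) x *\<^sub>R f x)"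

lemma L2_indicator:
  assumes [measurable]: "A \<in> sets borel" and fin: "emeasure lborel A < \<infinity>"
  shows "(\<lambda>x. of_real (indicat_real A x)) \<in> L2"
proof -
  have "(cmod (of_real (indicat_real A x)))\<^sup>2 = indicat_real A x" for x
    by (auto split: split_indicator)
  then show ?thesis using fin by (simp add: L2_def integrable_indicator_iff)
qed

lemma truncation_measurable:
  assumes "f \<in> borel_measurable lborel"
  shows "truncation f R \<in> borel_measurable lborel"
  using assms by (intro borel_measurable_scaleR borel_measurable_indicator) auto

text \<open>On a ball, Cauchy-Schwarz against the indicator turns square integrability into
  integrability. Truncations thus have a Fourier integral and satisfy Plancherel's identity.\<close>

lemma truncation_L2:
  assumes f: "f \<in> L2"
  shows "truncation f R \<in> L2" "integrable lborel (truncation f R)"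
proof -
  note [measurable] = L2_measurable[OF f]
  show "truncation f R \<in> L2"
    by (rule L2_mono(1)[OF f truncation_measurable]) (use L2_measurable[OF f] in \<open>auto split: split_indicator\<close>)
  show "integrable lborel (truncation f R)"
    using L2_mult_integrable[OF L2_indicator[of "cball 0 R"] f] emeasure_lborel_cball_finite[of "0::'a" R]
    by (simp add: scaleR_conv_of_real less_top)
qed

lemma truncation_tendsto_L2:
  assumes f: "f \<in> L2"
  shows "((\<lambda>R. L2_norm (\<lambda>x. truncation f R x - f x)) \<longlongrightarrow> 0) at_top"
proof -
  note [measurable] = L2_measurable[OF f]
  have "((\<lambda>R. \<integral>x. (cmod (truncation f R x - f x))\<^sup>2 \<partial>lborel) \<longlongrightarrow> integral\<^sup>L lborel (\<lambda>x::'a. 0)) at_top"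
  proof (rule integral_dominated_convergence_at_top[where w="\<lambda>x. (cmod (f x))\<^sup>2"])
    show "integrable lborel (\<lambda>x. (cmod (f x))\<^sup>2)" by (rule L2_integrable_square[OF f])
    show "AE x in lborel. ((\<lambda>R. (cmod (truncation f R x - f x))\<^sup>2) \<longlongrightarrow> 0) at_top"
    proof (rule AE_I2)
      fix x :: 'a
      have "\<forall>\<^sub>F R in at_top. (cmod (truncation f R x - f x))\<^sup>2 = 0"
        using eventually_ge_at_top[of "norm x"] by eventually_elim simp
      then show "((\<lambda>R. (cmod (truncation f R x - f x))\<^sup>2) \<longlongrightarrow> 0) at_top"
        by (rule tendsto_eventually)
    qed
    show "\<forall>\<^sub>F R in at_top. AE x in lborel. norm ((cmod (truncation f R x - f x))\<^sup>2) \<le> (cmod (f x))\<^sup>2"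
      by (auto split: split_indicator)
    have "(\<lambda>x. truncation f R x - f x) \<in> borel_measurable lborel" for R
      by (intro borel_measurable_diff truncation_measurable L2_measurable f)
    then show "(\<lambda>x. (cmod (truncation f R x - f x))\<^sup>2) \<in> borel_measurable lborel" for R
      by measurable
  qed measurable
  then have "((\<lambda>R. sqrt (\<integral>x. (cmod (truncation f R x - f x))\<^sup>2 \<partial>lborel)) \<longlongrightarrow> sqrt 0) at_top"
    by (intro tendsto_real_sqrt) simp
  then show ?thesis by (simp add: L2_norm_def)
qed

definition plancherel_const :: "'a::euclidean_space itself \<Rightarrow> real" where
  "plancherel_const T = sqrt ((2 * pi) ^ DIM('a))"

lemma plancherel_const_pos: "0 < plancherel_const T"
  by (simp add: plancherel_const_def)

lemma Plancherel_L1_L2_norm: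
  fixes f :: "'a::euclidean_space \<Rightarrow> complex"
  assumes "integrable lborel f" "f \<in> L2"
  shows "L2_norm (fourier_integral f) = plancherel_const TYPE('a) * L2_norm f"
  using Plancherel_L1_L2(2)[OF assms] L2_norm_nonneg[of f] L2_norm_nonneg[of "fourier_integral f"]
  unfolding plancherel_const_def
  by (metis abs_of_nonneg real_sqrt_abs real_sqrt_mult)

lemma fourier_truncation_L2: "f \<in> L2 \<Longrightarrow> fourier_integral (truncation f R) \<in> L2"
  by (intro Plancherel_L1_L2 truncation_L2)

lemma is_fourier_transform_iff:
  assumes f: "f \<in> L2"
  shows "is_fourier_transform f g \<longleftrightarrow> g \<in> L2 \<and>
    ((\<lambda>R. L2_norm (\<lambda>\<xi>. fourier_integral (truncation f R) \<xi> - g \<xi>)) \<longlongrightarrow> 0) at_top"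
proof (cases "g \<in> L2")
  case g: True
  let ?N = "\<lambda>R. L2_norm (\<lambda>\<xi>. fourier_integral (truncation f R) \<xi> - g \<xi>)"
  have "(\<integral>\<^sup>+\<xi>. ennreal ((cmod (fourier_integral (truncation f R) \<xi> - g \<xi>))\<^sup>2) \<partial>lborel) = ennreal ((?N R)\<^sup>2)" for R
    using truncation_L2[OF f] by (intro nn_integral_L2 L2_diff Plancherel_L1_L2 g)
  moreover have "((\<lambda>R. ennreal ((?N R)\<^sup>2)) \<longlongrightarrow> 0) at_top \<longleftrightarrow> ((\<lambda>R. (?N R)\<^sup>2) \<longlongrightarrow> 0) at_top"
    using tendsto_ennreal_iff[where F=at_top and f="\<lambda>R. (?N R)\<^sup>2" and x=0] by simp
  moreover have "((\<lambda>R. (?N R)\<^sup>2) \<longlongrightarrow> 0) at_top \<longleftrightarrow> (?N \<longlongrightarrow> 0) at_top"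
  proof
    assume "((\<lambda>R. (?N R)\<^sup>2) \<longlongrightarrow> 0) at_top"
    then have "((\<lambda>R. sqrt ((?N R)\<^sup>2)) \<longlongrightarrow> sqrt 0) at_top" by (rule tendsto_real_sqrt)
    then show "(?N \<longlongrightarrow> 0) at_top" by simp
  next
    assume "(?N \<longlongrightarrow> 0) at_top"
    then have "((\<lambda>R. (?N R)\<^sup>2) \<longlongrightarrow> 0\<^sup>2) at_top" by (rule tendsto_power)
    then show "((\<lambda>R. (?N R)\<^sup>2) \<longlongrightarrow> 0) at_top" by simp
  qed
  ultimately show ?thesis using g by (simp add: is_fourier_transform_def)
qed (simp add: is_fourier_transform_def)

lemma L2_norm_fourier_truncation_diff:
  fixes f :: "'a::euclidean_space \<Rightarrow> complex"
  assumes f: "f \<in> L2"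
  shows "L2_norm (\<lambda>\<xi>. fourier_integral (truncation f R) \<xi> - fourier_integral (truncation f S) \<xi>)
    \<le> plancherel_const TYPE('a) * (L2_norm (\<lambda>x. truncation f R x - f x) + L2_norm (\<lambda>x. truncation f S x - f x))"
proof -
  let ?d = "\<lambda>x. truncation f R x - truncation f S x"
  have d: "integrable lborel ?d" "?d \<in> L2"
    using truncation_L2[OF f, of R] truncation_L2[OF f, of S]
    by (auto intro!: L2_diff Bochner_Integration.integrable_diff)
  have "L2_norm (\<lambda>\<xi>. fourier_integral (truncation f R) \<xi> - fourier_integral (truncation f S) \<xi>)
      = plancherel_const TYPE('a) * L2_norm ?d"
    unfolding fourier_integral_diff[OF truncation_L2(2)[OF f] truncation_L2(2)[OF f], symmetric]
    by (rule Plancherel_L1_L2_norm[OF d])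
  also have "\<dots> \<le> plancherel_const TYPE('a) * (L2_norm (\<lambda>x. truncation f R x - f x) + L2_norm (\<lambda>x. f x - truncation f S x))"
    using plancherel_const_pos[of "TYPE('a)"]
    by (intro mult_left_mono L2_norm_triangle3 truncation_L2 f) auto
  finally show ?thesis using L2_norm_minus_commute[of f "truncation f S"] by simp
qed

text \<open>By Plancherel for integrable functions the transforms of the truncations are Cauchy, and
  completeness supplies a limit along integer radii.\<close>

lemma fourier_transform_exists:
  fixes f :: "'a::euclidean_space \<Rightarrow> complex"
  assumes f: "f \<in> L2"
  shows "\<exists>g. is_fourier_transform f g"
proof -
  let ?F = "\<lambda>R. fourier_integral (truncation f R)"
  let ?e = "\<lambda>R. L2_norm (\<lambda>x. truncation f R x - f x)"
  define c where "c = plancherel_const TYPE('a)"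
  have c: "c > 0" by (simp add: c_def plancherel_const_pos)
  note F = fourier_truncation_L2[OF f]
  have dF: "L2_norm (\<lambda>\<xi>. ?F R \<xi> - ?F S \<xi>) \<le> c * (?e R + ?e S)" for R S
    unfolding c_def by (rule L2_norm_fourier_truncation_diff[OF f])
  have e0: "(\<lambda>n. ?e (real n)) \<longlonglongrightarrow> 0"
    by (rule filterlim_compose[OF truncation_tendsto_L2[OF f] filterlim_real_sequentially])
  have "\<exists>g\<in>L2. (\<lambda>n. L2_norm (\<lambda>\<xi>. ?F (real n) \<xi> - g \<xi>)) \<longlonglongrightarrow> 0"
  proof (rule L2_complete[OF F])
    fix d :: real assume d: "d > 0"
    then have "d / (2 * c) > 0" using c by simp
    from LIMSEQ_D[OF e0 this] obtain N where N: "\<And>n. n \<ge> N \<Longrightarrow> ?e (real n) < d / (2 * c)" by auto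
    have "L2_norm (\<lambda>\<xi>. ?F (real m) \<xi> - ?F (real n) \<xi>) \<le> d" if "m \<ge> N" "n \<ge> N" for m n
    proof -
      have "c * (?e (real m) + ?e (real n)) \<le> c * (d / (2 * c) + d / (2 * c))"
        using N[OF that(1)] N[OF that(2)] c by (intro mult_left_mono add_mono) auto
      also have "\<dots> = d" using c by (simp add: field_simps)
      finally show ?thesis using dF[of "real m" "real n"] by linarith
    qed
    then show "\<exists>N. \<forall>m\<ge>N. \<forall>n\<ge>N. L2_norm (\<lambda>\<xi>. ?F (real m) \<xi> - ?F (real n) \<xi>) \<le> d" by blast
  qed
  then obtain g where g: "g \<in> L2" and lim: "(\<lambda>n. L2_norm (\<lambda>\<xi>. ?F (real n) \<xi> - g \<xi>)) \<longlonglongrightarrow> 0" by blast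
  \<comment> \<open>Letting \<open>n\<close> tend to infinity in the Cauchy estimate gives a rate
    for every real radius, hence convergence along \<open>at_top\<close> and not only along the
    integers.\<close>
  have le: "L2_norm (\<lambda>\<xi>. ?F R \<xi> - g \<xi>) \<le> c * ?e R" for R
  proof (rule LIMSEQ_le_const)
    show "(\<lambda>n. c * (?e R + ?e (real n)) + L2_norm (\<lambda>\<xi>. ?F (real n) \<xi> - g \<xi>)) \<longlonglongrightarrow> c * ?e R"
      using tendsto_add[OF tendsto_mult[OF tendsto_const tendsto_add[OF tendsto_const e0]] lim, of c "?e R"]
      by simp
    show "\<exists>N. \<forall>n\<ge>N. L2_norm (\<lambda>\<xi>. ?F R \<xi> - g \<xi>) \<le> c * (?e R + ?e (real n)) + L2_norm (\<lambda>\<xi>. ?F (real n) \<xi> - g \<xi>)"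
      using L2_norm_triangle3[OF F F g] dF by (meson add_right_mono order_trans)
  qed
  have "((\<lambda>R. L2_norm (\<lambda>\<xi>. ?F R \<xi> - g \<xi>)) \<longlongrightarrow> 0) at_top"
  proof (rule tendsto_sandwich[where f="\<lambda>_. 0"])
    show "((\<lambda>R. c * ?e R) \<longlongrightarrow> 0) at_top"
      by (intro tendsto_mult_right_zero truncation_tendsto_L2 f)
  qed (use le in auto)
  then show ?thesis using g is_fourier_transform_iff[OF f] by blast
qed

section \<open>Uniqueness, Plancherel's identity and linearity of the selected transform\<close>

lemma is_fourier_transform_fourier: "f \<in> L2 \<Longrightarrow> is_fourier_transform f (fourier f)"
  unfolding fourier_def by (rule someI_ex[OF fourier_transform_exists])

lemma fourier_L2 [simp]: "f \<in> L2 \<Longrightarrow> fourier f \<in> L2"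
  using is_fourier_transform_fourier by (auto simp: is_fourier_transform_def)

lemma fourier_AE_unique:
  assumes f: "f \<in> L2" and g: "is_fourier_transform f g"
  shows "AE \<xi> in lborel. fourier f \<xi> = g \<xi>"
proof -
  let ?F = "\<lambda>R. fourier_integral (truncation f R)"
  note F = fourier_truncation_L2[OF f]
  have g2: "g \<in> L2" and g0: "((\<lambda>R. L2_norm (\<lambda>\<xi>. ?F R \<xi> - g \<xi>)) \<longlongrightarrow> 0) at_top"
    and h0: "((\<lambda>R. L2_norm (\<lambda>\<xi>. ?F R \<xi> - fourier f \<xi>)) \<longlongrightarrow> 0) at_top"
    using g is_fourier_transform_fourier[OF f] is_fourier_transform_iff[OF f] by auto
  have "L2_norm (\<lambda>\<xi>. fourier f \<xi> - g \<xi>) \<le> 0"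
  proof (rule tendsto_lowerbound)
    show "((\<lambda>R. L2_norm (\<lambda>\<xi>. ?F R \<xi> - fourier f \<xi>) + L2_norm (\<lambda>\<xi>. ?F R \<xi> - g \<xi>)) \<longlongrightarrow> 0) at_top"
      using tendsto_add[OF h0 g0] by simp
    show "\<forall>\<^sub>F R in at_top. L2_norm (\<lambda>\<xi>. fourier f \<xi> - g \<xi>)
      \<le> L2_norm (\<lambda>\<xi>. ?F R \<xi> - fourier f \<xi>) + L2_norm (\<lambda>\<xi>. ?F R \<xi> - g \<xi>)"
      using L2_norm_triangle3[OF fourier_L2[OF f] F g2] L2_norm_minus_commute[of "fourier f"]
      by (intro always_eventually) simp
  qed simp
  then have "L2_norm (\<lambda>\<xi>. fourier f \<xi> - g \<xi>) = 0" using L2_norm_nonneg by (metis antisym)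
  then show ?thesis
    using L2_norm_eq_0_iff[OF L2_diff(1)[OF fourier_L2[OF f] g2]] by simp
qed

theorem Plancherel:
  fixes f :: "'a::euclidean_space \<Rightarrow> complex"
  assumes f: "f \<in> L2"
  shows "L2_norm (fourier f) = plancherel_const TYPE('a) * L2_norm f"
proof (rule tendsto_unique)
  let ?F = "\<lambda>R. fourier_integral (truncation f R)"
  note F = fourier_truncation_L2[OF f]
  have conv: "((\<lambda>R. L2_norm (s R)) \<longlongrightarrow> L2_norm g) at_top"
    if "\<And>R. s R \<in> L2" "g \<in> L2" "((\<lambda>R. L2_norm (\<lambda>x. s R x - g x)) \<longlongrightarrow> 0) at_top"
    for s :: "real \<Rightarrow> 'a \<Rightarrow> complex" and g
    by (rule LIM_zero_cancel, rule Lim_null_comparison[OF _ that(3)])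
       (use L2_norm_diff_ge[OF that(1,2)] in auto)
  show "((\<lambda>R. L2_norm (?F R)) \<longlongrightarrow> L2_norm (fourier f)) at_top"
    using is_fourier_transform_fourier[OF f] is_fourier_transform_iff[OF f] F f by (intro conv) auto
  have "L2_norm (?F R) = plancherel_const TYPE('a) * L2_norm (truncation f R)" for R
    using truncation_L2[OF f] by (intro Plancherel_L1_L2_norm)
  then show "((\<lambda>R. L2_norm (?F R)) \<longlongrightarrow> plancherel_const TYPE('a) * L2_norm f) at_top"
    using truncation_L2(1)[OF f] truncation_tendsto_L2[OF f] f
    by (auto intro!: tendsto_mult_left conv)
qed simp

lemma fourier_diff_AE:
  assumes f: "f \<in> L2" and g: "g \<in> L2"
  shows "AE \<xi> in lborel. fourier (\<lambda>x. f x - g x) \<xi> = fourier f \<xi> - fourier g \<xi>"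
proof (rule fourier_AE_unique[OF L2_diff(1)[OF f g]])
  let ?F = "\<lambda>f R. fourier_integral (truncation f R)"
  note F = fourier_truncation_L2
  note lim = is_fourier_transform_fourier[OF f, unfolded is_fourier_transform_iff[OF f]]
    is_fourier_transform_fourier[OF g, unfolded is_fourier_transform_iff[OF g]]
  have eq: "?F (\<lambda>x. f x - g x) R \<xi> = ?F f R \<xi> - ?F g R \<xi>" for R \<xi>
    using fourier_integral_diff[OF truncation_L2(2)[OF f] truncation_L2(2)[OF g], of R R \<xi>]
    by (simp add: scaleR_diff_right)
  have "((\<lambda>R. L2_norm (\<lambda>\<xi>. ?F (\<lambda>x. f x - g x) R \<xi> - (fourier f \<xi> - fourier g \<xi>))) \<longlongrightarrow> 0) at_top"
  proof (rule tendsto_sandwich[where f="\<lambda>_. 0"])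
    show "((\<lambda>R. L2_norm (\<lambda>\<xi>. ?F f R \<xi> - fourier f \<xi>) + L2_norm (\<lambda>\<xi>. ?F g R \<xi> - fourier g \<xi>)) \<longlongrightarrow> 0) at_top"
      using tendsto_add[OF conjunct2[OF lim(1)] conjunct2[OF lim(2)]] by simp
    have "L2_norm (\<lambda>\<xi>. ?F (\<lambda>x. f x - g x) R \<xi> - (fourier f \<xi> - fourier g \<xi>))
      \<le> L2_norm (\<lambda>\<xi>. ?F f R \<xi> - fourier f \<xi>) + L2_norm (\<lambda>\<xi>. ?F g R \<xi> - fourier g \<xi>)" for R
      using L2_diff(2)[OF L2_diff(1)[OF F[OF f] fourier_L2[OF f]] L2_diff(1)[OF F[OF g] fourier_L2[OF g]], of R R]
      unfolding eq by (simp add: algebra_simps)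
    then show "\<forall>\<^sub>F R in at_top. L2_norm (\<lambda>\<xi>. ?F (\<lambda>x. f x - g x) R \<xi> - (fourier f \<xi> - fourier g \<xi>))
      \<le> L2_norm (\<lambda>\<xi>. ?F f R \<xi> - fourier f \<xi>) + L2_norm (\<lambda>\<xi>. ?F g R \<xi> - fourier g \<xi>)" by simp
  qed auto
  then show "is_fourier_transform (\<lambda>x. f x - g x) (\<lambda>\<xi>. fourier f \<xi> - fourier g \<xi>)"
    using f g by (auto simp: is_fourier_transform_iff[OF L2_diff(1)[OF f g]] intro!: L2_diff(1))
qed

lemma fourier_cmult_AE:
  assumes f: "f \<in> L2"
  shows "AE \<xi> in lborel. fourier (\<lambda>x. c * f x) \<xi> = c * fourier f \<xi>"
proof (rule fourier_AE_unique[OF L2_cmult(1)[OF f]])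
  note lim = is_fourier_transform_fourier[OF f, unfolded is_fourier_transform_iff[OF f]]
  note F = fourier_truncation_L2[OF f]
  have "fourier_integral (truncation (\<lambda>x. c * f x) R) \<xi> = c * fourier_integral (truncation f R) \<xi>" for R \<xi>
    unfolding fourier_integral_def integral_mult_right_zero[symmetric]
    by (intro Bochner_Integration.integral_cong refl) (simp add: scaleR_conv_of_real mult_ac)
  then have "L2_norm (\<lambda>\<xi>. fourier_integral (truncation (\<lambda>x. c * f x) R) \<xi> - c * fourier f \<xi>)
      = cmod c * L2_norm (\<lambda>\<xi>. fourier_integral (truncation f R) \<xi> - fourier f \<xi>)" for R
    using L2_cmult(2)[OF L2_diff(1)[OF F fourier_L2[OF f]], of c R] by (simp add: right_diff_distrib)
  then show "is_fourier_transform (\<lambda>x. c * f x) (\<lambda>\<xi>. c * fourier f \<xi>)"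
    using lim tendsto_mult_right_zero[OF conjunct2[OF lim], of "cmod c"]
    by (auto simp: is_fourier_transform_iff[OF L2_cmult(1)[OF f]] intro!: L2_cmult(1))
qed

text \<open>The difference between \<open>f\<close> and its truncation is both integrable and square
  integrable, so Plancherel applies to it and shows that the Fourier integral is the required L^2
  limit.\<close>

lemma fourier_eq_fourier_integral_AE:
  fixes f :: "'a::euclidean_space \<Rightarrow> complex"
  assumes f: "f \<in> L2" and fi: "integrable lborel f"
  shows "AE \<xi> in lborel. fourier f \<xi> = fourier_integral f \<xi>"
proof (rule fourier_AE_unique[OF f])
  have "L2_norm (\<lambda>\<xi>. fourier_integral (truncation f R) \<xi> - fourier_integral f \<xi>)
      = plancherel_const TYPE('a) * L2_norm (\<lambda>x. truncation f R x - f x)" for R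
    unfolding fourier_integral_diff[OF truncation_L2(2)[OF f] fi, symmetric]
    by (rule Plancherel_L1_L2_norm) (intro Bochner_Integration.integrable_diff L2_diff truncation_L2 f fi)+
  then show "is_fourier_transform f (fourier_integral f)"
    using tendsto_mult_right_zero[OF truncation_tendsto_L2[OF f], of "plancherel_const TYPE('a)"]
    by (simp add: is_fourier_transform_iff[OF f] Plancherel_L1_L2(1)[OF fi f])
qed

text \<open>Genuine equality, not just almost everywhere: the predicate from which
  \<open>fourier\<close> selects depends only on the Fourier integrals of the truncations. These
  agree at every frequency, so the choice operator returns the same representative.\<close>

lemma fourier_cong_AE:
  assumes "f \<in> borel_measurable lborel" "g \<in> borel_measurable lborel" "AE x in lborel. f x = g x"
  shows "fourier f = fourier g"
proof -
  have [measurable]: "truncation f R \<in> borel_measurable lborel" "truncation g R \<in> borel_measurable lborel" for R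
    using assms by (intro truncation_measurable; simp)+
  have "fourier_integral (truncation f R) = fourier_integral (truncation g R)" for R
    unfolding fourier_integral_def
    by (rule ext, rule integral_cong_AE) (measurable, use assms(3) in \<open>auto elim!: eventually_mono\<close>)
  then show ?thesis by (simp add: fourier_def is_fourier_transform_def)
qed

section \<open>Oscillator equations in weak form\<close>

text \<open>Only the limit of \<open>\<phi>\<close> at \<open>t\<close> matters, because the factor
  \<open>r - t\<close> hides its value there. This suits difference quotients, where
  \<open>inverse 0 = 0\<close> produces a meaningless value at \<open>r = t\<close>.\<close>

lemma has_vector_derivative_affine_factor:
  fixes \<phi> :: "real \<Rightarrow> 'b::real_normed_vector"
  assumes "(\<phi> \<longlongrightarrow> l) (at t within X)"
  shows "((\<lambda>r. (r - t) *\<^sub>R \<phi> r) has_vector_derivative l) (at t within X)"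
  unfolding has_vector_derivative_def has_derivative_within
proof (intro conjI bounded_linear_scaleR_left)
  have "((\<lambda>r. sgn (r - t) *\<^sub>R (\<phi> r - l)) \<longlongrightarrow> 0) (at t within X)"
  proof (rule Lim_null_comparison)
    show "((\<lambda>r. norm (\<phi> r - l)) \<longlongrightarrow> 0) (at t within X)"
      using tendsto_norm_zero[OF LIM_zero[OF assms]] .
    show "\<forall>\<^sub>F r in at t within X. norm (sgn (r - t) *\<^sub>R (\<phi> r - l)) \<le> norm (\<phi> r - l)"
      by (intro always_eventually) (simp add: sgn_if)
  qed
  moreover have "(1 / norm (r - t)) *\<^sub>R ((r - t) *\<^sub>R \<phi> r - ((t - t) *\<^sub>R \<phi> t + (r - t) *\<^sub>R l))
      = sgn (r - t) *\<^sub>R (\<phi> r - l)" for r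
  proof -
    have "1 / norm (r - t) * (r - t) = sgn (r - t)"
      by (cases r t rule: linorder_cases) (simp_all add: divide_eq_eq)
    then show ?thesis
      by (simp only: diff_self scaleR_zero_left add_0_left scaleR_diff_right[symmetric] scaleR_scaleR)
  qed
  ultimately show "((\<lambda>r. (1 / norm (r - t)) *\<^sub>R ((r - t) *\<^sub>R \<phi> r - ((t - t) *\<^sub>R \<phi> t + (r - t) *\<^sub>R l))) \<longlongrightarrow> 0)
      (at t within X)" by simp
qed

text \<open>Bilinear, without conjugation, so that multipliers move freely between the two
  arguments.\<close>

definition pairing :: "('a::euclidean_space \<Rightarrow> complex) \<Rightarrow> ('a \<Rightarrow> complex) \<Rightarrow> complex" where
  "pairing F k = (\<integral>x. F x * k x \<partial>lborel)"

lemma pairing_diff_left: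
  "F \<in> L2 \<Longrightarrow> G \<in> L2 \<Longrightarrow> k \<in> L2 \<Longrightarrow> pairing (\<lambda>x. F x - G x) k = pairing F k - pairing G k"
  using L2_mult_integrable[of F k] L2_mult_integrable[of G k] by (simp add: pairing_def left_diff_distrib)

lemma pairing_add_right:
  "F \<in> L2 \<Longrightarrow> k \<in> L2 \<Longrightarrow> k' \<in> L2 \<Longrightarrow> pairing F (\<lambda>x. k x + k' x) = pairing F k + pairing F k'"
  using L2_mult_integrable[of F k] L2_mult_integrable[of F k'] by (simp add: pairing_def distrib_left)

lemma pairing_cmult_right: "pairing F (\<lambda>x. c * k x) = c * pairing F k"
  unfolding pairing_def integral_mult_right_zero[symmetric] by (simp only: mult_ac)

lemma pairing_cmult_left: "pairing (\<lambda>x. c * F x) k = c * pairing F k"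
  unfolding pairing_def integral_mult_right_zero[symmetric] by (simp only: mult_ac)

lemma pairing_bound: "F \<in> L2 \<Longrightarrow> k \<in> L2 \<Longrightarrow> cmod (pairing F k) \<le> L2_norm F * L2_norm k"
  unfolding pairing_def by (rule L2_Cauchy_Schwarz)

lemma pairing_tendsto:
  assumes F: "\<And>r. r \<in> X \<Longrightarrow> F r \<in> L2" and G: "G \<in> L2" and k: "k \<in> L2"
    and lim: "((\<lambda>r. L2_norm (\<lambda>x. F r x - G x)) \<longlongrightarrow> 0) (at t within X)"
  shows "((\<lambda>r. pairing (F r) k) \<longlongrightarrow> pairing G k) (at t within X)"
proof (rule LIM_zero_cancel, rule Lim_null_comparison)
  show "((\<lambda>r. L2_norm (\<lambda>x. F r x - G x) * L2_norm k) \<longlongrightarrow> 0) (at t within X)"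
    by (rule tendsto_mult_left_zero[OF lim])
  have "norm (pairing (F r) k - pairing G k) \<le> L2_norm (\<lambda>x. F r x - G x) * L2_norm k" if "r \<in> X" for r
    using pairing_bound[OF L2_diff(1)[OF F[OF that] G] k] pairing_diff_left[OF F[OF that] G k] by simp
  then show "\<forall>\<^sub>F r in at t within X. norm (pairing (F r) k - pairing G k) \<le> L2_norm (\<lambda>x. F r x - G x) * L2_norm k"
    by (auto simp: eventually_at_filter)
qed

text \<open>Only \<open>K\<close> has to be differentiable in norm; for \<open>F\<close> continuity in norm and
  differentiability against the single function \<open>K t\<close> suffice.\<close>

lemma pairing_product_rule:
  assumes t: "t \<in> X" and F: "\<And>r. r \<in> X \<Longrightarrow> F r \<in> L2" and K: "\<And>r. r \<in> X \<Longrightarrow> K r \<in> L2" and K': "K' \<in> L2"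
    and cont: "((\<lambda>r. L2_norm (\<lambda>x. F r x - F t x)) \<longlongrightarrow> 0) (at t within X)"
    and rem: "\<And>r. r \<in> X \<Longrightarrow> L2_norm (\<lambda>x. K r x - K t x - of_real (r - t) * K' x) \<le> (r - t)\<^sup>2 * B"
    and D: "((\<lambda>r. pairing (F r) (K t)) has_vector_derivative D) (at t within X)"
  shows "((\<lambda>r. pairing (F r) (K r)) has_vector_derivative D + pairing (F t) K') (at t within X)"
proof -
  let ?R = "\<lambda>r x. K r x - K t x - of_real (r - t) * K' x"
  \<comment> \<open>The contribution of the change in \<open>K\<close>, divided by
    \<open>r - t\<close>: derivative plus remainder. The remainder is quadratic in
    \<open>r - t\<close> while \<open>F r\<close> stays bounded in norm near \<open>t\<close>, so
    the second summand tends to 0.\<close>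
  let ?\<phi> = "\<lambda>r. pairing (F r) K' + inverse (of_real (r - t)) * pairing (F r) (?R r)"
  have R: "?R r \<in> L2" if "r \<in> X" for r
    using K[OF that] K[OF t] K' by (intro L2_diff(1) L2_cmult(1))
  have split: "pairing (F r) (K r) = pairing (F r) (K t) + (r - t) *\<^sub>R ?\<phi> r" if "r \<in> X" for r
  proof -
    have K'r: "(\<lambda>x. of_real (r - t) * K' x) \<in> L2" by (rule L2_cmult(1)[OF K'])
    have "pairing (F r) (K r) = pairing (F r) (\<lambda>x. (K t x + of_real (r - t) * K' x) + ?R r x)"
      by simp
    also have "\<dots> = pairing (F r) (\<lambda>x. K t x + of_real (r - t) * K' x) + pairing (F r) (?R r)"
      by (rule pairing_add_right[OF F[OF that] L2_add(1)[OF K[OF t] K'r] R[OF that]])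
    also have "pairing (F r) (\<lambda>x. K t x + of_real (r - t) * K' x)
        = pairing (F r) (K t) + of_real (r - t) * pairing (F r) K'"
      unfolding pairing_add_right[OF F[OF that] K[OF t] K'r] pairing_cmult_right ..
    finally have "pairing (F r) (K r)
        = pairing (F r) (K t) + of_real (r - t) * pairing (F r) K' + pairing (F r) (?R r)" .
    moreover have "pairing (F r) (?R r) = (r - t) *\<^sub>R (inverse (of_real (r - t)) * pairing (F r) (?R r))"
    proof (cases "r = t")
      case True
      then show ?thesis by (simp add: pairing_def)
    next
      case False
      then show ?thesis by (simp add: scaleR_conv_of_real field_simps)
    qed
    ultimately show ?thesis by (simp only: scaleR_conv_of_real distrib_left add.assoc)
  qed
  have "(?\<phi> \<longlongrightarrow> pairing (F t) K' + 0) (at t within X)"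
  proof (intro tendsto_add pairing_tendsto F K' cont t)
    show "((\<lambda>r. inverse (of_real (r - t)) * pairing (F r) (?R r)) \<longlongrightarrow> 0) (at t within X)"
    proof (rule Lim_null_comparison)
      show "((\<lambda>r. \<bar>r - t\<bar> * ((L2_norm (F t) + L2_norm (\<lambda>x. F r x - F t x)) * B)) \<longlongrightarrow> 0) (at t within X)"
      proof -
        have "((\<lambda>r. \<bar>r - t\<bar> * ((L2_norm (F t) + L2_norm (\<lambda>x. F r x - F t x)) * B)) \<longlongrightarrow>
          \<bar>t - t\<bar> * ((L2_norm (F t) + 0) * B)) (at t within X)"
          by (intro tendsto_intros cont)
        then show ?thesis by simp
      qed
      have "norm (inverse (of_real (r - t)) * pairing (F r) (?R r))
          \<le> \<bar>r - t\<bar> * ((L2_norm (F t) + L2_norm (\<lambda>x. F r x - F t x)) * B)" if r: "r \<in> X" "r \<noteq> t" for r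
      proof -
        have "cmod (pairing (F r) (?R r)) \<le> L2_norm (F r) * L2_norm (?R r)"
          by (rule pairing_bound[OF F[OF r(1)] R[OF r(1)]])
        also have "\<dots> \<le> (L2_norm (F t) + L2_norm (\<lambda>x. F r x - F t x)) * ((r - t)\<^sup>2 * B)"
          using L2_norm_diff_ge[OF F[OF r(1)] F[OF t]] rem[OF r(1)] by (intro mult_mono) auto
        finally have "inverse \<bar>r - t\<bar> * cmod (pairing (F r) (?R r))
            \<le> inverse \<bar>r - t\<bar> * ((L2_norm (F t) + L2_norm (\<lambda>x. F r x - F t x)) * ((r - t)\<^sup>2 * B))"
          by (intro mult_left_mono) auto
        also have "\<dots> = \<bar>r - t\<bar> * ((L2_norm (F t) + L2_norm (\<lambda>x. F r x - F t x)) * B)"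
          using r by (simp add: power2_eq_square abs_if field_simps)
        finally show ?thesis
          by (simp only: norm_mult norm_inverse norm_of_real)
      qed
      then show "\<forall>\<^sub>F r in at t within X. norm (inverse (of_real (r - t)) * pairing (F r) (?R r))
          \<le> \<bar>r - t\<bar> * ((L2_norm (F t) + L2_norm (\<lambda>x. F r x - F t x)) * B)"
        by (auto simp: eventually_at_filter)
    qed
  qed
  then have "((\<lambda>r. pairing (F r) (K t) + (r - t) *\<^sub>R ?\<phi> r) has_vector_derivative D + pairing (F t) K') (at t within X)"
    using has_vector_derivative_add[OF D has_vector_derivative_affine_factor] by simp
  then show ?thesis
    by (rule has_vector_derivative_transform[OF t, rotated]) (use split in simp)
qed

text \<open>Test functions vanish at the origin, where the frequency \<open>f\<close> is zero and \<open>sin (t f) / f\<close> takes the junk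
  value \<open>0\<close> instead of \<open>t\<close>.\<close>

definition test_function :: "('a::euclidean_space \<Rightarrow> complex) \<Rightarrow> bool" where
  "test_function k \<longleftrightarrow> k \<in> borel_measurable borel \<and>
    (\<exists>R M. \<forall>\<xi>. cmod (k \<xi>) \<le> M \<and> (k \<xi> \<noteq> 0 \<longrightarrow> \<xi> \<noteq> 0 \<and> norm \<xi> \<le> R))"

lemma test_function_L2:
  fixes k :: "'a::euclidean_space \<Rightarrow> complex"
  assumes "test_function k"
  shows "k \<in> L2"
proof -
  obtain R M where k: "\<And>\<xi>. cmod (k \<xi>) \<le> M" "\<And>\<xi>. k \<xi> \<noteq> 0 \<Longrightarrow> norm \<xi> \<le> R"
    using assms by (auto simp: test_function_def)
  have "(\<lambda>\<xi>::'a. of_real M * of_real (indicat_real (cball 0 R) \<xi>)) \<in> L2"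
    using emeasure_lborel_cball_finite[of "0::'a" R]
    by (intro L2_cmult(1) L2_indicator) (auto simp: less_top)
  then show ?thesis
  proof (rule L2_mono(1))
    show "AE \<xi> in lborel. cmod (k \<xi>) \<le> cmod (of_real M * of_real (indicat_real (cball 0 R) \<xi>))"
    proof (rule AE_I2)
      fix \<xi> show "cmod (k \<xi>) \<le> cmod (of_real M * of_real (indicat_real (cball 0 R) \<xi>))"
      proof (cases "k \<xi> = 0")
        case False
        then show ?thesis using k(1)[of \<xi>] k(2)[of \<xi>] by (simp add: norm_mult)
      qed simp
    qed
  qed (use assms in \<open>simp add: test_function_def\<close>)
qed

lemma test_function_mult:
  assumes k: "test_function k" and [measurable]: "m \<in> borel_measurable borel"
    and m: "\<And>R. \<exists>M. \<forall>\<xi>. \<xi> \<noteq> 0 \<longrightarrow> norm \<xi> \<le> R \<longrightarrow> \<bar>m \<xi>\<bar> \<le> M"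
  shows "test_function (\<lambda>\<xi>. of_real (m \<xi>) * k \<xi>)"
proof -
  have [measurable]: "k \<in> borel_measurable borel" using k by (simp add: test_function_def)
  obtain R M where k: "\<And>\<xi>. cmod (k \<xi>) \<le> M" "\<And>\<xi>. k \<xi> \<noteq> 0 \<Longrightarrow> \<xi> \<noteq> 0 \<and> norm \<xi> \<le> R"
    using k by (auto simp: test_function_def)
  obtain L where L: "\<And>\<xi>. \<xi> \<noteq> 0 \<Longrightarrow> norm \<xi> \<le> R \<Longrightarrow> \<bar>m \<xi>\<bar> \<le> L" using m[of R] by blast
  have "0 \<le> M" using k(1)[of 0] norm_ge_zero[of "k 0"] by linarith
  have "cmod (of_real (m \<xi>) * k \<xi>) \<le> \<bar>L\<bar> * M" for \<xi>
  proof (cases "k \<xi> = 0")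
    case False
    then have "\<bar>m \<xi>\<bar> \<le> \<bar>L\<bar>" using L k(2) by (meson abs_ge_self order_trans)
    then show ?thesis using k(1)[of \<xi>] \<open>0 \<le> M\<close> by (auto simp: norm_mult intro!: mult_mono)
  qed (use \<open>0 \<le> M\<close> in auto)
  then show ?thesis unfolding test_function_def
    using k(2) by (intro conjI exI[of _ R] exI[of _ "\<bar>L\<bar> * M"]) auto
qed

text \<open>At \<open>y = 0\<close> the quotient is 0 by the convention for division, so the bound
  needs no case distinction later.\<close>

lemma abs_sin_quotient_le: "\<bar>sin (t * y) / y\<bar> \<le> \<bar>t :: real\<bar>"
  using abs_sin_x_le_abs_x[of "t * y"] by (cases "y = 0") (simp_all add: divide_le_eq abs_mult)

lemma sin_quotient_square_le: "(sin (t * y) / y)\<^sup>2 \<le> (t :: real)\<^sup>2"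
  using abs_sin_quotient_le by (simp only: abs_le_square_iff)

text \<open>Imaginary and real parts of the first-order Taylor estimate for
  \<open>iexp (- y)\<close>, multiplied by the unimodular \<open>iexp x\<close>. The quadratic error
  is the form required by \<open>pairing_product_rule\<close>.\<close>

lemma sin_cos_second_order:
  fixes x y :: real
  shows "\<bar>sin (x - y) - sin x + y * cos x\<bar> \<le> y\<^sup>2 / 2" "\<bar>cos (x - y) - cos x - y * sin x\<bar> \<le> y\<^sup>2 / 2"
proof -
  have "cmod (iexp (- y) - (\<Sum>k\<le>1. (\<i> * of_real (- y)) ^ k / fact k)) \<le> \<bar>- y\<bar> ^ Suc 1 / fact (Suc 1)"
    by (rule iexp_approx1)
  then have "cmod (iexp (- y) - (1 - \<i> * y)) \<le> y\<^sup>2 / 2"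
    by (simp add: power2_eq_square abs_mult_self_eq)
  then have *: "cmod (iexp x * (iexp (- y) - (1 - \<i> * y))) \<le> y\<^sup>2 / 2"
    by (simp add: norm_mult)
  have e: "iexp x * (iexp (- y) - (1 - \<i> * y)) = iexp (x - y) - iexp x + \<i> * y * iexp x"
    by (simp add: exp_add[symmetric] algebra_simps)
  have i: "iexp z = cis z" for z by (simp add: cis_conv_exp)
  show "\<bar>sin (x - y) - sin x + y * cos x\<bar> \<le> y\<^sup>2 / 2"
    using order_trans[OF abs_Im_le_cmod *] unfolding e i by (simp add: sin_diff cos_diff algebra_simps)
  show "\<bar>cos (x - y) - cos x - y * sin x\<bar> \<le> y\<^sup>2 / 2"
    using order_trans[OF abs_Re_le_cmod *] unfolding e i by (simp add: sin_diff cos_diff algebra_simps)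
qed

text \<open>The problem seen from the Fourier side: \<open>U\<close> and \<open>V\<close> stand for
  the transforms of \<open>u\<close> and its time derivative, \<open>a\<close> for the symbol in
  front of the acceleration, and \<open>a * f^2\<close> for the elastic symbol. The equation keeps
  its time-integrated weak form, with the conjugation absorbed into the test function.\<close>

locale oscillator_family =
  fixes f a :: "'a::euclidean_space \<Rightarrow> real" and U V :: "real \<Rightarrow> 'a \<Rightarrow> complex"
  assumes f_measurable [measurable]: "f \<in> borel_measurable borel"
    and a_measurable [measurable]: "a \<in> borel_measurable borel"
    and f_pos: "\<And>\<xi>. \<xi> \<noteq> 0 \<Longrightarrow> f \<xi> > 0"
    and f_locally_bounded: "\<And>R. \<exists>M. \<forall>\<xi>. \<xi> \<noteq> 0 \<longrightarrow> norm \<xi> \<le> R \<longrightarrow> f \<xi> \<le> M"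
    and a_ge: "\<And>\<xi>. a \<xi> \<ge> 1"
    and U: "\<And>t. t \<ge> 0 \<Longrightarrow> U t \<in> L2" and V: "\<And>t. t \<ge> 0 \<Longrightarrow> V t \<in> L2"
    and U_cont: "\<And>t. t \<ge> 0 \<Longrightarrow> ((\<lambda>r. L2_norm (\<lambda>\<xi>. U r \<xi> - U t \<xi>)) \<longlongrightarrow> 0) (at t within {0..})"
    and V_cont: "\<And>t. t \<ge> 0 \<Longrightarrow> ((\<lambda>r. L2_norm (\<lambda>\<xi>. V r \<xi> - V t \<xi>)) \<longlongrightarrow> 0) (at t within {0..})"
    and U_deriv: "\<And>t. t \<ge> 0 \<Longrightarrow>
      ((\<lambda>r. L2_norm (\<lambda>\<xi>. of_real (inverse (r - t)) * (U r \<xi> - U t \<xi>) - V t \<xi>)) \<longlongrightarrow> 0) (at t within {0..})"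
    and equation: "\<And>t k. t \<ge> 0 \<Longrightarrow> test_function k \<Longrightarrow>
      pairing (\<lambda>\<xi>. V t \<xi> - V 0 \<xi>) (\<lambda>\<xi>. of_real (a \<xi>) * k \<xi>)
        + integral {0..t} (\<lambda>s. pairing (U s) (\<lambda>\<xi>. of_real (a \<xi> * (f \<xi>)\<^sup>2) * k \<xi>)) = 0"
begin

lemma test_mult_f: 
  assumes "test_function k"
  shows "test_function (\<lambda>\<xi>. of_real (f \<xi>) * k \<xi>)" "test_function (\<lambda>\<xi>. of_real ((f \<xi>)\<^sup>2) * k \<xi>)"
proof -
  have b: "\<exists>M. \<forall>\<xi>. \<xi> \<noteq> 0 \<longrightarrow> norm \<xi> \<le> R \<longrightarrow> \<bar>f \<xi>\<bar> \<le> M" for R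
    using f_locally_bounded[of R] f_pos by (auto simp: less_imp_le)
  show "test_function (\<lambda>\<xi>. of_real (f \<xi>) * k \<xi>)"
    by (rule test_function_mult[OF assms _ b]) measurable
  show "test_function (\<lambda>\<xi>. of_real ((f \<xi>)\<^sup>2) * k \<xi>)"
  proof (rule test_function_mult[OF assms])
    fix R
    obtain M where M: "\<And>\<xi>. \<xi> \<noteq> 0 \<Longrightarrow> norm \<xi> \<le> R \<Longrightarrow> \<bar>f \<xi>\<bar> \<le> M" using b[of R] by blast
    show "\<exists>M. \<forall>\<xi>. \<xi> \<noteq> 0 \<longrightarrow> norm \<xi> \<le> R \<longrightarrow> \<bar>(f \<xi>)\<^sup>2\<bar> \<le> M"
      using power_mono[OF M abs_ge_zero, where n=2] by (intro exI[of _ "M\<^sup>2"]) auto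
  qed measurable
qed

lemma test_mult_bounded:
  assumes "test_function k" "m \<in> borel_measurable borel" "\<And>\<xi>. \<bar>m \<xi>\<bar> \<le> M"
  shows "test_function (\<lambda>\<xi>. of_real (m \<xi>) * k \<xi>)"
  by (rule test_function_mult[OF assms(1,2)]) (use assms(3) in auto)

lemma U_pairing_continuous:
  assumes "test_function k"
  shows "continuous_on {0..T} (\<lambda>s. pairing (U s) k)"
  unfolding continuous_on_def
proof
  fix t assume "t \<in> {0..T}"
  then have t: "t \<ge> 0" by simp
  have "((\<lambda>s. pairing (U s) k) \<longlongrightarrow> pairing (U t) k) (at t within {0..})"
    by (rule pairing_tendsto[OF _ U[OF t] test_function_L2[OF assms] U_cont[OF t]]) (use U in auto)
  then show "((\<lambda>s. pairing (U s) k) \<longlongrightarrow> pairing (U t) k) (at t within {0..T})"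
    by (rule tendsto_within_subset) auto
qed

text \<open>Testing with \<open>k / a\<close>, admissible because \<open>a \<ge> 1\<close>, removes
  the symbol in front of the acceleration; the fundamental theorem of calculus then differentiates
  the time integral.\<close>

lemma V_pairing_derivative:
  assumes k: "test_function k" and t: "t \<in> {0..T}"
  shows "((\<lambda>s. pairing (V s) k) has_vector_derivative - pairing (U t) (\<lambda>\<xi>. of_real ((f \<xi>)\<^sup>2) * k \<xi>)) (at t within {0..T})"
proof -
  let ?k = "\<lambda>\<xi>. of_real ((f \<xi>)\<^sup>2) * k \<xi>"
  have tk: "test_function (\<lambda>\<xi>. of_real (inverse (a \<xi>)) * k \<xi>)"
  proof (rule test_mult_bounded[OF k])
    show "\<bar>inverse (a \<xi>)\<bar> \<le> 1" for \<xi> using a_ge[of \<xi>] by (simp add: inverse_le_1_iff)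
  qed measurable
  have ne: "a \<xi> \<noteq> 0" for \<xi> using a_ge[of \<xi>] by auto
  have c1: "of_real (a \<xi>) * (of_real (inverse (a \<xi>)) * k \<xi>) = k \<xi>" for \<xi>
    using ne[of \<xi>] by (simp add: mult.assoc[symmetric])
  have c2: "of_real (a \<xi> * (f \<xi>)\<^sup>2) * (of_real (inverse (a \<xi>)) * k \<xi>) = of_real ((f \<xi>)\<^sup>2) * k \<xi>" for \<xi>
    using ne[of \<xi>] by simp
  have eq: "pairing (V s) k = pairing (V 0) k - integral {0..s} (\<lambda>r. pairing (U r) ?k)" if "s \<in> {0..T}" for s
    using equation[OF _ tk, of s, unfolded c1 c2] pairing_diff_left[OF V V test_function_L2[OF k], of s 0] that
    by (simp add: algebra_simps add_eq_0_iff)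
  have "((\<lambda>s. pairing (V 0) k - integral {0..s} (\<lambda>r. pairing (U r) ?k)) has_vector_derivative 0 - pairing (U t) ?k) (at t within {0..T})"
    by (intro has_vector_derivative_diff has_vector_derivative_const integral_has_vector_derivative
        U_pairing_continuous test_mult_f k t)
  then have "((\<lambda>s. pairing (V s) k) has_vector_derivative 0 - pairing (U t) ?k) (at t within {0..T})"
    by (rule has_vector_derivative_transform[OF t, rotated]) (rule eq)
  then show ?thesis by simp
qed

lemma U_pairing_derivative:
  assumes k: "test_function k" and t: "t \<in> {0..T}"
  shows "((\<lambda>s. pairing (U s) k) has_vector_derivative pairing (V t) k) (at t within {0..T})"
proof -
  have t0: "t \<ge> 0" using t by simp
  let ?q = "\<lambda>r \<xi>. of_real (inverse (r - t)) * (U r \<xi> - U t \<xi>)"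
  have q: "?q r \<in> L2" if "r \<in> {0..}" for r
    using U that t0 by (intro L2_cmult(1) L2_diff(1)) auto
  have "((\<lambda>r. pairing (?q r) k) \<longlongrightarrow> pairing (V t) k) (at t within {0..})"
    by (rule pairing_tendsto[OF q V[OF t0] test_function_L2[OF k] U_deriv[OF t0]])
  then have "((\<lambda>r. pairing (?q r) k) \<longlongrightarrow> pairing (V t) k) (at t within {0..T})"
    by (rule tendsto_within_subset) auto
  then have "((\<lambda>r. pairing (U t) k + (r - t) *\<^sub>R pairing (?q r) k) has_vector_derivative 0 + pairing (V t) k) (at t within {0..T})"
    by (intro has_vector_derivative_add has_vector_derivative_const has_vector_derivative_affine_factor)
  moreover have eq: "pairing (U r) k = pairing (U t) k + (r - t) *\<^sub>R pairing (?q r) k" if "r \<in> {0..T}" for r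
    using pairing_diff_left[OF U U[OF t0] test_function_L2[OF k], of r] that
    by (cases "r = t") (simp_all only: pairing_cmult_left scaleR_conv_of_real mult.assoc[symmetric] of_real_mult[symmetric],
        simp_all)
  ultimately have "((\<lambda>s. pairing (U s) k) has_vector_derivative 0 + pairing (V t) k) (at t within {0..T})"
    by (intro has_vector_derivative_transform[OF t eq])
  then show ?thesis by simp
qed


text \<open>For fixed \<open>T\<close>, the pairing of \<open>V s\<close> with \<open>sin ((T - s) f) / f \<cdot> g\<close> plus that of \<open>U s\<close> with
  \<open>cos ((T - s) f) \<cdot> g\<close> does not depend on \<open>s\<close>.\<close>

lemma pairing_formula:
  assumes g: "test_function g" and T: "T \<ge> 0"
  shows "pairing (U T) g = pairing (V 0) (\<lambda>\<xi>. of_real (sin (T * f \<xi>) / f \<xi>) * g \<xi>)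
    + pairing (U 0) (\<lambda>\<xi>. of_real (cos (T * f \<xi>)) * g \<xi>)"
proof -
  \<comment> \<open>As functions of \<open>s\<close>, \<open>S\<close> has derivative
    \<open>-C\<close> and \<open>C\<close> has derivative \<open>Z = f^2 S\<close>: the backward
    oscillator dual to \<open>U' = V\<close>, \<open>V' = -f^2 U\<close>.\<close>
  define S where "S s \<xi> = of_real (sin ((T - s) * f \<xi>) / f \<xi>) * g \<xi>" for s \<xi>
  define C where "C s \<xi> = of_real (cos ((T - s) * f \<xi>)) * g \<xi>" for s \<xi>
  define Z where "Z s \<xi> = of_real (sin ((T - s) * f \<xi>)) * (of_real (f \<xi>) * g \<xi>)" for s \<xi>
  \<comment> \<open>Wherever \<open>g\<close> is nonzero the frequency is positive, which makes
    cancelling \<open>f\<close> in the sine quotient legitimate.\<close>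
  have gz: "f \<xi> > 0 \<or> g \<xi> = 0" for \<xi>
    using g f_pos[of \<xi>] by (auto simp: test_function_def)
  have tC: "test_function (C s)" for s
    unfolding C_def by (rule test_mult_bounded[OF g, of _ 1]) auto
  have tZ: "test_function (Z s)" for s
    unfolding Z_def by (rule test_mult_bounded[OF test_mult_f(1)[OF g], of _ 1]) auto
  have tS: "test_function (S s)" for s
    unfolding S_def by (rule test_mult_bounded[OF g _ abs_sin_quotient_le]) measurable
  note L2s = tC[THEN test_function_L2] tZ[THEN test_function_L2] tS[THEN test_function_L2]
  note fg = test_mult_f[OF g, THEN test_function_L2]
  have remS: "L2_norm (\<lambda>\<xi>. S r \<xi> - S t \<xi> - of_real (r - t) * (- 1 * C t \<xi>)) \<le> (r - t)\<^sup>2 * L2_norm (\<lambda>\<xi>. of_real (f \<xi>) * g \<xi>)" for r t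
  proof -
    have "cmod (S r \<xi> - S t \<xi> - of_real (r - t) * (- 1 * C t \<xi>)) \<le> cmod (of_real ((r - t)\<^sup>2) * (of_real (f \<xi>) * g \<xi>))" for \<xi>
    proof (cases "g \<xi> = 0")
      case False
      then have fp: "f \<xi> > 0" using gz by auto
      let ?x = "(T - t) * f \<xi>" and ?y = "(r - t) * f \<xi>"
      have xy: "(T - r) * f \<xi> = ?x - ?y" by (simp add: algebra_simps)
      have "S r \<xi> - S t \<xi> - of_real (r - t) * (- 1 * C t \<xi>) = of_real ((sin (?x - ?y) - sin ?x + ?y * cos ?x) / f \<xi>) * g \<xi>"
        unfolding S_def C_def xy using fp by (simp add: field_simps)
      moreover have "\<bar>(sin (?x - ?y) - sin ?x + ?y * cos ?x) / f \<xi>\<bar> \<le> (r - t)\<^sup>2 * f \<xi>"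
      proof -
        have "\<bar>(sin (?x - ?y) - sin ?x + ?y * cos ?x) / f \<xi>\<bar> \<le> ?y\<^sup>2 / f \<xi>"
          using order_trans[OF sin_cos_second_order(1)[of ?x ?y], of "?y\<^sup>2"] fp
          by (simp add: abs_divide divide_right_mono)
        also have "\<dots> = (r - t)\<^sup>2 * f \<xi>" using fp by (simp add: power2_eq_square)
        finally show ?thesis .
      qed
      ultimately show ?thesis using fp
        by (simp only: norm_mult norm_of_real mult.assoc[symmetric]) (intro mult_right_mono, auto)
    qed (simp add: S_def C_def)
    moreover have "(\<lambda>\<xi>. S r \<xi> - S t \<xi> - of_real (r - t) * (- 1 * C t \<xi>)) \<in> borel_measurable lborel"
      by (intro L2_measurable L2_diff(1) L2_cmult(1) L2s)
    ultimately show ?thesis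
      using L2_norm_le_scaled[OF fg(1), of _ "(r - t)\<^sup>2"] by simp
  qed
  have remC: "L2_norm (\<lambda>\<xi>. C r \<xi> - C t \<xi> - of_real (r - t) * Z t \<xi>) \<le> (r - t)\<^sup>2 * L2_norm (\<lambda>\<xi>. of_real ((f \<xi>)\<^sup>2) * g \<xi>)" for r t
  proof -
    have "cmod (C r \<xi> - C t \<xi> - of_real (r - t) * Z t \<xi>) \<le> cmod (of_real ((r - t)\<^sup>2) * (of_real ((f \<xi>)\<^sup>2) * g \<xi>))" for \<xi>
    proof -
      let ?x = "(T - t) * f \<xi>" and ?y = "(r - t) * f \<xi>"
      have xy: "(T - r) * f \<xi> = ?x - ?y" by (simp add: algebra_simps)
      have "C r \<xi> - C t \<xi> - of_real (r - t) * Z t \<xi> = of_real (cos (?x - ?y) - cos ?x - ?y * sin ?x) * g \<xi>"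
        unfolding Z_def C_def xy by (simp add: algebra_simps)
      moreover have "\<bar>cos (?x - ?y) - cos ?x - ?y * sin ?x\<bar> \<le> (r - t)\<^sup>2 * (f \<xi>)\<^sup>2"
        using order_trans[OF sin_cos_second_order(2)[of ?x ?y], of "?y\<^sup>2"] by (simp add: power_mult_distrib)
      ultimately show ?thesis
        by (simp only: norm_mult norm_of_real mult.assoc[symmetric]) (intro mult_right_mono, auto)
    qed
    moreover have "(\<lambda>\<xi>. C r \<xi> - C t \<xi> - of_real (r - t) * Z t \<xi>) \<in> borel_measurable lborel"
      by (intro L2_measurable L2_diff(1) L2_cmult(1) L2s)
    ultimately show ?thesis
      using L2_norm_le_scaled[OF fg(2), of _ "(r - t)\<^sup>2"] by simp
  qed
  have "((\<lambda>s. pairing (V s) (S s) + pairing (U s) (C s)) has_vector_derivative 0) (at t within {0..T})"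
    if t: "t \<in> {0..T}" for t
  proof -
    have t0: "t \<ge> 0" using t by simp
    have s1: "((\<lambda>s. pairing (V s) (S s)) has_vector_derivative
        - pairing (U t) (\<lambda>\<xi>. of_real ((f \<xi>)\<^sup>2) * S t \<xi>) + pairing (V t) (\<lambda>\<xi>. - 1 * C t \<xi>)) (at t within {0..T})"
      by (rule pairing_product_rule[OF t V L2s(3) L2_cmult(1)[OF L2s(1)]
            tendsto_within_subset[OF V_cont[OF t0]] remS V_pairing_derivative[OF tS t]]) auto
    have s2: "((\<lambda>s. pairing (U s) (C s)) has_vector_derivative
        pairing (V t) (C t) + pairing (U t) (Z t)) (at t within {0..T})"
      by (rule pairing_product_rule[OF t U L2s(1) L2s(2)
            tendsto_within_subset[OF U_cont[OF t0]] remC U_pairing_derivative[OF tC t]]) auto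
    have eqZ: "of_real ((f \<xi>)\<^sup>2) * S t \<xi> = Z t \<xi>" for \<xi>
      using gz[of \<xi>] by (auto simp: S_def Z_def power2_eq_square)
    have eqC: "pairing (V t) (\<lambda>\<xi>. - 1 * C t \<xi>) = - pairing (V t) (C t)"
      unfolding pairing_cmult_right by simp
    show ?thesis
      using has_vector_derivative_add[OF s1 s2] unfolding eqZ eqC by simp
  qed
  then obtain c where c: "\<And>s. s \<in> {0..T} \<Longrightarrow> pairing (V s) (S s) + pairing (U s) (C s) = c"
    using has_vector_derivative_zero_constant[of "{0..T}" "\<lambda>s. pairing (V s) (S s) + pairing (U s) (C s)"] by auto
  have "pairing (V T) (S T) + pairing (U T) (C T) = pairing (V 0) (S 0) + pairing (U 0) (C 0)"
    using c[of T] c[of 0] T by simp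
  \<comment> \<open>At \<open>s = T\<close> the sine factor vanishes and the cosine factor is 1; the
    value at \<open>s = 0\<close> is the claimed right-hand side.\<close>
  moreover have "S T = (\<lambda>_. 0)" "C T = g" by (auto simp: S_def C_def)
  ultimately show ?thesis by (simp add: pairing_def S_def C_def)
qed

text \<open>The defect \<open>W\<close> of the formula is tested against its own conjugate, cut off
  so as to be a test function. The integral of its squared modulus over the cut-off set then
  vanishes, and these sets exhaust everything except the origin.\<close>

theorem solution_formula:
  assumes T: "T \<ge> 0"
  shows "AE \<xi> in lborel. U T \<xi> = of_real (cos (T * f \<xi>)) * U 0 \<xi> + of_real (sin (T * f \<xi>) / f \<xi>) * V 0 \<xi>"
proof -
  let ?C = "\<lambda>\<xi>. of_real (cos (T * f \<xi>)) :: complex" and ?S = "\<lambda>\<xi>. of_real (sin (T * f \<xi>) / f \<xi>) :: complex"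
  define W where "W \<xi> = U T \<xi> - ?C \<xi> * U 0 \<xi> - ?S \<xi> * V 0 \<xi>" for \<xi>
  have [measurable]: "U T \<in> borel_measurable borel" "U 0 \<in> borel_measurable borel" "V 0 \<in> borel_measurable borel"
    using L2_measurable[OF U[of T]] L2_measurable[OF U[of 0]] L2_measurable[OF V[of 0]] T by auto
  have Wm[measurable]: "W \<in> borel_measurable borel" unfolding W_def by measurable
  have C2: "(\<lambda>\<xi>. ?C \<xi> * U 0 \<xi>) \<in> L2"
    by (rule L2_mono(1)[OF U[of 0]]) (auto simp: norm_mult intro!: mult_left_le_one_le)
  have S2: "(\<lambda>\<xi>. ?S \<xi> * V 0 \<xi>) \<in> L2"
  proof (rule L2_mono(1)[OF L2_cmult(1)[OF V[of 0], of "of_real T"]])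
    show "AE \<xi> in lborel. cmod (?S \<xi> * V 0 \<xi>) \<le> cmod (of_real T * V 0 \<xi>)"
      by (intro AE_I2) (simp only: norm_mult norm_of_real abs_sin_quotient_le mult_right_mono norm_ge_zero)
  qed (simp, measurable)
  have "AE \<xi> in lborel. W \<xi> = 0 \<or> \<not> (\<xi> \<noteq> 0 \<and> norm \<xi> \<le> real n \<and> cmod (W \<xi>) \<le> real n)" for n :: nat
  proof -
    define A where "A = {\<xi>. \<xi> \<noteq> 0 \<and> norm \<xi> \<le> real n \<and> cmod (W \<xi>) \<le> real n}"
    have A[measurable]: "A \<in> sets borel"
      unfolding A_def by measurable
    define g where "g \<xi> = of_real (indicat_real A \<xi>) * cnj (W \<xi>)" for \<xi>
    have g: "test_function g"
      unfolding test_function_def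
    proof (intro conjI exI allI impI)
      show "g \<in> borel_measurable borel" unfolding g_def by measurable
      show "cmod (g \<xi>) \<le> real n" for \<xi> by (auto simp: g_def A_def norm_mult split: split_indicator)
      fix \<xi> assume "g \<xi> \<noteq> 0"
      then have "\<xi> \<in> A" by (auto simp: g_def split: split_indicator_asm)
      then show "\<xi> \<noteq> 0" "norm \<xi> \<le> real n" by (auto simp: A_def)
    qed
    note g2 = test_function_L2[OF g]
    have "pairing W g = pairing (U T) g - pairing (\<lambda>\<xi>. ?C \<xi> * U 0 \<xi>) g - pairing (\<lambda>\<xi>. ?S \<xi> * V 0 \<xi>) g"
      unfolding W_def using U[OF T] C2 S2 g2 by (simp add: pairing_diff_left L2_diff(1))
    also have "pairing (\<lambda>\<xi>. ?C \<xi> * U 0 \<xi>) g = pairing (U 0) (\<lambda>\<xi>. ?C \<xi> * g \<xi>)"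
      unfolding pairing_def by (simp only: mult_ac)
    also have "pairing (\<lambda>\<xi>. ?S \<xi> * V 0 \<xi>) g = pairing (V 0) (\<lambda>\<xi>. ?S \<xi> * g \<xi>)"
      unfolding pairing_def by (simp only: mult_ac)
    finally have "pairing W g = 0" using pairing_formula[OF g T] by simp
    moreover have "pairing W g = of_real (\<integral>\<xi>. indicat_real A \<xi> * (cmod (W \<xi>))\<^sup>2 \<partial>lborel)"
      unfolding pairing_def g_def integral_complex_of_real[symmetric] of_real_mult complex_norm_square
      by (simp only: mult_ac)
    ultimately have "(\<integral>\<xi>. indicat_real A \<xi> * (cmod (W \<xi>))\<^sup>2 \<partial>lborel) = 0" by simp
    moreover have "W \<in> L2" unfolding W_def using U[OF T] C2 S2 by (intro L2_diff(1))
    then have "integrable lborel (\<lambda>\<xi>. indicat_real A \<xi> * (cmod (W \<xi>))\<^sup>2)"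
      by (intro Bochner_Integration.integrable_bound[OF L2_integrable_square]) (auto split: split_indicator)
    ultimately have "AE \<xi> in lborel. indicat_real A \<xi> * (cmod (W \<xi>))\<^sup>2 = 0"
      by (subst (asm) integral_nonneg_eq_0_iff_AE) auto
    then show ?thesis
      by eventually_elim (auto simp: A_def)
  qed
  then have "AE \<xi> in lborel. \<forall>n. W \<xi> = 0 \<or> \<not> (\<xi> \<noteq> 0 \<and> norm \<xi> \<le> real n \<and> cmod (W \<xi>) \<le> real n)"
    by (simp add: AE_all_countable)
  moreover have "AE \<xi>::'a in lborel. \<xi> \<noteq> 0" by (rule AE_lborel_singleton)
  ultimately show ?thesis
  proof eventually_elim
    fix \<xi> assume W: "\<forall>n. W \<xi> = 0 \<or> \<not> (\<xi> \<noteq> 0 \<and> norm \<xi> \<le> real n \<and> cmod (W \<xi>) \<le> real n)" and "\<xi> \<noteq> 0"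
    obtain n where "max (norm \<xi>) (cmod (W \<xi>)) \<le> real n" using real_arch_simple by blast
    then have "W \<xi> = 0" using W \<open>\<xi> \<noteq> 0\<close> by auto
    then show "U T \<xi> = ?C \<xi> * U 0 \<xi> + ?S \<xi> * V 0 \<xi>" by (simp add: W_def algebra_simps)
  qed
qed

end

section \<open>Dyadic integrals in the plane\<close>

lemma power2_two_power: "(2 ^ n)\<^sup>2 = (4 :: real) ^ n"
  by (simp add: power2_eq_square flip: power_mult_distrib)

text \<open>If \<open>N > 0\<close> is the first exponent with \<open>q \<le> 4^N\<close>, then
  \<open>4^(N-1) < q\<close> and \<open>q * |\<xi>|^2 \<le> 1\<close> force
  \<open>|\<xi>| \<le> (1/2)^(N-1)\<close>, and the summand with \<open>k = N - 1\<close> alone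
  equals \<open>4^N\<close>. For \<open>q \<le> 1\<close> the unit ball suffices.\<close>

lemma dyadic_majorant:
  fixes \<xi> :: "'a::euclidean_space"
  assumes "norm \<xi> \<le> 1" "q \<le> 4 ^ N" "q * (norm \<xi>)\<^sup>2 \<le> 1"
  shows "q \<le> (\<Sum>k\<le>N. 4 ^ Suc k * indicat_real (cball 0 ((1/2) ^ k)) \<xi>)"
  using assms(2)
proof (induction N)
  case 0
  then show ?case using assms(1) by simp
next
  case (Suc N)
  let ?H = "\<lambda>N. \<Sum>k\<le>N. 4 ^ Suc k * indicat_real (cball 0 ((1/2) ^ k)) \<xi>"
  have nn: "0 \<le> ?H M" for M by (intro sum_nonneg) auto
  show ?case
  proof (cases "q \<le> 4 ^ N")
    case True
    then show ?thesis using Suc.IH by (simp add: add_increasing2)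
  next
    case False
    then have "4 ^ N * (norm \<xi>)\<^sup>2 \<le> q * (norm \<xi>)\<^sup>2" by (intro mult_right_mono) auto
    then have "(2 ^ N * norm \<xi>)\<^sup>2 \<le> 1\<^sup>2"
      using assms(3) by (simp add: power_mult_distrib power2_two_power)
    then have "2 ^ N * norm \<xi> \<le> 1" by (rule power2_le_imp_le) simp
    then have "indicat_real (cball 0 ((1/2) ^ N)) \<xi> = 1" by (simp add: power_divide field_simps)
    moreover have "4 ^ Suc N * indicat_real (cball 0 ((1/2) ^ N)) \<xi> \<le> ?H N"
      by (rule member_le_sum) auto
    ultimately have "q \<le> ?H N" using Suc.prems by simp
    then show ?thesis by (simp add: add_increasing2)
  qed
qed

lemma measure_cball_plane:
  "0 \<le> r \<Longrightarrow> measure lborel (cball (0::real^2) r) = r\<^sup>2 * measure lborel (cball (0::real^2) 1)"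
  by (simp add: content_cball)

text \<open>In the plane the ball of radius \<open>(1/2)^k\<close> has area proportional to
  \<open>4^-k\<close>, so every scale contributes the same amount: this is where the logarithm comes
  from.\<close>

lemma dyadic_majorant_integral:
  defines "H \<equiv> \<lambda>N (\<xi>::real^2). \<Sum>k\<le>N. 4 ^ Suc k * indicat_real (cball 0 ((1/2) ^ k)) \<xi>"
  shows "integrable lborel (H N)"
    and "(\<integral>\<xi>. H N \<xi> \<partial>lborel) = 4 * measure lborel (cball (0::real^2) 1) * real (Suc N)"
proof -
  have i: "integrable lborel (indicat_real (cball (0::real^2) r))" for r
    using emeasure_lborel_cball_finite[of "0::real^2" r] by (simp add: integrable_indicator_iff less_top)
  show "integrable lborel (H N)" unfolding H_def by (intro Bochner_Integration.integrable_sum integrable_mult_right i)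
  have "(\<integral>\<xi>. H N \<xi> \<partial>lborel) = (\<Sum>k\<le>N. 4 ^ Suc k * measure lborel (cball (0::real^2) ((1/2) ^ k)))"
    unfolding H_def
    by (subst Bochner_Integration.integral_sum) (intro integrable_mult_right i, simp only: integral_mult_right_zero Bochner_Integration.integral_indicator, simp)
  also have "\<dots> = (\<Sum>k\<le>N. 4 * measure lborel (cball (0::real^2) 1))"
  proof (rule sum.cong[OF refl])
    fix k
    have "4 ^ Suc k * ((1/2) ^ k)\<^sup>2 = (4::real)"
      by (simp add: power_divide power2_two_power)
    moreover have p: "(0::real) \<le> (1/2) ^ k" by simp
    ultimately show "4 ^ Suc k * measure lborel (cball (0::real^2) ((1/2) ^ k)) = 4 * measure lborel (cball (0::real^2) 1)"
      unfolding measure_cball_plane[OF p] by (simp only: mult.assoc[symmetric])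
  qed
  finally show "(\<integral>\<xi>. H N \<xi> \<partial>lborel) = 4 * measure lborel (cball (0::real^2) 1) * real (Suc N)" by simp
qed

text \<open>The sum equals \<open>1 - cos d * cos (2 * x + d)\<close>, and on the given range of
  \<open>d\<close> one has \<open>|cos d| \<le> sqrt 2 / 2 < 3/4\<close>.\<close>

lemma sin_squares_shift:
  fixes x d :: real
  assumes "pi / 4 \<le> d" "d \<le> 3 * pi / 4"
  shows "1 / 4 \<le> (sin x)\<^sup>2 + (sin (x + d))\<^sup>2"
proof -
  have id: "(sin x)\<^sup>2 + (sin (x + d))\<^sup>2 = 1 - cos d * cos (2 * x + d)"
  proof -
    have s: "(sin y)\<^sup>2 = (1 - cos (2 * y)) / 2" for y :: real
      by (simp add: cos_double sin_squared_eq)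
    have "cos ((2 * x + d) - d) + cos ((2 * x + d) + d) = 2 * (cos d * cos (2 * x + d))"
      unfolding cos_diff cos_add by simp
    then have "cos (2 * x) + cos (2 * (x + d)) = 2 * (cos d * cos (2 * x + d))"
      by (simp add: algebra_simps)
    then show ?thesis unfolding s by (simp add: field_simps)
  qed
  have "\<bar>cos d\<bar> \<le> sqrt 2 / 2"
  proof -
    have "cos d \<le> cos (pi / 4)" using assms pi_gt_zero by (intro cos_monotone_0_pi_le) auto
    moreover have "cos (3 * pi / 4) \<le> cos d" using assms pi_gt_zero by (intro cos_monotone_0_pi_le) auto
    moreover have "cos (3 * pi / 4) = - cos (pi / 4)" using cos_minus_pi[of "pi/4"] cos_pi_minus[of "pi / 4"]
      by (simp add: field_simps)
    ultimately show ?thesis using cos_45 by (simp add: abs_le_iff)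
  qed
  moreover have "sqrt 2 / 2 \<le> (3 / 4 :: real)"
  proof -
    have "sqrt 2 \<le> (3 / 2 :: real)" by (rule real_le_lsqrt) (auto simp: power2_eq_square)
    then show ?thesis by simp
  qed
  ultimately have "\<bar>cos d\<bar> \<le> 3 / 4" by linarith
  then have "\<bar>cos d * cos (2 * x + d)\<bar> \<le> 3 / 4 * 1"
    unfolding abs_mult by (intro mult_mono) auto
  then show ?thesis unfolding id by linarith
qed

section \<open>Boxes near the first axis and horizontal shifts\<close>

lemma norm_plane: "(norm (x::real^2))\<^sup>2 = (x$1)\<^sup>2 + (x$2)\<^sup>2"
  by (simp add: norm_vec_def L2_set_def sum_2 power2_eq_square)

lemma mem_cbox_plane: "x \<in> cbox (vector [a, b]) (vector [c, d] :: real^2) \<longleftrightarrow> a \<le> x$1 \<and> x$1 \<le> c \<and> b \<le> x$2 \<and> x$2 \<le> d"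
  by (auto simp: mem_box_cart forall_2)

lemma norm_box_plane:
  assumes x: "x \<in> cbox (vector [3/4 * s, 0]) (vector [9/8 * s, s / 8] :: real^2)" and s: "0 < s"
  shows "0 < norm x" "(norm x)\<^sup>2 \<le> 2 * s\<^sup>2" "norm x \<le> 2 * s"
proof -
  have x: "3/4 * s \<le> x$1" "x$1 \<le> 9/8 * s" "0 \<le> x$2" "x$2 \<le> s / 8"
    using x by (auto simp: mem_cbox_plane)
  then show "0 < norm x" using component_le_norm_cart[of x 1] s by linarith
  have "(norm x)\<^sup>2 \<le> (9/8 * s)\<^sup>2 + (s/8)\<^sup>2"
    unfolding norm_plane using x s by (intro add_mono power_mono) auto
  also have "\<dots> \<le> 2 * s\<^sup>2" by (simp add: power_mult_distrib power_divide)
  finally show n: "(norm x)\<^sup>2 \<le> 2 * s\<^sup>2" .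
  also have "\<dots> \<le> (2 * s)\<^sup>2" by (simp add: power_mult_distrib)
  finally show "norm x \<le> 2 * s" by (rule power2_le_imp_le) (use s in simp)
qed

lemma measure_cbox_plane:
  assumes "a \<le> c" "b \<le> d"
  shows "measure lborel (cbox (vector [a, b]) (vector [c, d] :: real^2)) = (c - a) * (d - b)"
proof -
  have "vector [a, b] \<in> cbox (vector [a, b]) (vector [c, d] :: real^2)"
    using assms by (simp add: mem_cbox_plane)
  then have "cbox (vector [a, b]) (vector [c, d] :: real^2) \<noteq> {}" by blast
  then show ?thesis by (simp add: content_cbox_cart UNIV_2)
qed

text \<open>The slope condition makes the angle to the first axis so small that
  \<open>x$1 \<ge> 9/10 * norm x\<close>. Cauchy-Schwarz for \<open>x\<close> and the shifted point
  then gives the lower bound: the shift is almost radial.\<close>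

lemma norm_shift_bounds:
  fixes x :: "real^2"
  assumes x: "0 < x$1" "0 \<le> x$2" "6 * x$2 \<le> x$1" and h: "0 < h"
  shows "norm x + 9/10 * h \<le> norm (x + vector [h, 0])" "norm (x + vector [h, 0]) \<le> norm x + h"
proof -
  let ?d = "vector [h, 0] :: real^2"
  have nx: "norm x > 0" using x component_le_norm_cart[of x 1] by linarith
  have nd: "norm ?d = h"
    using norm_plane[of ?d] h by (simp add: power2_eq_iff_nonneg)
  then show "norm (x + ?d) \<le> norm x + h" using norm_triangle_ineq[of x ?d] by simp
  have "(9/10 * norm x)\<^sup>2 \<le> (x$1)\<^sup>2"
  proof -
    have "(6 * x$2)\<^sup>2 \<le> (x$1)\<^sup>2" using x by (intro power_mono) auto
    then have "36 * (x$2)\<^sup>2 \<le> (x$1)\<^sup>2" by (simp add: power_mult_distrib)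
    then have "81 * (x$2)\<^sup>2 \<le> 19 * (x$1)\<^sup>2" using zero_le_power2[of "x$1"] by linarith
    then show ?thesis by (simp add: power_mult_distrib norm_plane power_divide)
  qed
  then have c: "9/10 * norm x \<le> x$1" by (rule power2_le_imp_le) (use x in simp)
  have "norm x * norm (x + ?d) \<ge> x \<bullet> (x + ?d)" by (rule norm_cauchy_schwarz)
  also have "x \<bullet> (x + ?d) = (norm x)\<^sup>2 + h * x$1"
  proof -
    have "x \<bullet> ?d = h * x$1" by (simp add: inner_vec_def sum_2)
    then show ?thesis by (simp add: inner_add_right power2_norm_eq_inner)
  qed
  finally have "norm x * norm (x + ?d) \<ge> norm x * norm x + h * (9/10 * norm x)"
    using mult_left_mono[OF c less_imp_le[OF h]] unfolding power2_eq_square by linarith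
  then have "norm x * (norm x + 9/10 * h) \<le> norm x * norm (x + ?d)" by (simp add: algebra_simps)
  then show "norm x + 9/10 * h \<le> norm (x + ?d)" using nx by simp
qed

text \<open>On the left part of the box, of area \<open>s^2 / 32\<close>, the values of
  \<open>sin^2\<close> at a point and at its translate sum to at least 1/4. Halving, because the two
  copies may overlap in the full box, gives \<open>s^2 / 256\<close>.\<close>

lemma oscillation_box:
  fixes \<phi> \<phi>' :: "real \<Rightarrow> real"
  assumes m[measurable]: "\<phi> \<in> borel_measurable borel" and k0: "k0 > 0" and rho: "\<rho> > 0"
    and d: "\<And>r. 0 < r \<Longrightarrow> r \<le> \<rho> \<Longrightarrow> (\<phi> has_real_derivative \<phi>' r) (at r)"
    and d': "\<And>r. 0 < r \<Longrightarrow> r \<le> \<rho> \<Longrightarrow> 4/5 * k0 \<le> \<phi>' r \<and> \<phi>' r \<le> 6/5 * k0"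
    and s: "0 < s" "2 * s \<le> \<rho>" and t: "0 < t" and h: "pi / (2 * t * k0) \<le> s / 8"
  shows "s\<^sup>2 / 256 \<le> (\<integral>\<xi>. indicat_real (cbox (vector [3/4 * s, 0]) (vector [9/8 * s, s / 8])) (\<xi>::real^2) * (sin (t * \<phi> (norm \<xi>)))\<^sup>2 \<partial>lborel)"
proof -
  define h where "h = pi / (2 * t * k0)"
  have h0: "0 < h" "h \<le> s / 8" using t k0 h by (auto simp: h_def)
  let ?d = "vector [h, 0] :: real^2"
  \<comment> \<open>\<open>Q\<close> leaves a margin \<open>s / 8\<close> on the right inside
    \<open>P\<close>, enough for the shift by \<open>h\<close>. Its left edge \<open>3/4 * s\<close>
    is six times its height, which gives the slope condition of
    \<open>norm_shift_bounds\<close>.\<close>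
  define Q where "Q = cbox (vector [3/4 * s, 0]) (vector [s, s / 8] :: real^2)"
  define P where "P = cbox (vector [3/4 * s, 0]) (vector [9/8 * s, s / 8] :: real^2)"
  define g where "g \<xi> = (sin (t * \<phi> (norm \<xi>)))\<^sup>2" for \<xi> :: "real^2"
  have [measurable]: "Q \<in> sets borel" "P \<in> sets borel" "g \<in> borel_measurable borel"
    by (auto simp: Q_def P_def g_def[abs_def])
  have g01: "0 \<le> g \<xi>" "g \<xi> \<le> 1" for \<xi> by (auto simp: g_def abs_square_le_1)
  have fin: "integrable lborel (indicat_real Q)" "integrable lborel (indicat_real P)"
    by (auto simp: Q_def P_def integrable_indicator_iff emeasure_lborel_cbox_eq)
  have iQ: "integrable lborel (\<lambda>\<xi>. indicat_real Q \<xi> * u \<xi>)" if [measurable]: "u \<in> borel_measurable borel"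
    and "\<And>\<xi>. \<bar>u \<xi>\<bar> \<le> 1" for u
    by (rule Bochner_Integration.integrable_bound[OF fin(1)]) (use that(2) in \<open>auto split: split_indicator\<close>)
  have iP: "integrable lborel (\<lambda>\<xi>. indicat_real P \<xi> * g \<xi>)"
    by (rule Bochner_Integration.integrable_bound[OF fin(2)]) (use g01 in \<open>auto split: split_indicator\<close>)
  have iQg: "integrable lborel (\<lambda>\<xi>. indicat_real Q \<xi> * g \<xi>)" "integrable lborel (\<lambda>\<xi>. indicat_real Q \<xi> * g (\<xi> + ?d))"
    by (rule iQ; use g01 in auto)+
  have tr: "(\<integral>\<xi>. indicat_real Q (\<xi> + - ?d) * g \<xi> \<partial>lborel) = (\<integral>\<xi>. indicat_real Q \<xi> * g (\<xi> + ?d) \<partial>lborel)"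
    "integrable lborel (\<lambda>\<xi>. indicat_real Q (\<xi> + - ?d) * g \<xi>)"
    using lborel_translation_integral(2)[of "\<lambda>\<xi>. indicat_real Q (\<xi> + - ?d) * g \<xi>" ?d]
      lborel_translation_integral(1)[of "\<lambda>\<xi>. indicat_real Q (\<xi> + - ?d) * g \<xi>" ?d] iQg(2)
    by (simp_all add: add.assoc)
  have key: "1 / 4 \<le> g \<xi> + g (\<xi> + ?d)" if "\<xi> \<in> Q" for \<xi>
  proof -
    have x: "3/4 * s \<le> \<xi>$1" "\<xi>$1 \<le> s" "0 \<le> \<xi>$2" "\<xi>$2 \<le> s / 8"
      using that by (auto simp: Q_def mem_cbox_plane)
    define r r' where "r = norm \<xi>" and "r' = norm (\<xi> + ?d)"
    have rr: "r + 9/10 * h \<le> r'" "r' \<le> r + h"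
      unfolding r_def r'_def using x s h0 by (intro norm_shift_bounds; simp)+
    have "0 < \<xi>$1" using x s by linarith
    then have r0: "r > 0" unfolding r_def using component_le_norm_cart[of \<xi> 1] by linarith
    have "r\<^sup>2 \<le> s\<^sup>2 + (s/8)\<^sup>2"
      unfolding r_def norm_plane using x s by (intro add_mono power_mono) auto
    also have "\<dots> \<le> (9/8 * s)\<^sup>2" by (simp add: power_mult_distrib power_divide)
    finally have "r \<le> 9/8 * s" by (rule power2_le_imp_le) (use s in simp)
    then have r': "r' \<le> \<rho>" using rr h0 s by linarith
    have "r < r'" using rr h0 by linarith
    obtain z where z: "r < z" "z < r'" "\<phi> r' - \<phi> r = (r' - r) * \<phi>' z"
      using MVT2[OF \<open>r < r'\<close>, of \<phi> \<phi>'] d r0 r' by auto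
    have pz: "4/5 * k0 \<le> \<phi>' z" "\<phi>' z \<le> 6/5 * k0" using d'[of z] z r0 r' by auto
    have lo: "9/10 * h * (4/5 * k0) \<le> \<phi> r' - \<phi> r"
      unfolding z(3) using rr pz h0 k0 by (intro mult_mono) auto
    have hi: "\<phi> r' - \<phi> r \<le> h * (6/5 * k0)"
      unfolding z(3) using rr pz h0 k0 by (intro mult_mono) auto
    \<comment> \<open>For the exact slope \<open>k0\<close> the shift is a quarter period. The
      distortion factors lie between \<open>9/10 * 4/5 = 18/25\<close> and \<open>6/5\<close>, which
      keeps the phase increment in the window from \<open>pi / 4\<close> to
      \<open>3 * pi / 4\<close>.\<close>
    have tk: "t * (h * k0) = pi / 2" using t k0 by (simp add: h_def)
    have 1: "pi / 4 \<le> t * (\<phi> r' - \<phi> r)"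
    proof -
      have "t * (9/10 * h * (4/5 * k0)) = 18/25 * (pi / 2)" unfolding tk[symmetric] by simp
      then show ?thesis using mult_left_mono[OF lo less_imp_le[OF t]] pi_gt_zero by linarith
    qed
    have 2: "t * (\<phi> r' - \<phi> r) \<le> 3 * pi / 4"
    proof -
      have "t * (h * (6/5 * k0)) = 6/5 * (pi / 2)" unfolding tk[symmetric] by simp
      then show ?thesis using mult_left_mono[OF hi less_imp_le[OF t]] pi_gt_zero by linarith
    qed
    show ?thesis
      using sin_squares_shift[OF 1 2, of "t * \<phi> r"] by (simp add: g_def r_def r'_def algebra_simps)
  qed
  have sub: "indicat_real Q \<xi> + indicat_real Q (\<xi> + - ?d) \<le> 2 * indicat_real P \<xi>" for \<xi>
    using h0 s by (auto simp: Q_def P_def mem_cbox_plane split: split_indicator)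
  have "s\<^sup>2 / 32 = measure lborel Q"
    unfolding Q_def using s by (subst measure_cbox_plane) (simp_all add: power2_eq_square)
  then have "s\<^sup>2 / 128 = (\<integral>\<xi>. indicat_real Q \<xi> * (1 / 4) \<partial>lborel)" by simp
  also have "\<dots> \<le> (\<integral>\<xi>. indicat_real Q \<xi> * g \<xi> + indicat_real Q \<xi> * g (\<xi> + ?d) \<partial>lborel)"
    using key iQg fin by (intro integral_mono) (auto split: split_indicator)
  also have "\<dots> = (\<integral>\<xi>. indicat_real Q \<xi> * g \<xi> + indicat_real Q (\<xi> + - ?d) * g \<xi> \<partial>lborel)"
    using iQg tr by simp
  also have "\<dots> \<le> (\<integral>\<xi>. 2 * (indicat_real P \<xi> * g \<xi>) \<partial>lborel)"
  proof (rule integral_mono)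
    fix \<xi> :: "real^2"
    show "indicat_real Q \<xi> * g \<xi> + indicat_real Q (\<xi> + - ?d) * g \<xi> \<le> 2 * (indicat_real P \<xi> * g \<xi>)"
      using mult_right_mono[OF sub g01(1), of \<xi> \<xi>] by (simp add: algebra_simps)
  qed (use iQg tr iP in auto)
  finally have "s\<^sup>2 / 128 \<le> 2 * (\<integral>\<xi>. indicat_real P \<xi> * g \<xi> \<partial>lborel)" by simp
  then show ?thesis by (simp add: P_def g_def)
qed

text \<open>An admissible dyadic box contributes at least \<open>1 / (512 * B^2)\<close>: on it
  \<open>\<phi>^2 \<le> 2 * B^2 * s^2\<close>, against \<open>s^2 / 256\<close> from
  \<open>oscillation_box\<close>. A smaller \<open>\<epsilon>\<close> discards a fixed number of
  large boxes, which raises \<open>T\<close> but leaves \<open>c\<close> unchanged.\<close>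

lemma oscillation_lower_bound:
  fixes \<phi> \<phi>' :: "real \<Rightarrow> real"
  assumes m[measurable]: "\<phi> \<in> borel_measurable borel" and k0: "k0 > 0" and rho: "\<rho> > 0" and B: "B > 0"
    and pos: "\<And>r. 0 < r \<Longrightarrow> 0 < \<phi> r"
    and le: "\<And>r. 0 < r \<Longrightarrow> r \<le> \<rho> \<Longrightarrow> \<phi> r \<le> B * r"
    and d: "\<And>r. 0 < r \<Longrightarrow> r \<le> \<rho> \<Longrightarrow> (\<phi> has_real_derivative \<phi>' r) (at r)"
    and d': "\<And>r. 0 < r \<Longrightarrow> r \<le> \<rho> \<Longrightarrow> 4/5 * k0 \<le> \<phi>' r \<and> \<phi>' r \<le> 6/5 * k0"
  shows "\<exists>c>0. \<forall>\<epsilon>>0. \<exists>T>1. \<forall>t\<ge>T.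
    integrable lborel (\<lambda>\<xi>::real^2. indicat_real (cball 0 \<epsilon>) \<xi> * (sin (t * \<phi> (norm \<xi>)) / \<phi> (norm \<xi>))\<^sup>2) \<and>
    c * ln t \<le> (\<integral>\<xi>. indicat_real (cball 0 \<epsilon>) \<xi> * (sin (t * \<phi> (norm (\<xi>::real^2))) / \<phi> (norm \<xi>))\<^sup>2 \<partial>lborel)"
    (is "\<exists>c>0. \<forall>\<epsilon>>0. \<exists>T>1. \<forall>t\<ge>T. ?P c \<epsilon> t")
proof (rule exI[of _ "1 / (1024 * B\<^sup>2 * ln 2)"], intro conjI allI impI)
  \<comment> \<open>The witness is the contribution \<open>1 / (512 * B^2)\<close> of one box times
    half of \<open>log 2 t / ln t\<close>.\<close>
  show "0 < 1 / (1024 * B\<^sup>2 * ln 2)" using B by simp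
  fix \<epsilon> :: real assume \<epsilon>: "\<epsilon> > 0"
  \<comment> \<open>For \<open>s = (1/2)^k\<close> the requirement
    \<open>pi / (2 * t * k0) \<le> s / 8\<close> reads \<open>2^k \<le> A * t\<close>.\<close>
  define A where "A = k0 / (4 * pi)"
  have A: "A > 0" using k0 by (simp add: A_def)
  obtain k1 where k1: "(1/2) ^ k1 < min \<rho> \<epsilon> / 2"
    using real_arch_pow_inv[of "min \<rho> \<epsilon> / 2" "1/2"] rho \<epsilon> by auto
  define P where "P k = cbox (vector [3/4 * (1/2) ^ k, 0]) (vector [9/8 * (1/2) ^ k, (1/2) ^ k / 8] :: real^2)" for k
  \<comment> \<open>The second entry makes \<open>log 2 (A * t)\<close> nonnegative. The third
    ensures that, despite the indices lost below \<open>k1\<close> and the offset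
    \<open>log 2 A\<close>, at least \<open>log 2 t / 2\<close> boxes remain.\<close>
  define T where "T = max 2 (max (1 / A) (2 powr (2 * (real k1 - log 2 A))))"
  have "?P (1 / (1024 * B\<^sup>2 * ln 2)) \<epsilon> t"
    if t: "t \<ge> T" for t
  proof -
    have t2: "t \<ge> 2" and At: "1 \<le> A * t" and tl: "2 powr (2 * (real k1 - log 2 A)) \<le> t"
      using t A by (auto simp: T_def divide_le_eq mult.commute)
    define g where "g \<xi> = (sin (t * \<phi> (norm \<xi>)) / \<phi> (norm \<xi>))\<^sup>2" for \<xi> :: "real^2"
    have [measurable]: "g \<in> borel_measurable borel" unfolding g_def[abs_def] by measurable
    have g0: "0 \<le> g \<xi>" for \<xi> by (simp add: g_def)
    have gt: "g \<xi> \<le> t\<^sup>2" for \<xi> unfolding g_def by (rule sin_quotient_square_le)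
    have int: "integrable lborel (\<lambda>\<xi>. indicat_real S \<xi> * g \<xi>)"
      if [measurable]: "S \<in> sets borel" and "emeasure lborel S < \<infinity>" for S :: "(real^2) set"
      by (rule Bochner_Integration.integrable_bound[of _ "\<lambda>\<xi>. t\<^sup>2 * indicat_real S \<xi>"])
         (use that(2) gt g0 in \<open>auto simp: integrable_indicator_iff split: split_indicator\<close>)
    have int_ball: "integrable lborel (\<lambda>\<xi>. indicat_real (cball 0 \<epsilon>) \<xi> * g \<xi>)"
      by (rule int) (use emeasure_lborel_cball_finite[of "0::real^2" \<epsilon>] in \<open>auto simp: less_top\<close>)
    have int_P: "integrable lborel (\<lambda>\<xi>. indicat_real (P k) \<xi> * g \<xi>)" for k
      by (rule int) (auto simp: P_def emeasure_lborel_cbox_eq)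
    define m where "m = nat \<lfloor>log 2 (A * t)\<rfloor>"
    have lg: "0 \<le> log 2 (A * t)" using At by simp
    then have mN: "real m \<le> log 2 (A * t)" "log 2 (A * t) < real m + 1"
      unfolding m_def by linarith+
    have box: "1 / (512 * B\<^sup>2) \<le> (\<integral>\<xi>. indicat_real (P k) \<xi> * g \<xi> \<partial>lborel)" if k: "k \<in> {k1..m}" for k
    proof -
      define s :: real where "s = (1/2) ^ k"
      have s0: "s > 0" by (simp add: s_def)
      have "s \<le> (1/2) ^ k1" unfolding s_def using k by (intro power_decreasing) auto
      then have s: "2 * s \<le> \<rho>" using k1 by auto
      have "2 ^ k \<le> A * t"
      proof -
        have "2 powr (real k) \<le> 2 powr (log 2 (A * t))" using mN(1) k by (intro powr_mono) auto
        then show ?thesis using A t2 by (simp add: powr_realpow)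
      qed
      then have "1 / s \<le> A * t" by (simp add: s_def power_divide)
      then have h: "pi / (2 * t * k0) \<le> s / 8"
        using s0 t2 k0 unfolding A_def by (simp add: field_simps)
      have le2: "indicat_real (P k) \<xi> * (sin (t * \<phi> (norm \<xi>)))\<^sup>2 \<le> 2 * B\<^sup>2 * s\<^sup>2 * (indicat_real (P k) \<xi> * g \<xi>)" for \<xi>
      proof (cases "\<xi> \<in> P k")
        case True
        note n = norm_box_plane[OF True[unfolded P_def s_def[symmetric]] s0]
        have n1: "norm \<xi> \<le> \<rho>" using n(3) s by simp
        have "(\<phi> (norm \<xi>))\<^sup>2 \<le> (B * norm \<xi>)\<^sup>2" using pos[OF n(1)] le[OF n(1) n1] by (intro power_mono) auto
        also have "\<dots> \<le> 2 * B\<^sup>2 * s\<^sup>2" using mult_left_mono[OF n(2), of "B\<^sup>2"] by (simp add: power_mult_distrib)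
        finally have "(\<phi> (norm \<xi>))\<^sup>2 * g \<xi> \<le> 2 * B\<^sup>2 * s\<^sup>2 * g \<xi>" by (rule mult_right_mono) (rule g0)
        moreover have "(\<phi> (norm \<xi>))\<^sup>2 * g \<xi> = (sin (t * \<phi> (norm \<xi>)))\<^sup>2"
          using pos[OF n(1)] by (simp add: g_def power_divide)
        ultimately show ?thesis using True by simp
      qed simp
      have "s\<^sup>2 / 256 \<le> (\<integral>\<xi>. indicat_real (P k) \<xi> * (sin (t * \<phi> (norm (\<xi>::real^2))))\<^sup>2 \<partial>lborel)"
        unfolding P_def s_def[symmetric]
        by (rule oscillation_box[OF m k0 rho d d' s0 s _ h]) (use t2 in auto)
      also have "\<dots> \<le> (\<integral>\<xi>. 2 * B\<^sup>2 * s\<^sup>2 * (indicat_real (P k) \<xi> * g \<xi>) \<partial>lborel)"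
        using int_P[of k] le2 by (intro integral_mono') (auto simp: g0)
      also have "\<dots> = 2 * B\<^sup>2 * s\<^sup>2 * (\<integral>\<xi>. indicat_real (P k) \<xi> * g \<xi> \<partial>lborel)" by simp
      finally show ?thesis using s0 B by (simp add: field_simps)
    qed
    have disj: "disjoint_family_on P {k1..m}"
      unfolding disjoint_family_on_def
    proof (intro ballI impI)
      \<comment> \<open>The first coordinates separate the boxes:
        \<open>9/8 * (1/2)^j \<le> 9/16 * (1/2)^i < 3/4 * (1/2)^i\<close>.\<close>
      have *: "P i \<inter> P j = {}" if "i < j" for i j :: nat
      proof -
        have "(1/2) ^ j \<le> (1/2 :: real) ^ Suc i" using that by (intro power_decreasing) auto
        then have "2 * (1/2) ^ j \<le> (1/2 :: real) ^ i" by simp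
        moreover have "0 < (1/2 :: real) ^ j" by simp
        ultimately have "9/8 * (1/2) ^ j < 3/4 * (1/2 :: real) ^ i" by linarith
        then show ?thesis by (auto simp: P_def mem_cbox_plane)
      qed
      fix i j :: nat assume "i \<noteq> j"
      then show "P i \<inter> P j = {}" using *[of i j] *[of j i] by (cases "i < j") auto
    qed
    have sub: "(\<Union>k\<in>{k1..m}. P k) \<subseteq> cball 0 \<epsilon>"
    proof
      fix \<xi> assume "\<xi> \<in> (\<Union>k\<in>{k1..m}. P k)"
      then obtain k where k: "k \<ge> k1" "\<xi> \<in> P k" by auto
      define s :: real where "s = (1/2) ^ k"
      have s0: "s > 0" by (simp add: s_def)
      have "s \<le> (1/2) ^ k1" unfolding s_def using k by (intro power_decreasing) auto
      then have s: "2 * s \<le> \<epsilon>" using k1 by auto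
      show "\<xi> \<in> cball 0 \<epsilon>"
        using norm_box_plane(3)[OF k(2)[unfolded P_def s_def[symmetric]] s0] s by simp
    qed
    have "1 / (1024 * B\<^sup>2 * ln 2) * ln t = 1 / (512 * B\<^sup>2) * (log 2 t / 2)"
      by (simp add: log_def)
    also have "\<dots> \<le> 1 / (512 * B\<^sup>2) * real (card {k1..m})"
    proof (rule mult_left_mono)
      have "log 2 (2 powr (2 * (real k1 - log 2 A))) \<le> log 2 t"
        using tl t2 by (subst log_le_cancel_iff) auto
      then have "2 * (real k1 - log 2 A) \<le> log 2 t" by simp
      moreover have "log 2 (A * t) = log 2 A + log 2 t" using A t2 by (simp add: log_def ln_mult add_divide_distrib)
      ultimately have "log 2 t / 2 \<le> real m + 1 - real k1" using mN(2) by simp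
      \<comment> \<open>The cardinality is \<open>m + 1 - k1\<close> in truncated subtraction, hence
        never below the real difference.\<close>
      then show "log 2 t / 2 \<le> real (card {k1..m})" by simp
    qed simp
    also have "\<dots> = (\<Sum>k\<in>{k1..m}. 1 / (512 * B\<^sup>2))" by simp
    also have "\<dots> \<le> (\<Sum>k\<in>{k1..m}. (\<integral>\<xi>. indicat_real (P k) \<xi> * g \<xi> \<partial>lborel))"
      by (intro sum_mono box)
    also have "\<dots> = (\<integral>\<xi>. (\<Sum>k\<in>{k1..m}. indicat_real (P k) \<xi> * g \<xi>) \<partial>lborel)"
      by (rule Bochner_Integration.integral_sum[symmetric]) (rule int_P)
    also have "\<dots> = (\<integral>\<xi>. indicat_real (\<Union>k\<in>{k1..m}. P k) \<xi> * g \<xi> \<partial>lborel)"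
      by (simp only: indicator_UN_disjoint[OF finite_atLeastAtMost disj] sum_distrib_right)
    also have "\<dots> \<le> (\<integral>\<xi>. indicat_real (cball 0 \<epsilon>) \<xi> * g \<xi> \<partial>lborel)"
      using sub g0 by (intro integral_mono'[OF int_ball] mult_right_mono)
        (auto split: split_indicator)
    finally show ?thesis using int_ball unfolding g_def by (intro conjI)
  qed
  moreover have "T > 1" by (simp add: T_def)
  ultimately show "\<exists>T>1. \<forall>t\<ge>T. ?P (1 / (1024 * B\<^sup>2 * ln 2)) \<epsilon> t"
    by blast
qed

section \<open>The dispersion relation and the estimates\<close>

lemma bessel_weight_factor_ge_1:
  fixes \<xi> :: "'a::euclidean_space"
  assumes "0 \<le> s"
  shows "1 \<le> (1 + (norm \<xi>)\<^sup>2) powr (s / 2)"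
  using assms by (intro ge_one_powr_ge_zero) auto

lemma bessel_weight_measurable [measurable]:
  assumes [measurable]: "g \<in> borel_measurable borel"
  shows "bessel_weight s g \<in> borel_measurable borel"
  unfolding bessel_weight_def[abs_def] by measurable

lemma sobolev_L2: "f \<in> sobolev s \<Longrightarrow> f \<in> L2"
  by (simp add: sobolev_def)

lemma sobolev_diff:
  assumes f: "f \<in> sobolev s" and g: "g \<in> sobolev s"
  shows "(\<lambda>x. f x - g x) \<in> sobolev s"
proof -
  note fg = sobolev_L2[OF f] sobolev_L2[OF g]
  note [measurable] = L2_measurable[OF fourier_L2[OF L2_diff(1)[OF fg]]]
  have a: "(\<lambda>\<xi>. bessel_weight s (fourier f) \<xi> - bessel_weight s (fourier g) \<xi>) \<in> L2"
    using f g by (intro L2_diff(1)) (auto simp: sobolev_def)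
  have b: "AE \<xi> in lborel. bessel_weight s (fourier f) \<xi> - bessel_weight s (fourier g) \<xi>
      = bessel_weight s (fourier (\<lambda>x. f x - g x)) \<xi>"
    using fourier_diff_AE[OF fg] by eventually_elim (simp add: bessel_weight_def right_diff_distrib)
  have "bessel_weight s (fourier (\<lambda>x. f x - g x)) \<in> L2"
    by (rule L2_cong_AE[OF a _ b]) (simp, measurable)
  then show ?thesis using L2_diff(1)[OF fg] by (simp add: sobolev_def)
qed

lemma sobolev_cmult:
  assumes f: "f \<in> sobolev s"
  shows "(\<lambda>x. c * f x) \<in> sobolev s"
proof -
  note f2 = sobolev_L2[OF f]
  note [measurable] = L2_measurable[OF fourier_L2[OF L2_cmult(1)[OF f2, of c]]]
  have a: "(\<lambda>\<xi>. c * bessel_weight s (fourier f) \<xi>) \<in> L2"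
    using f by (intro L2_cmult(1)) (auto simp: sobolev_def)
  have b: "AE \<xi> in lborel. c * bessel_weight s (fourier f) \<xi> = bessel_weight s (fourier (\<lambda>x. c * f x)) \<xi>"
    using fourier_cmult_AE[OF f2, of c] by eventually_elim (simp add: bessel_weight_def)
  have "bessel_weight s (fourier (\<lambda>x. c * f x)) \<in> L2"
    by (rule L2_cong_AE[OF a _ b]) (simp, measurable)
  then show ?thesis using L2_cmult(1)[OF f2] by (simp add: sobolev_def)
qed

lemma sobolev_mono:
  fixes f :: "'a::euclidean_space \<Rightarrow> complex"
  assumes f: "f \<in> sobolev s" and "s' \<le> s"
  shows "f \<in> sobolev s'"
proof -
  note [measurable] = L2_measurable[OF fourier_L2[OF sobolev_L2[OF f]]]
  have "bessel_weight s' (fourier f) \<in> L2"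
  proof (rule L2_mono(1))
    show "bessel_weight s (fourier f) \<in> L2" using f by (simp add: sobolev_def)
    have "(1 + (norm \<xi>)\<^sup>2) powr (s' / 2) \<le> (1 + (norm \<xi>)\<^sup>2) powr (s / 2)" for \<xi> :: 'a
      using assms(2) by (intro powr_mono) auto
    then show "AE \<xi> in lborel. cmod (bessel_weight s' (fourier f) \<xi>) \<le> cmod (bessel_weight s (fourier f) \<xi>)"
      by (intro AE_I2) (simp add: bessel_weight_def norm_mult mult_right_mono)
  qed (simp, measurable)
  then show ?thesis using sobolev_L2[OF f] by (simp add: sobolev_def)
qed

lemma L2_norm_fourier_le_sobolev_norm:
  fixes f :: "'a::euclidean_space \<Rightarrow> complex"
  assumes f: "f \<in> sobolev s" and "0 \<le> s"
  shows "L2_norm (fourier f) \<le> sobolev_norm s f"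
  unfolding sobolev_norm_def
proof (rule L2_mono(2))
  show "bessel_weight s (fourier f) \<in> L2" using f by (simp add: sobolev_def)
  show "fourier f \<in> borel_measurable lborel" by (intro L2_measurable fourier_L2 sobolev_L2[OF f])
  show "AE \<xi> in lborel. cmod (fourier f \<xi>) \<le> cmod (bessel_weight s (fourier f) \<xi>)"
    using mult_right_mono[OF bessel_weight_factor_ge_1[OF assms(2)] norm_ge_zero]
    by (intro AE_I2) (simp add: bessel_weight_def norm_mult)
qed

lemma fourier_tendsto_of_continuous_in_sobolev:
  assumes w: "continuous_in_sobolev s w" and s: "0 \<le> s" and t: "0 \<le> t"
  shows "((\<lambda>r. L2_norm (\<lambda>\<xi>. fourier (w r) \<xi> - fourier (w t) \<xi>)) \<longlongrightarrow> 0) (at t within {0..})"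
proof (rule Lim_null_comparison)
  have ws: "w r \<in> sobolev s" if "r \<ge> 0" for r using w that by (simp add: continuous_in_sobolev_def)
  show "((\<lambda>r. sobolev_norm s (\<lambda>x. w r x - w t x)) \<longlongrightarrow> 0) (at t within {0..})"
    using w t by (simp add: continuous_in_sobolev_def)
  have "norm (L2_norm (\<lambda>\<xi>. fourier (w r) \<xi> - fourier (w t) \<xi>)) \<le> sobolev_norm s (\<lambda>x. w r x - w t x)" if r: "r \<ge> 0" for r
  proof -
    note d = sobolev_diff[OF ws[OF r] ws[OF t]]
    note L2 = sobolev_L2[OF ws[OF r]] sobolev_L2[OF ws[OF t]]
    have "L2_norm (\<lambda>\<xi>. fourier (w r) \<xi> - fourier (w t) \<xi>) = L2_norm (fourier (\<lambda>x. w r x - w t x))"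
      using fourier_diff_AE[OF L2]
      by (intro L2_norm_cong_AE L2_measurable L2_diff(1) fourier_L2 L2) (auto elim: eventually_mono)
    then show ?thesis using L2_norm_fourier_le_sobolev_norm[OF d s] by simp
  qed
  then show "\<forall>\<^sub>F r in at t within {0..}. norm (L2_norm (\<lambda>\<xi>. fourier (w r) \<xi> - fourier (w t) \<xi>))
      \<le> sobolev_norm s (\<lambda>x. w r x - w t x)"
    by (auto simp: eventually_at_filter)
qed

lemma fourier_time_derivative:
  assumes d: "has_sobolev_time_derivative s w v" and s: "0 \<le> s" and t: "0 \<le> t"
    and w: "\<And>r. r \<ge> 0 \<Longrightarrow> w r \<in> sobolev s" and v: "v t \<in> sobolev s"
  shows "((\<lambda>r. L2_norm (\<lambda>\<xi>. of_real (inverse (r - t)) * (fourier (w r) \<xi> - fourier (w t) \<xi>) - fourier (v t) \<xi>)) \<longlongrightarrow> 0)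
    (at t within {0..})"
proof (rule Lim_null_comparison)
  show "((\<lambda>r. sobolev_norm s (\<lambda>x. (w r x - w t x) /\<^sub>R (r - t) - v t x)) \<longlongrightarrow> 0) (at t within {0..})"
    using d t by (simp add: has_sobolev_time_derivative_def)
  have "norm (L2_norm (\<lambda>\<xi>. of_real (inverse (r - t)) * (fourier (w r) \<xi> - fourier (w t) \<xi>) - fourier (v t) \<xi>))
      \<le> sobolev_norm s (\<lambda>x. (w r x - w t x) /\<^sub>R (r - t) - v t x)" if r: "r \<ge> 0" for r
  proof -
    let ?c = "complex_of_real (inverse (r - t))"
    have eq: "(\<lambda>x. (w r x - w t x) /\<^sub>R (r - t) - v t x) = (\<lambda>x. ?c * (w r x - w t x) - v t x)"
      by (simp add: scaleR_conv_of_real)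
    note sd = sobolev_diff[OF w[OF r] w[OF t]]
    note q = sobolev_diff[OF sobolev_cmult[OF sd, of ?c] v]
    note L2 = sobolev_L2[OF w[OF r]] sobolev_L2[OF w[OF t]] sobolev_L2[OF sd] sobolev_L2[OF sobolev_cmult[OF sd, of ?c]]
      sobolev_L2[OF v] sobolev_L2[OF q]
    have "AE \<xi> in lborel. ?c * (fourier (w r) \<xi> - fourier (w t) \<xi>) - fourier (v t) \<xi>
        = fourier (\<lambda>x. ?c * (w r x - w t x) - v t x) \<xi>"
      using fourier_diff_AE[OF L2(1,2)] fourier_cmult_AE[OF L2(3), of ?c] fourier_diff_AE[OF L2(4,5)]
      by eventually_elim simp
    then have "L2_norm (\<lambda>\<xi>. ?c * (fourier (w r) \<xi> - fourier (w t) \<xi>) - fourier (v t) \<xi>)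
        = L2_norm (fourier (\<lambda>x. ?c * (w r x - w t x) - v t x))"
      by (intro L2_norm_cong_AE L2_measurable L2_diff(1) L2_cmult(1) fourier_L2 L2)
    then show ?thesis using L2_norm_fourier_le_sobolev_norm[OF q s] unfolding eq by simp
  qed
  then show "\<forall>\<^sub>F r in at t within {0..}.
      norm (L2_norm (\<lambda>\<xi>. of_real (inverse (r - t)) * (fourier (w r) \<xi> - fourier (w t) \<xi>) - fourier (v t) \<xi>))
      \<le> sobolev_norm s (\<lambda>x. (w r x - w t x) /\<^sub>R (r - t) - v t x)"
    by (auto simp: eventually_at_filter)
qed

section \<open>The dispersion relation near the origin and at high frequency\<close>

definition dispersion :: "real \<Rightarrow> real \<Rightarrow> real \<Rightarrow> real \<Rightarrow> real \<Rightarrow> real" where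
  "dispersion \<delta> \<mu> \<kappa> \<theta> r = sqrt ((\<mu> * r ^ 4 + \<kappa> * r\<^sup>2) / (1 + \<delta> * r powr (2 * \<theta>)))"

locale plate_parameters =
  fixes \<delta> \<mu> \<kappa> \<theta> :: real
  assumes pars: "\<delta> > 0" "\<mu> > 0" "\<kappa> > 0" "0 < \<theta>" "\<theta> \<le> 2"
begin

abbreviation \<phi> where "\<phi> \<equiv> dispersion \<delta> \<mu> \<kappa> \<theta>"

lemma dispersion_measurable [measurable]: "\<phi> \<in> borel_measurable borel"
  unfolding dispersion_def[abs_def] by measurable

lemma denominator_ge_1: "1 \<le> 1 + \<delta> * r powr (2 * \<theta>)"
  using pars by simp

lemma dispersion_pos: "0 < r \<Longrightarrow> 0 < \<phi> r"
  using pars denominator_ge_1[of r] by (simp add: dispersion_def add_pos_pos)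

lemma dispersion_square: "(\<phi> r)\<^sup>2 = (\<mu> * r ^ 4 + \<kappa> * r\<^sup>2) / (1 + \<delta> * r powr (2 * \<theta>))"
  using pars denominator_ge_1[of r] by (simp add: dispersion_def)

lemma denominator_dispersion_square: "(1 + \<delta> * r powr (2 * \<theta>)) * (\<phi> r)\<^sup>2 = \<mu> * r ^ 4 + \<kappa> * r\<^sup>2"
  using denominator_ge_1[of r] unfolding dispersion_square by (simp add: nonzero_mult_div_cancel_left)

lemma dispersion_square_le: "(\<phi> r)\<^sup>2 \<le> \<mu> * r ^ 4 + \<kappa> * r\<^sup>2"
  using mult_right_mono[OF denominator_ge_1[of r] zero_le_power2[of "\<phi> r"]]
  unfolding denominator_dispersion_square by simp

lemma dispersion_le_linear:
  assumes "0 < r" "r \<le> 1"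
  shows "\<phi> r \<le> sqrt (\<mu> + \<kappa>) * r"
proof (rule power2_le_imp_le)
  have "r ^ 4 \<le> r\<^sup>2" using assms by (intro power_decreasing) auto
  then have "\<mu> * r ^ 4 + \<kappa> * r\<^sup>2 \<le> (\<mu> + \<kappa>) * r\<^sup>2"
    using pars by (simp add: distrib_right)
  then show "(\<phi> r)\<^sup>2 \<le> (sqrt (\<mu> + \<kappa>) * r)\<^sup>2"
    using dispersion_square_le[of r] pars by (simp add: power_mult_distrib)
qed (use assms pars in simp)

lemma dispersion_low:
  assumes "0 \<le> r" "r \<le> 1"
  shows "\<kappa> / (1 + \<delta>) * r\<^sup>2 \<le> (\<phi> r)\<^sup>2"
proof -
  have "r powr (2 * \<theta>) \<le> 1" using assms pars by (intro powr_le1) auto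
  then have "1 + \<delta> * r powr (2 * \<theta>) \<le> 1 + \<delta>" using pars by simp
  from mult_right_mono[OF this zero_le_power2[of "\<phi> r"]]
  have "\<mu> * r ^ 4 + \<kappa> * r\<^sup>2 \<le> (1 + \<delta>) * (\<phi> r)\<^sup>2"
    unfolding denominator_dispersion_square .
  moreover have "0 \<le> \<mu> * r ^ 4" using pars by simp
  ultimately have "\<kappa> * r\<^sup>2 \<le> (1 + \<delta>) * (\<phi> r)\<^sup>2" by linarith
  then show ?thesis using pars by (simp add: field_simps)
qed

text \<open>As \<open>\<theta> \<le> 2\<close>, the denominator grows no faster than
  \<open>r^4\<close>, which the term \<open>\<mu> * r^4\<close> compensates. The frequency thus
  stays away from 0 and the sine quotient is bounded uniformly in \<open>t\<close>.\<close>

lemma dispersion_high: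
  assumes "1 \<le> r"
  shows "\<mu> / (1 + \<delta>) \<le> (\<phi> r)\<^sup>2"
proof -
  have "r powr (2 * \<theta>) \<le> r powr (real 4)" using assms pars by (intro powr_mono) auto
  then have p: "r powr (2 * \<theta>) \<le> r ^ 4" using assms by (subst (asm) powr_realpow) auto
  have r4: "1 \<le> r ^ 4" using assms by simp
  have "1 + \<delta> * r powr (2 * \<theta>) \<le> r ^ 4 + \<delta> * r ^ 4" using p r4 pars by (intro add_mono mult_left_mono) auto
  then have "1 + \<delta> * r powr (2 * \<theta>) \<le> (1 + \<delta>) * r ^ 4" by (simp add: distrib_right)
  from mult_right_mono[OF this zero_le_power2[of "\<phi> r"]]
  have "\<mu> * r ^ 4 + \<kappa> * r\<^sup>2 \<le> (1 + \<delta>) * r ^ 4 * (\<phi> r)\<^sup>2"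
    unfolding denominator_dispersion_square .
  moreover have "0 \<le> \<kappa> * r\<^sup>2" using pars by simp
  ultimately have "r ^ 4 * \<mu> \<le> r ^ 4 * ((1 + \<delta>) * (\<phi> r)\<^sup>2)" by (simp add: mult_ac)
  then have "\<mu> \<le> (1 + \<delta>) * (\<phi> r)\<^sup>2" using r4 by (subst (asm) mult_le_cancel_left_pos) auto
  then show ?thesis using pars by (simp add: field_simps)
qed

text \<open>For \<open>r > 0\<close> the relation is \<open>r * sqrt (G r)\<close>, with
  \<open>G\<close> tending to \<open>\<kappa>\<close> at 0. For \<open>\<theta> < 1/2\<close> the
  derivative of \<open>G\<close> blows up like \<open>r powr (2 * \<theta> - 1)\<close>, but it
  enters only multiplied by \<open>r\<close>.\<close>

lemma dispersion_derivative:
  obtains \<phi>' \<rho> where "0 < \<rho>" "\<rho> \<le> 1"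
    "\<And>r. 0 < r \<Longrightarrow> (\<phi> has_real_derivative \<phi>' r) (at r)"
    "\<And>r. 0 < r \<Longrightarrow> r \<le> \<rho> \<Longrightarrow> 4/5 * sqrt \<kappa> \<le> \<phi>' r \<and> \<phi>' r \<le> 6/5 * sqrt \<kappa>"
proof -
  define D where "D r = 1 + \<delta> * r powr (2 * \<theta>)" for r
  define G where "G r = (\<mu> * r\<^sup>2 + \<kappa>) / D r" for r
  define G' where "G' r = (2 * \<mu> * r * D r - (\<mu> * r\<^sup>2 + \<kappa>) * (\<delta> * (2 * \<theta> * r powr (2 * \<theta> - 1)))) / (D r)\<^sup>2" for r
  define \<phi>' where "\<phi>' r = sqrt (G r) + r * G' r / (2 * sqrt (G r))" for r
  have D1: "1 \<le> D r" for r unfolding D_def by (rule denominator_ge_1)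
  have Gpos: "0 < G r" for r
    using D1[of r] pars by (simp add: G_def add_nonneg_pos)
  have eq: "\<phi> r = r * sqrt (G r)" if "0 < r" for r
  proof -
    have "(\<mu> * r ^ 4 + \<kappa> * r\<^sup>2) / D r = r\<^sup>2 * G r"
      by (simp add: G_def algebra_simps power2_eq_square power4_eq_xxxx)
    then show ?thesis using that by (simp add: dispersion_def D_def real_sqrt_mult)
  qed
  have dG: "(G has_real_derivative G' r) (at r)" if r: "0 < r" for r
  proof -
    have dD: "(D has_real_derivative \<delta> * (2 * \<theta> * r powr (2 * \<theta> - 1))) (at r)"
      unfolding D_def[abs_def] using r by (auto intro!: derivative_eq_intros)
    have dN: "((\<lambda>r. \<mu> * r\<^sup>2 + \<kappa>) has_real_derivative 2 * \<mu> * r) (at r)"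
      by (auto intro!: derivative_eq_intros)
    have "D r \<noteq> 0" using D1[of r] by simp
    from DERIV_divide[OF dN dD this] show ?thesis
      unfolding G_def[abs_def] G'_def by (simp add: power2_eq_square)
  qed
  have d: "(\<phi> has_real_derivative \<phi>' r) (at r)" if r: "0 < r" for r
  proof -
    have "((\<lambda>r. r * sqrt (G r)) has_real_derivative \<phi>' r) (at r)"
      using dG[OF r] Gpos[of r] unfolding \<phi>'_def
      by (auto intro!: derivative_eq_intros simp: field_simps)
    moreover have "eventually (\<lambda>x. x \<in> {0<..}) (nhds r)"
      using r by (intro eventually_nhds_in_open) auto
    then have "eventually (\<lambda>x. \<phi> x = x * sqrt (G x)) (nhds r)"
      by eventually_elim (use eq in auto)
    ultimately show ?thesis
      by (subst DERIV_cong_ev[OF refl _ refl])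
  qed
  have powr0: "((\<lambda>r. r powr (2 * \<theta>)) \<longlongrightarrow> 0) (at_right 0)"
    using pars tendsto_powr'[of "\<lambda>r. r" 0 "at_right 0" "\<lambda>_. 2 * \<theta>" "2 * \<theta>"]
    by (auto simp: eventually_at_right_less intro!: tendsto_eq_intros eventually_mono[OF eventually_at_right_less])
  have id0: "((\<lambda>r::real. r) \<longlongrightarrow> 0) (at_right 0)" by (rule tendsto_ident_at)
  have D0: "(D \<longlongrightarrow> 1) (at_right 0)"
    unfolding D_def[abs_def] using tendsto_add[OF tendsto_const tendsto_mult_right_zero[OF powr0, of \<delta>], of 1] by simp
  have G0: "(G \<longlongrightarrow> \<kappa>) (at_right 0)"
  proof -
    have "((\<lambda>r. (\<mu> * r\<^sup>2 + \<kappa>) / D r) \<longlongrightarrow> (\<mu> * 0\<^sup>2 + \<kappa>) / 1) (at_right 0)"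
      by (intro tendsto_intros D0 id0) simp
    then show ?thesis by (simp add: G_def[abs_def])
  qed
  have rG0: "((\<lambda>r. r * G' r) \<longlongrightarrow> 0) (at_right 0)"
  proof -
    have "((\<lambda>r. (2 * \<mu> * r\<^sup>2 * D r - (\<mu> * r\<^sup>2 + \<kappa>) * (\<delta> * (2 * \<theta> * r powr (2 * \<theta>)))) / (D r)\<^sup>2) \<longlongrightarrow>
       (2 * \<mu> * 0\<^sup>2 * 1 - (\<mu> * 0\<^sup>2 + \<kappa>) * (\<delta> * (2 * \<theta> * 0))) / 1\<^sup>2) (at_right 0)"
      by (intro tendsto_intros D0 id0 powr0) simp
    moreover have "eventually (\<lambda>r. (2 * \<mu> * r\<^sup>2 * D r - (\<mu> * r\<^sup>2 + \<kappa>) * (\<delta> * (2 * \<theta> * r powr (2 * \<theta>)))) / (D r)\<^sup>2 = r * G' r) (at_right 0)"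
      using eventually_at_right_less[of "0::real"]
    proof eventually_elim
      case (elim r)
      then have "r powr (2 * \<theta>) = r * r powr (2 * \<theta> - 1)" by (simp add: powr_diff)
      then show ?case by (simp add: G'_def power2_eq_square algebra_simps)
    qed
    ultimately show ?thesis by (simp add: tendsto_cong)
  qed
  have "(\<phi>' \<longlongrightarrow> sqrt \<kappa> + 0 / (2 * sqrt \<kappa>)) (at_right 0)"
    unfolding \<phi>'_def[abs_def] by (intro tendsto_intros G0 rG0) (use pars in simp)
  then have lim: "(\<phi>' \<longlongrightarrow> sqrt \<kappa>) (at_right 0)" by simp
  have sk: "0 < sqrt \<kappa>" using pars by simp
  \<comment> \<open>A tolerance of one fifth is small enough for the phase increments in
    \<open>oscillation_box\<close> to stay within the window of
    \<open>sin_squares_shift\<close>.\<close>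
  have "eventually (\<lambda>r. dist (\<phi>' r) (sqrt \<kappa>) < sqrt \<kappa> / 5) (at_right 0)"
    using tendstoD[OF lim, of "sqrt \<kappa> / 5"] sk by simp
  then obtain b where b: "b > 0" "\<And>r. 0 < r \<Longrightarrow> r < b \<Longrightarrow> dist (\<phi>' r) (sqrt \<kappa>) < sqrt \<kappa> / 5"
    by (auto simp: eventually_at_right_field)
  show thesis
  proof (rule that[of "min 1 (b / 2)" \<phi>'])
    fix r assume r: "0 < r" "r \<le> min 1 (b / 2)"
    then have "dist (\<phi>' r) (sqrt \<kappa>) < sqrt \<kappa> / 5" using b by (intro b(2)) auto
    then show "4/5 * sqrt \<kappa> \<le> \<phi>' r \<and> \<phi>' r \<le> 6/5 * sqrt \<kappa>"
      unfolding dist_real_def by linarith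
  qed (use b d in auto)
qed


lemma dispersion_locally_bounded: "\<exists>M. \<forall>\<xi>::'a::euclidean_space. \<xi> \<noteq> 0 \<longrightarrow> norm \<xi> \<le> R \<longrightarrow> \<phi> (norm \<xi>) \<le> M"
proof (intro exI allI impI)
  fix \<xi> :: 'a assume "norm \<xi> \<le> R"
  then have "\<mu> * norm \<xi> ^ 4 + \<kappa> * (norm \<xi>)\<^sup>2 \<le> \<mu> * R ^ 4 + \<kappa> * R\<^sup>2"
    using pars by (intro add_mono mult_left_mono power_mono) auto
  then have "(\<phi> (norm \<xi>))\<^sup>2 \<le> \<mu> * R ^ 4 + \<kappa> * R\<^sup>2" using dispersion_square_le[of "norm \<xi>"] by linarith
  then show "\<phi> (norm \<xi>) \<le> sqrt (\<mu> * R ^ 4 + \<kappa> * R\<^sup>2)" by (rule real_le_rsqrt)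
qed

text \<open>The proof turns \<open>mild_solution\<close> into an \<open>oscillator_family\<close>:
  Sobolev norms dominate the \<open>L2\<close> norms of transforms because the weight is at least 1,
  and initial values that agree almost everywhere have equal transforms.\<close>

lemma mild_solution_fourier:
  fixes u0 u1 :: "'a::euclidean_space \<Rightarrow> complex"
  assumes sol: "mild_solution \<delta> \<mu> \<kappa> \<theta> u0 u1 u"
    and u0: "u0 \<in> sobolev 2" and u1: "u1 \<in> sobolev \<theta>" and t: "0 \<le> t"
  shows "u t \<in> L2"
    and "AE \<xi> in lborel. fourier (u t) \<xi> = of_real (cos (t * \<phi> (norm \<xi>))) * fourier u0 \<xi>
      + of_real (sin (t * \<phi> (norm \<xi>)) / \<phi> (norm \<xi>)) * fourier u1 \<xi>"
proof -
  from sol obtain v where uc: "continuous_in_sobolev 2 u" and ud: "has_sobolev_time_derivative \<theta> u v"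
    and vc: "continuous_in_sobolev \<theta> v" and i0: "AE x in lborel. u 0 x = u0 x" and i1: "AE x in lborel. v 0 x = u1 x"
    and eq: "\<And>t g. t \<ge> 0 \<Longrightarrow> bessel_weight 2 g \<in> L2 \<Longrightarrow>
      multiplier_pairing (\<lambda>r. 1 + \<delta> * r powr (2 * \<theta>)) (\<lambda>x. v t x - u1 x) g
       + integral {0..t} (\<lambda>s. multiplier_pairing (\<lambda>r. \<mu> * r ^ 4 + \<kappa> * r\<^sup>2) (u s) g) = 0"
    unfolding mild_solution_def by auto
  have us: "u r \<in> sobolev 2" if "r \<ge> 0" for r using uc that by (simp add: continuous_in_sobolev_def)
  have vs: "v r \<in> sobolev \<theta>" if "r \<ge> 0" for r using vc that by (simp add: continuous_in_sobolev_def)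
  \<comment> \<open>\<open>\<theta> \<le> 2\<close> embeds the space of \<open>u\<close> into the
    one in which its time derivative is taken.\<close>
  have us': "u r \<in> sobolev \<theta>" if "r \<ge> 0" for r by (rule sobolev_mono[OF us[OF that] pars(5)])
  note u2 = sobolev_L2[OF us] and v2 = sobolev_L2[OF vs] and u12 = sobolev_L2[OF u1]
  have f0: "fourier (u 0) = fourier u0"
    by (rule fourier_cong_AE[OF L2_measurable[OF u2] L2_measurable[OF sobolev_L2[OF u0]] i0]) simp
  have f1: "fourier (v 0) = fourier u1"
    by (rule fourier_cong_AE[OF L2_measurable[OF v2] L2_measurable[OF u12] i1]) simp
  interpret oscillator_family "\<lambda>\<xi>::'a. \<phi> (norm \<xi>)" "\<lambda>\<xi>::'a. 1 + \<delta> * norm \<xi> powr (2 * \<theta>)"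
    "\<lambda>t. fourier (u t)" "\<lambda>t. fourier (v t)"
  proof
    show "(\<lambda>\<xi>::'a. \<phi> (norm \<xi>)) \<in> borel_measurable borel" by measurable
    show "(\<lambda>\<xi>::'a. 1 + \<delta> * norm \<xi> powr (2 * \<theta>)) \<in> borel_measurable borel" by measurable
    show "0 < \<phi> (norm \<xi>)" if "\<xi> \<noteq> 0" for \<xi> :: 'a using that by (intro dispersion_pos) simp
    show "\<exists>M. \<forall>\<xi>::'a. \<xi> \<noteq> 0 \<longrightarrow> norm \<xi> \<le> R \<longrightarrow> \<phi> (norm \<xi>) \<le> M" for R
      by (rule dispersion_locally_bounded)
    show "1 \<le> 1 + \<delta> * norm \<xi> powr (2 * \<theta>)" for \<xi> :: 'a by (rule denominator_ge_1)
    fix t :: real assume t: "0 \<le> t"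
    show "fourier (u t) \<in> L2" "fourier (v t) \<in> L2" using u2[OF t] v2[OF t] by simp_all
    show "((\<lambda>r. L2_norm (\<lambda>\<xi>. fourier (u r) \<xi> - fourier (u t) \<xi>)) \<longlongrightarrow> 0) (at t within {0..})"
      by (rule fourier_tendsto_of_continuous_in_sobolev[OF uc _ t]) simp
    show "((\<lambda>r. L2_norm (\<lambda>\<xi>. fourier (v r) \<xi> - fourier (v t) \<xi>)) \<longlongrightarrow> 0) (at t within {0..})"
      by (rule fourier_tendsto_of_continuous_in_sobolev[OF vc _ t]) (use pars in simp)
    show "((\<lambda>r. L2_norm (\<lambda>\<xi>. of_real (inverse (r - t)) * (fourier (u r) \<xi> - fourier (u t) \<xi>) - fourier (v t) \<xi>)) \<longlongrightarrow> 0)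
      (at t within {0..})"
      by (rule fourier_time_derivative[OF ud _ t us' vs[OF t]]) (use pars in auto)
    fix k :: "'a \<Rightarrow> complex" assume k: "test_function k"
    have [measurable]: "k \<in> borel_measurable borel" using k by (simp add: test_function_def)
    \<comment> \<open>The conjugate appears because \<open>multiplier_pairing\<close> conjugates its
      test function and \<open>pairing\<close> does not. At order 2 the Bessel factor is the
      polynomial \<open>1 + |\<xi>|^2\<close>, bounded on the support of \<open>k\<close>.\<close>
    have bw: "bessel_weight 2 (\<lambda>\<xi>. cnj (k \<xi>)) \<in> L2"
    proof -
      have "test_function (\<lambda>\<xi>::'a. of_real (1 + (norm \<xi>)\<^sup>2) * k \<xi>)"
      proof (rule test_function_mult[OF k])
        fix R :: real
        have "\<bar>1 + (norm \<xi>)\<^sup>2\<bar> \<le> 1 + R\<^sup>2" if "norm \<xi> \<le> R" for \<xi> :: 'a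
          using power_mono[OF that, of 2] by simp
        then show "\<exists>M. \<forall>\<xi>::'a. \<xi> \<noteq> 0 \<longrightarrow> norm \<xi> \<le> R \<longrightarrow> \<bar>1 + (norm \<xi>)\<^sup>2\<bar> \<le> M" by blast
      qed measurable
      from L2_cnj(1)[OF test_function_L2[OF this]] show ?thesis
        by (simp add: bessel_weight_def[abs_def] powr_one)
    qed
    note d2 = L2_diff(1)[OF v2[OF t] u12]
    have ae: "AE \<xi> in lborel. fourier (\<lambda>x. v t x - u1 x) \<xi> = fourier (v t) \<xi> - fourier (v 0) \<xi>"
      using fourier_diff_AE[OF v2[OF t] u12] by (simp add: f1)
    have m[measurable]: "fourier (\<lambda>x. v t x - u1 x) \<in> borel_measurable borel" "fourier (v t) \<in> borel_measurable borel"
      "fourier (v 0) \<in> borel_measurable borel"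
      using L2_measurable[OF fourier_L2[OF d2]] L2_measurable[OF fourier_L2[OF v2[OF t]]]
        L2_measurable[OF fourier_L2[OF v2[of 0]]] by simp_all
    have p1: "multiplier_pairing (\<lambda>r. 1 + \<delta> * r powr (2 * \<theta>)) (\<lambda>x. v t x - u1 x) (\<lambda>\<xi>. cnj (k \<xi>))
        = pairing (\<lambda>\<xi>. fourier (v t) \<xi> - fourier (v 0) \<xi>) (\<lambda>\<xi>. of_real (1 + \<delta> * norm \<xi> powr (2 * \<theta>)) * k \<xi>)"
      unfolding multiplier_pairing_def pairing_def
    proof (rule integral_cong_AE)
      show "AE \<xi> in lborel. of_real (1 + \<delta> * norm \<xi> powr (2 * \<theta>)) * fourier (\<lambda>x. v t x - u1 x) \<xi> * cnj (cnj (k \<xi>))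
        = (fourier (v t) \<xi> - fourier (v 0) \<xi>) * (of_real (1 + \<delta> * norm \<xi> powr (2 * \<theta>)) * k \<xi>)"
        using ae by eventually_elim simp
    qed measurable
    have p2: "multiplier_pairing (\<lambda>r. \<mu> * r ^ 4 + \<kappa> * r\<^sup>2) (u s) (\<lambda>\<xi>. cnj (k \<xi>))
      = pairing (fourier (u s)) (\<lambda>\<xi>. of_real ((1 + \<delta> * norm \<xi> powr (2 * \<theta>)) * (\<phi> (norm \<xi>))\<^sup>2) * k \<xi>)" for s
      unfolding multiplier_pairing_def pairing_def denominator_dispersion_square
      by (simp add: mult_ac)
    show "pairing (\<lambda>\<xi>. fourier (v t) \<xi> - fourier (v 0) \<xi>) (\<lambda>\<xi>. of_real (1 + \<delta> * norm \<xi> powr (2 * \<theta>)) * k \<xi>)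
      + integral {0..t} (\<lambda>s. pairing (fourier (u s)) (\<lambda>\<xi>. of_real ((1 + \<delta> * norm \<xi> powr (2 * \<theta>)) * (\<phi> (norm \<xi>))\<^sup>2) * k \<xi>)) = 0"
      using eq[OF t bw] unfolding p1 p2 .
  qed
  show "u t \<in> L2" by (rule u2[OF t])
  show "AE \<xi> in lborel. fourier (u t) \<xi> = of_real (cos (t * \<phi> (norm \<xi>))) * fourier u0 \<xi>
      + of_real (sin (t * \<phi> (norm \<xi>)) / \<phi> (norm \<xi>)) * fourier u1 \<xi>"
    using solution_formula[OF t] by (simp add: f0 f1)
qed

section \<open>Estimates for the term driven by \<open>u1\<close>\<close>

definition sine_part :: "real \<Rightarrow> ('a::euclidean_space \<Rightarrow> complex) \<Rightarrow> 'a \<Rightarrow> complex" where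
  "sine_part t g \<xi> = of_real (sin (t * \<phi> (norm \<xi>)) / \<phi> (norm \<xi>)) * g \<xi>"

lemma sin_quotient_square_mult_le: "(sin (t * \<phi> r) / \<phi> r)\<^sup>2 * (\<phi> r)\<^sup>2 \<le> 1"
  by (cases "\<phi> r = 0") (simp_all add: power_divide abs_square_le_1)

lemma sine_part_L2:
  fixes g :: "'a::euclidean_space \<Rightarrow> complex"
  assumes g: "g \<in> L2"
  shows "sine_part t g \<in> L2"
proof (rule L2_mono(1)[OF L2_cmult(1)[OF g, of "of_real t"]])
  have [measurable]: "g \<in> borel_measurable borel" using L2_measurable[OF g] by simp
  show "sine_part t g \<in> borel_measurable lborel" unfolding sine_part_def[abs_def] by measurable
  show "AE \<xi> in lborel. cmod (sine_part t g \<xi>) \<le> cmod (of_real t * g \<xi>)"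
    by (intro AE_I2) (simp only: sine_part_def norm_mult norm_of_real abs_sin_quotient_le mult_right_mono norm_ge_zero)
qed

text \<open>The cosine factor is at most 1 in modulus, so removing the sine part from the transform
  of \<open>u t\<close> leaves at most the transform of \<open>u0\<close>, for which Plancherel's
  constant cancels. The upper and the lower estimate both reduce to
  \<open>sine_part\<close>.\<close>

lemma solution_norm_bounds:
  fixes u0 u1 :: "'a::euclidean_space \<Rightarrow> complex"
  assumes sol: "mild_solution \<delta> \<mu> \<kappa> \<theta> u0 u1 u"
    and u0: "u0 \<in> sobolev 2" and u1: "u1 \<in> sobolev \<theta>" and t: "0 \<le> t"
  shows "\<bar>L2_norm (u t) - L2_norm (sine_part t (fourier u1)) / plancherel_const TYPE('a)\<bar> \<le> L2_norm u0"
proof -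
  define c where "c = plancherel_const TYPE('a)"
  have c: "c > 0" by (simp add: c_def plancherel_const_pos)
  note ut = mild_solution_fourier[OF assms]
  note U2 = fourier_L2[OF ut(1)] and U02 = fourier_L2[OF sobolev_L2[OF u0]]
  have [measurable]: "fourier u0 \<in> borel_measurable borel" using L2_measurable[OF U02] by simp
  let ?S = "sine_part t (fourier u1)"
  have S2: "?S \<in> L2" by (intro sine_part_L2 fourier_L2 sobolev_L2[OF u1])
  have "L2_norm (\<lambda>\<xi>. fourier (u t) \<xi> - ?S \<xi>) \<le> L2_norm (fourier u0)"
  proof (rule L2_mono(2)[OF U02])
    show "(\<lambda>\<xi>. fourier (u t) \<xi> - ?S \<xi>) \<in> borel_measurable lborel"
      by (intro L2_measurable L2_diff(1) U2 S2)
    show "AE \<xi> in lborel. cmod (fourier (u t) \<xi> - ?S \<xi>) \<le> cmod (fourier u0 \<xi>)"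
      using ut(2) by eventually_elim (auto simp: sine_part_def norm_mult intro!: mult_left_le_one_le)
  qed
  then have "\<bar>L2_norm (fourier (u t)) - L2_norm ?S\<bar> \<le> c * L2_norm u0"
    using L2_norm_diff_ge[OF U2 S2] Plancherel[OF sobolev_L2[OF u0]] by (simp add: c_def)
  also have "L2_norm (fourier (u t)) = c * L2_norm (u t)"
    using Plancherel[OF ut(1)] by (simp add: c_def)
  also have "c * L2_norm (u t) - L2_norm ?S = c * (L2_norm (u t) - L2_norm ?S / c)"
    using c by (simp add: right_diff_distrib)
  finally have "c * \<bar>L2_norm (u t) - L2_norm ?S / c\<bar> \<le> c * L2_norm u0"
    using c by (simp add: abs_mult)
  then show ?thesis using c by (simp add: c_def)
qed

text \<open>Inside the unit ball the transform is bounded by the L^1 norm of \<open>u1\<close>, and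
  the dyadic majorant integrates to order \<open>ln t\<close>; outside it the multiplier is bounded
  and the L^2 norm suffices. Hence both norms on the right.\<close>

lemma sine_part_upper:
  obtains K where "K > 0"
    "\<And>(u1 :: real^2 \<Rightarrow> complex) t. u1 \<in> L2 \<Longrightarrow> integrable lborel u1 \<Longrightarrow> t \<ge> 2 \<Longrightarrow>
      (L2_norm (sine_part t (fourier u1)))\<^sup>2 \<le> K * (L2_norm u1 + L1_norm u1)\<^sup>2 * ln t"
proof -
  \<comment> \<open>Scaling by \<open>m\<close> makes the squared multiplier meet both hypotheses of
    \<open>dyadic_majorant\<close>: \<open>m \<le> 1\<close> serves the bound by \<open>4^N\<close>,
    and \<open>m \<le> \<kappa> / (1 + \<delta>)\<close> the bound by
    \<open>|\<xi>|^-2\<close>.\<close>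
  define m where "m = min 1 (\<kappa> / (1 + \<delta>))"
  have m: "0 < m" "m \<le> 1" "m \<le> \<kappa> / (1 + \<delta>)" using pars by (auto simp: m_def)
  define \<beta> where "\<beta> = 4 * measure lborel (cball (0::real^2) 1)"
  have \<beta>: "\<beta> \<ge> 0" by (simp add: \<beta>_def)
  define c where "c = plancherel_const TYPE(real^2)"
  define b where "b = (1 + \<delta>) / \<mu>"
  have b: "b > 0" using pars by (simp add: b_def)
  define K where "K = \<beta> / m * (3 / ln 2) + b * c\<^sup>2 / ln 2"
  have K: "K > 0" using \<beta> m b plancherel_const_pos[of "TYPE(real^2)"] unfolding K_def c_def
    by (intro add_nonneg_pos) auto
  show thesis
  proof (rule that[OF K])
    fix u1 :: "real^2 \<Rightarrow> complex" and t :: real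
    assume u2: "u1 \<in> L2" and ui: "integrable lborel u1" and t: "t \<ge> 2"
    \<comment> \<open>The smallest \<open>N\<close> with \<open>t \<le> 2^N\<close>, so that
      \<open>t^2 \<le> 4^N\<close>; the majorant then has \<open>N + 1\<close> scales.\<close>
    define N where "N = nat \<lceil>log 2 t\<rceil>"
    have lg1: "1 \<le> log 2 t" using t by (simp add: le_log_iff)
    have N: "log 2 t \<le> real N" "real N \<le> log 2 t + 1" using lg1 unfolding N_def by linarith+
    have tN: "t\<^sup>2 \<le> 4 ^ N"
    proof -
      have "t = 2 powr (log 2 t)" using t by simp
      also have "\<dots> \<le> 2 powr (real N)" using N by (intro powr_mono) auto
      finally have "t \<le> 2 ^ N" by (simp add: powr_realpow)
      then have "t\<^sup>2 \<le> (2 ^ N)\<^sup>2" using t by (intro power_mono) auto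
      then show ?thesis by (simp add: power2_two_power)
    qed
    define H where "H \<xi> = (\<Sum>k\<le>N. 4 ^ Suc k * indicat_real (cball 0 ((1/2) ^ k)) \<xi>)" for \<xi> :: "real^2"
    have Hi: "integrable lborel H" and Hv: "(\<integral>\<xi>. H \<xi> \<partial>lborel) = \<beta> * real (Suc N)"
      unfolding H_def \<beta>_def by (rule dyadic_majorant_integral)+
    have H0: "0 \<le> H \<xi>" for \<xi> unfolding H_def by (intro sum_nonneg) auto
    let ?U = "fourier u1"
    have U2: "?U \<in> L2" by (rule fourier_L2[OF u2])
    have bd: "AE \<xi> in lborel. cmod (?U \<xi>) \<le> L1_norm u1"
      using fourier_eq_fourier_integral_AE[OF u2 ui] norm_fourier_integral_le[OF ui] by (auto elim: eventually_mono)
    have L10: "0 \<le> L1_norm u1" by (simp add: L1_norm_def)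
    let ?R = "\<lambda>\<xi>. (L1_norm u1)\<^sup>2 / m * H \<xi> + b * (cmod (?U \<xi>))\<^sup>2"
    have "AE \<xi> in lborel. (cmod (sine_part t ?U \<xi>))\<^sup>2 \<le> ?R \<xi>"
      using bd
    proof eventually_elim
      case (elim \<xi>)
      let ?s = "(sin (t * \<phi> (norm \<xi>)) / \<phi> (norm \<xi>))\<^sup>2"
      have e: "(cmod (sine_part t ?U \<xi>))\<^sup>2 = ?s * (cmod (?U \<xi>))\<^sup>2"
        by (simp only: sine_part_def norm_mult norm_of_real power_mult_distrib power2_abs)
      show ?case
      proof (cases "norm \<xi> \<le> 1")
        case True
        have "m * ?s \<le> H \<xi>"
          unfolding H_def
        proof (rule dyadic_majorant[OF True])
          have "m * ?s \<le> 1 * ?s" using m by (intro mult_right_mono) auto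
          then show "m * ?s \<le> 4 ^ N" using sin_quotient_square_le[of t "\<phi> (norm \<xi>)"] tN by linarith
          have "m * (norm \<xi>)\<^sup>2 \<le> \<kappa> / (1 + \<delta>) * (norm \<xi>)\<^sup>2" using m by (intro mult_right_mono) auto
          also have "\<dots> \<le> (\<phi> (norm \<xi>))\<^sup>2" using True by (intro dispersion_low) auto
          finally have "?s * (m * (norm \<xi>)\<^sup>2) \<le> ?s * (\<phi> (norm \<xi>))\<^sup>2" by (intro mult_left_mono) auto
          then show "m * ?s * (norm \<xi>)\<^sup>2 \<le> 1"
            using sin_quotient_square_mult_le[of t "norm \<xi>"] by (simp add: mult_ac)
        qed
        then have "?s \<le> H \<xi> / m" using m by (simp add: field_simps)
        then have "?s * (cmod (?U \<xi>))\<^sup>2 \<le> H \<xi> / m * (L1_norm u1)\<^sup>2"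
          using elim H0[of \<xi>] m by (intro mult_mono power_mono) auto
        moreover have "0 \<le> b * (cmod (?U \<xi>))\<^sup>2" using b by simp
        ultimately show ?thesis unfolding e by (simp add: mult_ac)
      next
        case False
        then have h: "\<mu> / (1 + \<delta>) \<le> (\<phi> (norm \<xi>))\<^sup>2" by (intro dispersion_high) simp
        have "?s * (\<mu> / (1 + \<delta>)) \<le> ?s * (\<phi> (norm \<xi>))\<^sup>2" using h by (intro mult_left_mono) auto
        then have "?s * (\<mu> / (1 + \<delta>)) \<le> 1" using sin_quotient_square_mult_le[of t "norm \<xi>"] by linarith
        moreover have "0 < \<mu> / (1 + \<delta>)" using pars by simp
        ultimately have "?s \<le> 1 / (\<mu> / (1 + \<delta>))" by (simp only: pos_le_divide_eq)
        then have "?s \<le> b" by (simp only: b_def divide_divide_eq_right mult_1)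
        then have "?s * (cmod (?U \<xi>))\<^sup>2 \<le> b * (cmod (?U \<xi>))\<^sup>2" by (intro mult_right_mono) auto
        moreover have "0 \<le> (L1_norm u1)\<^sup>2 / m * H \<xi>" using m H0 by simp
        ultimately show ?thesis unfolding e by linarith
      qed
    qed
    moreover have Ri: "integrable lborel ?R" using Hi L2_integrable_square[OF U2] by auto
    ultimately have "(L2_norm (sine_part t ?U))\<^sup>2 \<le> (\<integral>\<xi>. ?R \<xi> \<partial>lborel)"
      unfolding L2_norm_square using L2_integrable_square[OF sine_part_L2[OF U2]] by (intro integral_mono_AE) auto
    also have "\<dots> = (L1_norm u1)\<^sup>2 / m * (\<beta> * real (Suc N)) + b * (L2_norm ?U)\<^sup>2"
      using Hi L2_integrable_square[OF U2] by (simp add: Hv L2_norm_square del: of_nat_Suc)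
    also have "L2_norm ?U = c * L2_norm u1" using Plancherel[OF u2] by (simp add: c_def)
    also have "(L1_norm u1)\<^sup>2 / m * (\<beta> * real (Suc N)) + b * (c * L2_norm u1)\<^sup>2
      \<le> (\<beta> / m * (3 / ln 2) * ln t) * (L2_norm u1 + L1_norm u1)\<^sup>2 + (b * c\<^sup>2 / ln 2 * ln t) * (L2_norm u1 + L1_norm u1)\<^sup>2"
    proof (rule add_mono)
      \<comment> \<open>\<open>N + 1 \<le> log 2 t + 2 \<le> 3 * log 2 t\<close> since
        \<open>t \<ge> 2\<close>; the same condition absorbs the high-frequency term, which carries
        no logarithm of its own.\<close>
      have "real (Suc N) \<le> 3 * log 2 t" using N lg1 by simp
      then have n: "real (Suc N) \<le> 3 / ln 2 * ln t" by (simp add: log_def)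
      have "\<beta> / m * real (Suc N) * (L1_norm u1)\<^sup>2 \<le> \<beta> / m * (3 / ln 2 * ln t) * (L2_norm u1 + L1_norm u1)\<^sup>2"
        using n \<beta> m L10 t by (intro mult_mono mult_left_mono power_mono) auto
      then show "(L1_norm u1)\<^sup>2 / m * (\<beta> * real (Suc N)) \<le> (\<beta> / m * (3 / ln 2) * ln t) * (L2_norm u1 + L1_norm u1)\<^sup>2"
        by (simp add: mult_ac)
      have l: "1 \<le> ln t / ln 2" using lg1 by (simp add: log_def)
      have "b * c\<^sup>2 * 1 * (L2_norm u1)\<^sup>2 \<le> b * c\<^sup>2 * (ln t / ln 2) * (L2_norm u1 + L1_norm u1)\<^sup>2"
        using l b L10 t by (intro mult_mono mult_left_mono power_mono) auto
      then show "b * (c * L2_norm u1)\<^sup>2 \<le> (b * c\<^sup>2 / ln 2 * ln t) * (L2_norm u1 + L1_norm u1)\<^sup>2"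
        by (simp add: mult_ac power_mult_distrib)
    qed
    also have "\<dots> = K * (L2_norm u1 + L1_norm u1)\<^sup>2 * ln t"
      by (simp add: K_def algebra_simps)
    finally show "(L2_norm (sine_part t ?U))\<^sup>2 \<le> K * (L2_norm u1 + L1_norm u1)\<^sup>2 * ln t" .
  qed
qed

text \<open>Dominated convergence makes the transform continuous at the origin, where it equals the
  integral of \<open>f\<close>. The radius depends on \<open>f\<close>, but later it affects only
  the time threshold.\<close>

lemma fourier_integral_near_zero:
  fixes f :: "'a::euclidean_space \<Rightarrow> complex"
  assumes f: "integrable lborel f" and P: "(\<integral>x. f x \<partial>lborel) \<noteq> 0"
  obtains \<epsilon> where "\<epsilon> > 0" "\<And>\<xi>. norm \<xi> \<le> \<epsilon> \<Longrightarrow> cmod (\<integral>x. f x \<partial>lborel) / 2 \<le> cmod (fourier_integral f \<xi>)"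
proof -
  note [measurable] = borel_measurable_integrable[OF f]
  have "isCont (fourier_integral f) 0"
    unfolding continuous_at_sequentially comp_def
  proof (intro allI impI)
    fix x :: "nat \<Rightarrow> 'a" assume x: "x \<longlonglongrightarrow> 0"
    show "(\<lambda>n. fourier_integral f (x n)) \<longlonglongrightarrow> fourier_integral f 0"
      unfolding fourier_integral_def
    proof (rule integral_dominated_convergence[where w="\<lambda>y. cmod (f y)"])
      show "AE y in lborel. (\<lambda>n. exp (- (\<i> * of_real (y \<bullet> x n))) * f y) \<longlonglongrightarrow> exp (- (\<i> * of_real (y \<bullet> 0))) * f y"
        by (intro AE_I2 tendsto_intros x)
    qed (use f in \<open>auto simp: norm_mult\<close>)
  qed
  moreover have F0: "fourier_integral f 0 = (\<integral>x. f x \<partial>lborel)" by (simp add: fourier_integral_def)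
  ultimately have "isCont (\<lambda>\<xi>. cmod (fourier_integral f \<xi>)) 0" by (intro continuous_intros)
  then obtain d where d: "d > 0" "\<And>\<xi>. dist \<xi> 0 < d \<Longrightarrow>
      dist (cmod (fourier_integral f \<xi>)) (cmod (fourier_integral f 0)) < cmod (\<integral>x. f x \<partial>lborel) / 2"
    using P unfolding continuous_at_eps_delta by (metis half_gt_zero zero_less_norm_iff)
  show thesis
  proof (rule that[of "d / 2"])
    fix \<xi> :: 'a assume "norm \<xi> \<le> d / 2"
    then have "dist \<xi> 0 < d" using d(1) by simp
    from d(2)[OF this] show "cmod (\<integral>x. f x \<partial>lborel) / 2 \<le> cmod (fourier_integral f \<xi>)"
      unfolding F0 dist_real_def by linarith
  qed (use d in simp)
qed

lemma sine_part_lower: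
  obtains c where "c > 0"
    "\<And>u1 :: real^2 \<Rightarrow> complex. u1 \<in> L2 \<Longrightarrow> integrable lborel u1 \<Longrightarrow> (\<integral>x. u1 x \<partial>lborel) \<noteq> 0 \<Longrightarrow>
      \<exists>T>1. \<forall>t\<ge>T. c * (cmod (\<integral>x. u1 x \<partial>lborel))\<^sup>2 * ln t \<le> (L2_norm (sine_part t (fourier u1)))\<^sup>2"
proof -
  obtain \<phi>' \<rho> where \<rho>: "0 < \<rho>" "\<rho> \<le> 1"
    and d: "\<And>r. 0 < r \<Longrightarrow> (\<phi> has_real_derivative \<phi>' r) (at r)"
    and d': "\<And>r. 0 < r \<Longrightarrow> r \<le> \<rho> \<Longrightarrow> 4/5 * sqrt \<kappa> \<le> \<phi>' r \<and> \<phi>' r \<le> 6/5 * sqrt \<kappa>"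
    by (rule dispersion_derivative) blast
  have "\<exists>c>0. \<forall>\<epsilon>>0. \<exists>T>1. \<forall>t\<ge>T.
    integrable lborel (\<lambda>\<xi>::real^2. indicat_real (cball 0 \<epsilon>) \<xi> * (sin (t * \<phi> (norm \<xi>)) / \<phi> (norm \<xi>))\<^sup>2) \<and>
    c * ln t \<le> (\<integral>\<xi>. indicat_real (cball 0 \<epsilon>) \<xi> * (sin (t * \<phi> (norm (\<xi>::real^2))) / \<phi> (norm \<xi>))\<^sup>2 \<partial>lborel)"
    (is "\<exists>c>0. \<forall>\<epsilon>>0. \<exists>T>1. \<forall>t\<ge>T. ?P c \<epsilon> t")
    by (rule oscillation_lower_bound[OF dispersion_measurable _ \<rho>(1) _ dispersion_pos dispersion_le_linear d d'])
       (use pars \<rho> in auto)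
  then obtain c where c: "c > 0" and lb: "\<And>\<epsilon>. \<epsilon> > 0 \<Longrightarrow> \<exists>T>1. \<forall>t\<ge>T. ?P c \<epsilon> t"
    by blast
  show thesis
  proof (rule that[of "c / 4"])
    \<comment> \<open>The quarter is the square of the factor 1/2 in the lower bound for the
      transform near the origin.\<close>
    show "c / 4 > 0" using c by simp
    fix u1 :: "real^2 \<Rightarrow> complex"
    assume u2: "u1 \<in> L2" and ui: "integrable lborel u1" and P: "(\<integral>x. u1 x \<partial>lborel) \<noteq> 0"
    define p where "p = cmod (\<integral>x. u1 x \<partial>lborel)"
    obtain \<epsilon> where \<epsilon>: "\<epsilon> > 0" "\<And>\<xi>. norm \<xi> \<le> \<epsilon> \<Longrightarrow> p / 2 \<le> cmod (fourier_integral u1 \<xi>)"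
      unfolding p_def by (rule fourier_integral_near_zero[OF ui P]) blast
    obtain T where T: "T > 1" and lT: "\<And>t. t \<ge> T \<Longrightarrow> ?P c \<epsilon> t"
      using lb[OF \<epsilon>(1)] by blast
    have "c / 4 * p\<^sup>2 * ln t \<le> (L2_norm (sine_part t (fourier u1)))\<^sup>2" if t: "t \<ge> T" for t
    proof -
      let ?I = "\<lambda>\<xi>::real^2. indicat_real (cball 0 \<epsilon>) \<xi> * (sin (t * \<phi> (norm \<xi>)) / \<phi> (norm \<xi>))\<^sup>2"
      have I: "integrable lborel ?I" "c * ln t \<le> (\<integral>\<xi>. ?I \<xi> \<partial>lborel)" using lT[OF t] by auto
      have "c / 4 * p\<^sup>2 * ln t = p\<^sup>2 / 4 * (c * ln t)" by simp
      also have "\<dots> \<le> p\<^sup>2 / 4 * (\<integral>\<xi>. ?I \<xi> \<partial>lborel)" using I(2) by (intro mult_left_mono) auto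
      also have "\<dots> = (\<integral>\<xi>. p\<^sup>2 / 4 * ?I \<xi> \<partial>lborel)" by simp
      also have "\<dots> \<le> (\<integral>\<xi>. (cmod (sine_part t (fourier u1) \<xi>))\<^sup>2 \<partial>lborel)"
      proof (rule integral_mono_AE)
        show "integrable lborel (\<lambda>\<xi>. p\<^sup>2 / 4 * ?I \<xi>)" using I(1) by (rule integrable_mult_right)
        show "integrable lborel (\<lambda>\<xi>. (cmod (sine_part t (fourier u1) \<xi>))\<^sup>2)"
          by (intro L2_integrable_square sine_part_L2 fourier_L2 u2)
        show "AE \<xi> in lborel. p\<^sup>2 / 4 * ?I \<xi> \<le> (cmod (sine_part t (fourier u1) \<xi>))\<^sup>2"
          using fourier_eq_fourier_integral_AE[OF u2 ui]
        proof eventually_elim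
          case (elim \<xi>)
          let ?s = "(sin (t * \<phi> (norm \<xi>)) / \<phi> (norm \<xi>))\<^sup>2"
          have e: "(cmod (sine_part t (fourier u1) \<xi>))\<^sup>2 = ?s * (cmod (fourier u1 \<xi>))\<^sup>2"
            by (simp only: sine_part_def norm_mult norm_of_real power_mult_distrib power2_abs)
          show ?case
          proof (cases "norm \<xi> \<le> \<epsilon>")
            case True
            then have "(p / 2)\<^sup>2 \<le> (cmod (fourier u1 \<xi>))\<^sup>2"
              unfolding elim by (intro power_mono \<epsilon>(2)) (simp_all add: p_def)
            then have "?s * (p / 2)\<^sup>2 \<le> ?s * (cmod (fourier u1 \<xi>))\<^sup>2" by (intro mult_left_mono) auto
            then show ?thesis unfolding e using True by (simp add: power_divide mult_ac)
          qed simp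
        qed
      qed
      finally show ?thesis by (simp add: L2_norm_square)
    qed
    then show "\<exists>T>1. \<forall>t\<ge>T. c / 4 * (cmod (\<integral>x. u1 x \<partial>lborel))\<^sup>2 * ln t \<le> (L2_norm (sine_part t (fourier u1)))\<^sup>2"
      using T unfolding p_def by blast
  qed
qed

text \<open>The sine part accounts for \<open>sqrt K / c\<close>; the extra 1 in the constant pays
  for \<open>u0\<close> once \<open>sqrt (ln t)\<close> exceeds the ratio of the L^2 norms of
  \<open>u0\<close> and \<open>u1\<close>.\<close>

lemma upper_bound:
  "\<exists>C1>0. \<forall>(u0 :: real ^ 2 \<Rightarrow> complex) u1 u.
        u0 \<in> sobolev 2 \<longrightarrow> u1 \<in> sobolev \<theta> \<longrightarrow> integrable lborel u1 \<longrightarrow>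
        ((AE x in lborel. u1 x = 0) \<longrightarrow> (AE x in lborel. u0 x = 0)) \<longrightarrow>
        mild_solution \<delta> \<mu> \<kappa> \<theta> u0 u1 u \<longrightarrow>
        (\<exists>T>1. \<forall>t\<ge>T. L2_norm (u t) \<le> C1 * (L2_norm u1 + L1_norm u1) * sqrt (ln t))"
proof -
  obtain K where K: "K > 0" and up: "\<And>(u1 :: real^2 \<Rightarrow> complex) t. u1 \<in> L2 \<Longrightarrow> integrable lborel u1 \<Longrightarrow> t \<ge> 2 \<Longrightarrow>
      (L2_norm (sine_part t (fourier u1)))\<^sup>2 \<le> K * (L2_norm u1 + L1_norm u1)\<^sup>2 * ln t"
    by (rule sine_part_upper) blast
  define c where "c = plancherel_const TYPE(real^2)"
  have c: "c > 0" by (simp add: c_def plancherel_const_pos)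
  show ?thesis
  proof (rule exI[of _ "sqrt K / c + 1"], intro conjI allI impI)
    show "0 < sqrt K / c + 1" using c K by (intro add_nonneg_pos) auto
    fix u0 u1 :: "real^2 \<Rightarrow> complex" and u
    assume u0: "u0 \<in> sobolev 2" and u1: "u1 \<in> sobolev \<theta>" and ui: "integrable lborel u1"
      and z: "(AE x in lborel. u1 x = 0) \<longrightarrow> (AE x in lborel. u0 x = 0)"
      and sol: "mild_solution \<delta> \<mu> \<kappa> \<theta> u0 u1 u"
    define I where "I = L2_norm u1 + L1_norm u1"
    have L10: "0 \<le> L1_norm u1" by (simp add: L1_norm_def)
    then have I: "L2_norm u1 \<le> I" "0 \<le> I" by (auto simp: I_def)
    \<comment> \<open>If \<open>u1\<close> vanishes, the quotient is 0 by convention and this entry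
      carries no information; in that case the hypothesis on the data makes \<open>u0\<close> vanish
      as well.\<close>
    define T where "T = max 2 (exp ((L2_norm u0 / L2_norm u1)\<^sup>2))"
    have "L2_norm (u t) \<le> (sqrt K / c + 1) * I * sqrt (ln t)" if t: "t \<ge> T" for t
    proof -
      have t2: "t \<ge> 2" and tT: "exp ((L2_norm u0 / L2_norm u1)\<^sup>2) \<le> t" using t by (auto simp: T_def)
      have l0: "0 \<le> ln t" using t2 by simp
      have "L2_norm (u t) \<le> L2_norm (sine_part t (fourier u1)) / c + L2_norm u0"
        using solution_norm_bounds[OF sol u0 u1, of t] t2 unfolding c_def by linarith
      moreover have "L2_norm (sine_part t (fourier u1)) \<le> sqrt K * I * sqrt (ln t)"
      proof (rule power2_le_imp_le)
        show "(L2_norm (sine_part t (fourier u1)))\<^sup>2 \<le> (sqrt K * I * sqrt (ln t))\<^sup>2"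
          using up[OF sobolev_L2[OF u1] ui t2] K l0 by (simp add: power_mult_distrib I_def)
      qed (use K I l0 in simp)
      then have "L2_norm (sine_part t (fourier u1)) / c \<le> sqrt K * I * sqrt (ln t) / c"
        using c by (intro divide_right_mono) auto
      moreover have "L2_norm u0 \<le> I * sqrt (ln t)"
      proof (cases "L2_norm u1 = 0")
        case True
        then have "AE x in lborel. u0 x = 0" using z L2_norm_eq_0_iff[OF sobolev_L2[OF u1]] by blast
        then have "L2_norm u0 = 0" using L2_norm_eq_0_iff[OF sobolev_L2[OF u0]] by blast
        then show ?thesis using I l0 by simp
      next
        case False
        then have p: "L2_norm u1 > 0" using L2_norm_nonneg[of u1] by linarith
        have "(L2_norm u0 / L2_norm u1)\<^sup>2 \<le> ln t"
          using tT t2 by (subst ln_ge_iff) auto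
        then have "L2_norm u0 / L2_norm u1 \<le> sqrt (ln t)" by (rule real_le_rsqrt)
        then have "L2_norm u0 \<le> L2_norm u1 * sqrt (ln t)" using p by (simp add: field_simps)
        also have "\<dots> \<le> I * sqrt (ln t)" using I l0 by (intro mult_right_mono) auto
        finally show ?thesis .
      qed
      ultimately show ?thesis by (simp add: algebra_simps)
    qed
    moreover have "T > 1" by (simp add: T_def)
    ultimately show "\<exists>T>1. \<forall>t\<ge>T. L2_norm (u t) \<le> (sqrt K / c + 1) * (L2_norm u1 + L1_norm u1) * sqrt (ln t)"
      unfolding I_def by blast
  qed
qed

lemma lower_bound:
  "\<exists>C2>0. \<forall>(u0 :: real ^ 2 \<Rightarrow> complex) u1 u.
          u0 \<in> sobolev 2 \<longrightarrow> u1 \<in> sobolev \<theta> \<longrightarrow> integrable lborel u1 \<longrightarrow>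
          mild_solution \<delta> \<mu> \<kappa> \<theta> u0 u1 u \<longrightarrow>
          (\<exists>T>1. \<forall>t\<ge>T. C2 * cmod (\<integral>x. u1 x \<partial>lborel) * sqrt (ln t) \<le> L2_norm (u t))"
proof -
  obtain k where k: "k > 0" and low: "\<And>u1 :: real^2 \<Rightarrow> complex. u1 \<in> L2 \<Longrightarrow> integrable lborel u1 \<Longrightarrow>
      (\<integral>x. u1 x \<partial>lborel) \<noteq> 0 \<Longrightarrow>
      \<exists>T>1. \<forall>t\<ge>T. k * (cmod (\<integral>x. u1 x \<partial>lborel))\<^sup>2 * ln t \<le> (L2_norm (sine_part t (fourier u1)))\<^sup>2"
    by (rule sine_part_lower) blast
  define c where "c = plancherel_const TYPE(real^2)"
  have c: "c > 0" by (simp add: c_def plancherel_const_pos)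
  \<comment> \<open>Half of the constant for the sine part; the other half outweighs the norm of
    \<open>u0\<close> as soon as \<open>t \<ge> T\<close>.\<close>
  define C where "C = sqrt k / (2 * c)"
  have C: "C > 0" using k c by (simp add: C_def)
  show ?thesis
  proof (rule exI[of _ C], intro conjI allI impI C)
    fix u0 u1 :: "real^2 \<Rightarrow> complex" and u
    assume u0: "u0 \<in> sobolev 2" and u1: "u1 \<in> sobolev \<theta>" and ui: "integrable lborel u1"
      and sol: "mild_solution \<delta> \<mu> \<kappa> \<theta> u0 u1 u"
    define p where "p = cmod (\<integral>x. u1 x \<partial>lborel)"
    show "\<exists>T>1. \<forall>t\<ge>T. C * cmod (\<integral>x. u1 x \<partial>lborel) * sqrt (ln t) \<le> L2_norm (u t)"
    proof (cases "(\<integral>x. u1 x \<partial>lborel) = 0")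
      case True
      then show ?thesis by (intro exI[of _ 2]) simp
    next
      case False
      then have p: "p > 0" by (simp add: p_def)
      obtain T0 where T0: "T0 > 1" and lT: "\<And>t. t \<ge> T0 \<Longrightarrow> k * p\<^sup>2 * ln t \<le> (L2_norm (sine_part t (fourier u1)))\<^sup>2"
        using low[OF sobolev_L2[OF u1] ui False] unfolding p_def by blast
      define T where "T = max T0 (exp ((L2_norm u0 / (C * p))\<^sup>2))"
      have "C * p * sqrt (ln t) \<le> L2_norm (u t)" if t: "t \<ge> T" for t
      proof -
        have t1: "t > 1" "t \<ge> T0" and tT: "exp ((L2_norm u0 / (C * p))\<^sup>2) \<le> t" using t T0 by (auto simp: T_def)
        have l0: "0 \<le> ln t" using t1 by simp
        have "(sqrt k * p * sqrt (ln t))\<^sup>2 \<le> (L2_norm (sine_part t (fourier u1)))\<^sup>2"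
          using lT[OF t1(2)] k l0 by (simp add: power_mult_distrib)
        then have "sqrt k * p * sqrt (ln t) \<le> L2_norm (sine_part t (fourier u1))"
          by (rule power2_le_imp_le) simp
        then have "sqrt k * p * sqrt (ln t) / c \<le> L2_norm (sine_part t (fourier u1)) / c"
          using c by (intro divide_right_mono) auto
        moreover have "sqrt k * p * sqrt (ln t) / c = 2 * (C * p * sqrt (ln t))"
          using c by (simp add: C_def)
        moreover have "L2_norm (sine_part t (fourier u1)) / c - L2_norm u0 \<le> L2_norm (u t)"
          using solution_norm_bounds[OF sol u0 u1, of t] t1 unfolding c_def by linarith
        moreover have "L2_norm u0 \<le> C * p * sqrt (ln t)"
        proof -
          have "(L2_norm u0 / (C * p))\<^sup>2 \<le> ln t" using tT t1 by (subst ln_ge_iff) auto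
          then have "L2_norm u0 / (C * p) \<le> sqrt (ln t)" by (rule real_le_rsqrt)
          then show ?thesis using C p by (simp add: field_simps)
        qed
        ultimately show ?thesis by linarith
      qed
      moreover have "T > 1" using T0 by (simp add: T_def)
      ultimately show ?thesis unfolding p_def by blast
    qed
  qed
qed

end


(* In the upper bound the case "u1 = 0 but u0 nonzero" has to be excluded: there the right-hand
   side vanishes while u(t) does not. *)
theorem theorem1p2:
  fixes \<delta> \<mu> \<kappa> \<theta> :: real
  assumes "\<delta> > 0" and "\<mu> > 0" and "\<kappa> > 0" and "0 < \<theta>" and "\<theta> \<le> 2"
  shows
    "(\<exists>C1>0. \<forall>(u0 :: real ^ 2 \<Rightarrow> complex) u1 u.
        u0 \<in> sobolev 2 \<longrightarrow> u1 \<in> sobolev \<theta> \<longrightarrow> integrable lborel u1 \<longrightarrow>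
        ((AE x in lborel. u1 x = 0) \<longrightarrow> (AE x in lborel. u0 x = 0)) \<longrightarrow>
        mild_solution \<delta> \<mu> \<kappa> \<theta> u0 u1 u \<longrightarrow>
        (\<exists>T>1. \<forall>t\<ge>T. L2_norm (u t) \<le> C1 * (L2_norm u1 + L1_norm u1) * sqrt (ln t)))
     \<and>
     (\<forall>\<gamma>. 0 < \<gamma> \<longrightarrow> \<gamma> \<le> 1 \<longrightarrow>
       (\<exists>C2>0. \<forall>(u0 :: real ^ 2 \<Rightarrow> complex) u1 u.
          u0 \<in> sobolev 2 \<longrightarrow> u1 \<in> sobolev \<theta> \<longrightarrow> u1 \<in> L1_weighted \<gamma> \<longrightarrow>
          mild_solution \<delta> \<mu> \<kappa> \<theta> u0 u1 u \<longrightarrow>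
          (\<exists>T>1. \<forall>t\<ge>T. C2 * cmod (\<integral>x. u1 x \<partial>lborel) * sqrt (ln t) \<le> L2_norm (u t))))"
proof -
  interpret plate_parameters \<delta> \<mu> \<kappa> \<theta> using assms by unfold_locales
  show ?thesis
    by (intro conjI[OF upper_bound] allI impI, rule ex_forward[OF lower_bound]) (simp add: L1_weighted_def)
qed

end
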